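(* Fix $x<0<y$. (i) The hull $\gamma_\tau$ generated on $[0,\tau]$ by upwards SLE$_0(-2,-2)$ started from $(\xi(0),V_1(0),V_2(0))=(0,x,y)$, where $\tau$ is the first hitting time of $\xi$ and one of the $V_j$, is a straight line segment whose angle of intersection with the right-hand side of $\mathbb{R}$ is $\frac{\pi y}{y-x}$, and the images of the force points $V_1(\tau)$ and $V_2(\tau)$ are the two prime ends corresponding to the base of $\gamma_\tau$. (ii) The hull $\tilde\gamma_t$ generated by upwards SLE$_0(-3,-3)$ started from $(\xi(0),V_1(0),V_2(0))=(0,x,y)$ is a circular arc which meets $\mathbb{R}$ orthogonally (a vertical segment in the degenerate case $y=-x$), where $t$ is any time $0<t\le\tau$, with $\tau$ the first hitting time of $\xi$ and one of the $V_j$. At time $\tau$, $V_1(\tau)$ and $V_2(\tau)$ are the two prime ends corresponding to the base of $\tilde\gamma_\tau$.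
   Context: Let $\mathbb{H}$ be the upper half-plane. Upwards SLE$_0(\rho_1,\rho_2)$ starting from $(\xi(0),V_1(0),V_2(0))\in\mathbb{R}^3$ is the upwards Loewner flow $\dot h_t(z)=\frac{-2}{h_t(z)-\xi(t)}$, $h_0(z)=z$, whose driver solves $$\dot\xi(t)=\sum_{j=1}^2\frac{-\rho_j}{\xi(t)-V_j(t)},\qquad \dot V_j(t)=\frac{-2}{V_j(t)-\xi(t)}\ (j=1,2),$$ so that $V_j(t)=h_t(V_j(0))$, run until the first time $\tau$ that $\xi$ hits one of the $V_j$, i.e. $\inf_{t<\tau}|\xi(t)-V_j(t)|=0$ for some $j$. The hull generated on $[0,t]$ is $\mathbb{H}\setminus h_t(\mathbb{H})$; its base is at $\xi(t)\in\mathbb{R}$. The statement that $V_1(\tau),V_2(\tau)$ are the two prime ends corresponding to the base means that the continuous extension of $h_\tau$ sends $V_1(0)=x$ and $V_2(0)=y$ to the left and right prime ends of $\mathbb{H}\setminus\gamma_\tau$ at the base point, so that both force points hit $\xi$ at time $\tau$ and $[x,0]$, $[0,y]$ are mapped to the two sides of the hull. *)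

theory Defs
  imports "HOL-Complex_Analysis.Contour_Integration"
begin

definition uhp :: "complex set" where
  "uhp = {z. Im z > 0}"


section \<open>Upwards SLE(0) with two force points\<close>

text \<open>
  The driver and the force points are considered on the time interval from 0 (included) to
  \<open>\<tau>\<close> (excluded), where \<open>\<tau>\<close> may be infinite. At time 0 the derivatives are one-sided.
  If \<open>\<tau>\<close> is finite, the last clause makes it the first hitting time: by continuity, the infima
  over a shorter interval are positive. If \<open>\<tau>\<close> is infinite, there is no hitting.
\<close>

definition upwards_SLE0 ::
    "real \<Rightarrow> real \<Rightarrow> real \<Rightarrow> real \<Rightarrow> real \<Rightarrow> ereal \<Rightarrow> (real \<Rightarrow> real) \<Rightarrow> (real \<Rightarrow> real) \<Rightarrow> (real \<Rightarrow> real) \<Rightarrow> bool" where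
  "upwards_SLE0 \<rho>1 \<rho>2 x0 v1 v2 \<tau> \<xi> V1 V2 \<longleftrightarrow>
     0 < \<tau> \<and> \<xi> 0 = x0 \<and> V1 0 = v1 \<and> V2 0 = v2 \<and>
     (\<forall>t. 0 \<le> t \<and> ereal t < \<tau> \<longrightarrow>
        \<xi> t \<noteq> V1 t \<and> \<xi> t \<noteq> V2 t \<and>
        (\<xi> has_real_derivative (- \<rho>1 / (\<xi> t - V1 t) + - \<rho>2 / (\<xi> t - V2 t))) (at t within {0..}) \<and>
        (V1 has_real_derivative (-2 / (V1 t - \<xi> t))) (at t within {0..}) \<and>
        (V2 has_real_derivative (-2 / (V2 t - \<xi> t))) (at t within {0..})) \<and>
     (\<tau> < \<infinity> \<longrightarrow>
        (INF t\<in>{t. 0 \<le> t \<and> ereal t < \<tau>}. \<bar>\<xi> t - V1 t\<bar>) = 0 \<or>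
        (INF t\<in>{t. 0 \<le> t \<and> ereal t < \<tau>}. \<bar>\<xi> t - V2 t\<bar>) = 0)"

definition upwards_loewner_flow :: "(real \<Rightarrow> real) \<Rightarrow> ereal \<Rightarrow> (real \<Rightarrow> complex \<Rightarrow> complex) \<Rightarrow> bool" where
  "upwards_loewner_flow \<xi> \<tau> h \<longleftrightarrow>
     (\<forall>z\<in>uhp. h 0 z = z \<and>
        (\<forall>t. 0 \<le> t \<and> ereal t < \<tau> \<longrightarrow>
           h t z \<noteq> of_real (\<xi> t) \<and>
           ((\<lambda>s. h s z) has_vector_derivative (-2 / (h t z - of_real (\<xi> t)))) (at t within {0..})))"

text \<open>
  The differential equations hold before time \<open>\<tau>\<close>. The values at time \<open>\<tau>\<close> itself
  (the driver and the flow map) are limits from the left.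
\<close>

definition upto_time :: "ereal \<Rightarrow> (real \<Rightarrow> 'a::t2_space) \<Rightarrow> real \<Rightarrow> 'a" where
  "upto_time \<tau> f t = (if ereal t < \<tau> then f t else Lim (at_left t) f)"

definition loewner_map :: "ereal \<Rightarrow> (real \<Rightarrow> complex \<Rightarrow> complex) \<Rightarrow> real \<Rightarrow> complex \<Rightarrow> complex" where
  "loewner_map \<tau> h t z = upto_time \<tau> (\<lambda>s. h s z) t"

definition loewner_hull :: "ereal \<Rightarrow> (real \<Rightarrow> complex \<Rightarrow> complex) \<Rightarrow> real \<Rightarrow> complex set" where
  "loewner_hull \<tau> h t = uhp - loewner_map \<tau> h t ` uhp"


section \<open>Segments and circular arcs rooted at a real point\<close>

text \<open>Hulls are subsets of the open half-plane, so the root is removed.\<close>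

definition segment_at_angle :: "complex set \<Rightarrow> real \<Rightarrow> real \<Rightarrow> bool" where
  "segment_at_angle K b \<theta> \<longleftrightarrow>
     (\<exists>p\<in>uhp. K = closed_segment (of_real b) p - {of_real b} \<and> Arg (p - of_real b) = \<theta>)"

definition orthogonal_circular_arc :: "complex set \<Rightarrow> real \<Rightarrow> bool" where
  "orthogonal_circular_arc K b \<longleftrightarrow>
     (\<exists>c r \<phi> \<psi>. r > 0 \<and> \<phi> \<noteq> \<psi> \<and> \<bar>\<psi> - \<phi>\<bar> < 2 * pi \<and>
        pathstart (part_circlepath c r \<phi> \<psi>) = of_real b \<and>
        K = path_image (part_circlepath c r \<phi> \<psi>) - {of_real b} \<and>
        orthogonal (vector_derivative (part_circlepath c r \<phi> \<psi>) (at 0)) 1)"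


section \<open>Prime ends\<close>

text \<open>
  Caratheodory's prime ends via null-chains of crosscuts. The Euclidean diameter is used, so that
  the prime ends obtained are those with bounded null-chains (all prime ends except the
  one at infinity, for the complement of a bounded hull in the half-plane).
  The end points of a crosscut may coincide.
\<close>

definition crosscut :: "complex set \<Rightarrow> complex set \<Rightarrow> bool" where
  "crosscut \<Omega> C \<longleftrightarrow>
     (\<exists>g. simple_path g \<and> g ` {0<..<1} \<subseteq> \<Omega> \<and>
          pathstart g \<in> frontier \<Omega> \<and> pathfinish g \<in> frontier \<Omega> \<and> C = g ` {0<..<1})"

definition separates :: "complex set \<Rightarrow> complex set \<Rightarrow> complex set \<Rightarrow> complex set \<Rightarrow> bool" where
  "separates \<Omega> C A B \<longleftrightarrow>
     (\<exists>U\<in>components (\<Omega> - C). \<exists>V\<in>components (\<Omega> - C). U \<noteq> V \<and> A \<subseteq> U \<and> B \<subseteq> V)"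

definition null_chain :: "complex set \<Rightarrow> (nat \<Rightarrow> complex set) \<Rightarrow> bool" where
  "null_chain \<Omega> C \<longleftrightarrow>
     (\<forall>n. crosscut \<Omega> (C n)) \<and>
     (\<forall>n. closure (C n) \<inter> closure (C (Suc n)) = {}) \<and>
     (\<forall>n. separates \<Omega> (C (Suc n)) (C 0) (C (Suc (Suc n)))) \<and>
     (\<lambda>n. diameter (C n)) \<longlonglongrightarrow> 0"

text \<open>The component of \<open>\<Omega> - C n\<close> on the far side of \<open>C n\<close>, i.e. the one containing \<open>C (Suc n)\<close>.\<close>

definition inner_domain :: "complex set \<Rightarrow> (nat \<Rightarrow> complex set) \<Rightarrow> nat \<Rightarrow> complex set" where
  "inner_domain \<Omega> C n = \<Union>{U \<in> components (\<Omega> - C n). C (Suc n) \<subseteq> U}"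

definition equivalent_chains :: "complex set \<Rightarrow> (nat \<Rightarrow> complex set) \<Rightarrow> (nat \<Rightarrow> complex set) \<Rightarrow> bool" where
  "equivalent_chains \<Omega> C D \<longleftrightarrow>
     (\<forall>m. \<exists>n. inner_domain \<Omega> C n \<subseteq> inner_domain \<Omega> D m) \<and>
     (\<forall>m. \<exists>n. inner_domain \<Omega> D n \<subseteq> inner_domain \<Omega> C m)"

definition prime_end :: "complex set \<Rightarrow> (nat \<Rightarrow> complex set) set \<Rightarrow> bool" where
  "prime_end \<Omega> P \<longleftrightarrow>
     (\<exists>C. null_chain \<Omega> C \<and> P = {D. null_chain \<Omega> D \<and> equivalent_chains \<Omega> C D})"

definition impression :: "complex set \<Rightarrow> (nat \<Rightarrow> complex set) set \<Rightarrow> complex set" where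
  "impression \<Omega> P = (\<Inter>C\<in>P. \<Inter>n. closure (inner_domain \<Omega> C n))"

text \<open>
  The prime ends corresponding to a real boundary point, and what it means for such a prime end
  to be the left (right) one: its neighbourhoods abut the real line immediately to the left (right)
  of the point.
\<close>

definition prime_ends_at :: "complex set \<Rightarrow> real \<Rightarrow> (nat \<Rightarrow> complex set) set set" where
  "prime_ends_at \<Omega> b = {P. prime_end \<Omega> P \<and> impression \<Omega> P = {of_real b}}"

definition left_sided :: "complex set \<Rightarrow> real \<Rightarrow> (nat \<Rightarrow> complex set) set \<Rightarrow> bool" where
  "left_sided \<Omega> b P \<longleftrightarrow>
     (\<forall>C\<in>P. \<forall>n. \<exists>\<delta>>0. complex_of_real ` {b - \<delta><..<b} \<subseteq> closure (inner_domain \<Omega> C n))"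

definition right_sided :: "complex set \<Rightarrow> real \<Rightarrow> (nat \<Rightarrow> complex set) set \<Rightarrow> bool" where
  "right_sided \<Omega> b P \<longleftrightarrow>
     (\<forall>C\<in>P. \<forall>n. \<exists>\<delta>>0. complex_of_real ` {b<..<b + \<delta>} \<subseteq> closure (inner_domain \<Omega> C n))"

text \<open>
  The continuous extension of \<open>g\<close>, from the half-plane into \<open>\<Omega>\<close>, sends the real point \<open>u\<close>
  to the prime end \<open>P\<close> (convergence in the prime end topology).
\<close>

definition sends_to_prime_end ::
    "(complex \<Rightarrow> complex) \<Rightarrow> complex set \<Rightarrow> real \<Rightarrow> (nat \<Rightarrow> complex set) set \<Rightarrow> bool" where
  "sends_to_prime_end g \<Omega> u P \<longleftrightarrow>
     (\<forall>C\<in>P. \<forall>n. \<forall>\<^sub>F z in at (of_real u) within uhp. g z \<in> inner_domain \<Omega> C n)"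

definition maps_to_base_prime_ends :: "(complex \<Rightarrow> complex) \<Rightarrow> complex set \<Rightarrow> real \<Rightarrow> real \<Rightarrow> real \<Rightarrow> bool" where
  "maps_to_base_prime_ends g K b x y \<longleftrightarrow>
     (\<exists>P Q. P \<noteq> Q \<and> prime_ends_at (uhp - K) b = {P, Q} \<and>
        left_sided (uhp - K) b P \<and> right_sided (uhp - K) b Q \<and>
        sends_to_prime_end g (uhp - K) x P \<and> sends_to_prime_end g (uhp - K) y Q)"

text \<open>
  The extension of \<open>g\<close> to the closed half-plane traces out the slit \<open>K\<close>, together with its root
  \<open>b\<close>, once along \<open>[x, w]\<close> and once along \<open>[w, y]\<close>, both \<open>x\<close> and \<open>y\<close> being sent to the root.
\<close>

definition maps_to_two_sides ::
    "(complex \<Rightarrow> complex) \<Rightarrow> complex set \<Rightarrow> real \<Rightarrow> real \<Rightarrow> real \<Rightarrow> real \<Rightarrow> bool" where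
  "maps_to_two_sides g K b x w y \<longleftrightarrow>
     (\<exists>f. continuous_on {z. Im z \<ge> 0} f \<and> (\<forall>z\<in>uhp. f z = g z) \<and>
        f (of_real x) = of_real b \<and> f (of_real y) = of_real b \<and>
        inj_on f (of_real ` {x..w}) \<and> f ` of_real ` {x..w} = insert (of_real b) K \<and>
        inj_on f (of_real ` {w..y}) \<and> f ` of_real ` {w..y} = insert (of_real b) K)"

text \<open>
  The final time \<open>T = \<tau>\<close> is finite, the driver, both force points and the flow
  have limits there, and the force points end up at the two prime ends of the base of the hull.
\<close>

definition force_points_end_at_base ::
    "ereal \<Rightarrow> real \<Rightarrow> (real \<Rightarrow> real) \<Rightarrow> (real \<Rightarrow> real) \<Rightarrow> (real \<Rightarrow> real) \<Rightarrow> (real \<Rightarrow> complex \<Rightarrow> complex) \<Rightarrow> bool" where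
  "force_points_end_at_base \<tau> T \<xi> V1 V2 h \<longleftrightarrow>
     \<tau> = ereal T \<and>
     (\<xi> \<longlongrightarrow> upto_time \<tau> \<xi> T) (at_left T) \<and>
     (V1 \<longlongrightarrow> upto_time \<tau> \<xi> T) (at_left T) \<and>
     (V2 \<longlongrightarrow> upto_time \<tau> \<xi> T) (at_left T) \<and>
     (\<forall>z\<in>uhp. ((\<lambda>t. h t z) \<longlongrightarrow> loewner_map \<tau> h T z) (at_left T)) \<and>
     maps_to_base_prime_ends (loewner_map \<tau> h T) (loewner_hull \<tau> h T) (upto_time \<tau> \<xi> T) (V1 0) (V2 0) \<and>
     maps_to_two_sides (loewner_map \<tau> h T) (loewner_hull \<tau> h T) (upto_time \<tau> \<xi> T) (V1 0) (\<xi> 0) (V2 0)"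

end

theory Submission
  imports Defs "HOL-Complex_Analysis.Conformal_Mappings"
begin

text \<open>
  Both evolutions are explicitly integrable. Write \<open>L = \<xi> - V1\<close>, \<open>R = V2 - \<xi>\<close>.

  For weights -2, the ratio \<open>L / R\<close> and, with \<open>p = - x / (y - x)\<close>, the function
  \<open>(h - V1) powr p * (h - V2) powr (1 - p)\<close> are conserved. At the hitting time this gives
  \<open>h = x + y + (z - x) powr p * (z - y) powr (1 - p)\<close>, which opens up a straight slit.

  For weights -3, put \<open>l = (L + R)\<^sup>2\<close>. Then \<open>R - L = k * l\<close> with \<open>k\<close> constant, and
  \<open>(h - V1) * (h - V2) / (k * (h - \<xi>) + (1 - k\<^sup>2 * l) / 2)\<^sup>2\<close> is conserved. In the coordinate
  \<open>P = Z / (k * Z + (1 - k\<^sup>2 * l) / 2)\<close>, \<open>Z = h - \<xi>\<close>, which is a Moebius automorphism of the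
  half-plane, the flow is the square root map \<open>P\<^sup>2 = \<mu> * P0\<^sup>2 - m\<^sup>2\<close>, so the hull is the Moebius image
  of a vertical segment.

  Both slits are polar graphs around their root \<open>b\<close>, so small circles around \<open>b\<close> are cut
  into exactly two arcs, which form two null-chains. Every null-chain with impression \<open>{b}\<close> is
  equivalent to one of them, by elementary connectedness arguments.
\<close>

section \<open>The upper half-plane\<close>

text \<open>For both weights the conservation law for \<open>L\<close> and \<open>R\<close> forces
  the two gaps to vanish together. The first hitting is therefore simultaneous, its time is an
  explicit constant, and the base is the common limit of \<xi>, \<open>V1\<close> and
  \<open>V2\<close>. The hypotheses say nothing about values at time \<tau> itself, so each law is
  proved before \<tau> and carried over by a limit. This works because \<open>Im (h t z)\<close>
  never decreases, which keeps the limit of \<open>h\<close> inside the open half-plane, where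
  logarithms and quotients stay continuous.

  The two hulls are identified differently. For weights -3 the map is inverted by a square root, so
  its image is computed directly. For weights -2 the explicit map has no such inverse; instead its
  image is shown to be open and closed in the slit domain, by properness and by its boundary values.
  Both cases also need the map on the real axis, in order to speak of the two sides of the slit.

  One polar description serves both slits: the cosine of the polar angle is constant on a segment,
  and proportional to the radius on a circle that meets the real line orthogonally at
  \<open>b\<close>.\<close>

lemma open_uhp: "open uhp"
  unfolding uhp_def by (simp add: open_halfspace_Im_gt)

lemma convex_uhp: "convex uhp"
  unfolding uhp_def by (simp add: convex_halfspace_Im_gt)

text \<open>Turns an eventual statement at a real point into an actual nearby point of the
  half-plane.\<close>

lemma at_within_uhp_neq_bot: "at (of_real u) within uhp \<noteq> bot"
proof -
  have "\<exists>z\<in>uhp. z \<noteq> of_real u \<and> dist z (of_real u) < e" if "0 < e" for e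
    using that by (intro bexI[of _ "Complex u (e / 2)"])
      (auto simp: uhp_def complex_eq_iff dist_norm cmod_def)
  then show ?thesis
    by (simp add: trivial_limit_within islimpt_approachable)
qed

section \<open>Null chains\<close>

text \<open>Since \<Omega> is open, the end points of a crosscut lie outside it. Removing the open
  arc is therefore the same as removing the compact closed arc, which leaves an open set.\<close>

lemma crosscut_topology:
  assumes "crosscut \<Omega> C" "open \<Omega>"
  shows "connected C" "C \<noteq> {}" "C \<subseteq> \<Omega>" "open (\<Omega> - C)"
proof -
  obtain g where g: "simple_path g" "g ` {0<..<1} \<subseteq> \<Omega>"
      "pathstart g \<in> frontier \<Omega>" "pathfinish g \<in> frontier \<Omega>" "C = g ` {0<..<1}"
    using assms(1) unfolding crosscut_def by blast
  have cont: "continuous_on {0..1} g"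
    using g(1) by (simp add: simple_path_def path_def)
  then have "continuous_on {0<..<1} g"
    by (rule continuous_on_subset) auto
  then show "connected C"
    using g(5) by (simp add: connected_continuous_image)
  show "C \<noteq> {}" "C \<subseteq> \<Omega>"
    using g by auto
  have "g 0 \<notin> \<Omega>" "g 1 \<notin> \<Omega>"
    using g(3,4) assms(2) by (auto simp: frontier_def pathstart_def pathfinish_def interior_open)
  moreover have "{0..1} = insert 0 (insert 1 {0<..<1::real})"
    by auto
  ultimately have "\<Omega> - C = \<Omega> - g ` {0..1}"
    using g(5) by auto
  moreover have "closed (g ` {0..1})"
    using cont by (simp add: compact_continuous_image compact_imp_closed)
  ultimately show "open (\<Omega> - C)"
    using assms(2) by (simp add: open_Diff)
qed

text \<open>Lets a crosscut be joined to either of its sides before maximality of components is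
  applied.\<close>

lemma connected_Un_component:
  fixes \<Omega> :: "'a::real_normed_vector set"
  assumes "connected \<Omega>" "connected C" "C \<subseteq> \<Omega>" "open (\<Omega> - C)" "V \<in> components (\<Omega> - C)"
  shows "connected (C \<union> V)"
proof (rule connected_Un_clopen_in_complement)
  show "openin (top_of_set (\<Omega> - C)) V"
    using open_components[OF assms(4,5)] in_components_subset[OF assms(5)]
    by (simp add: openin_open_eq assms(4))
  show "closedin (top_of_set (\<Omega> - C)) V"
    using assms(5) by (simp add: closedin_component)
qed (use assms in auto)

text \<open>The union in \<open>inner_domain\<close> runs over exactly one component, because
  \<open>C (Suc n)\<close> is connected, nonempty and misses \<open>C n\<close>.\<close>

lemma inner_domain_component:
  assumes "null_chain \<Omega> C" "open \<Omega>"
  shows "inner_domain \<Omega> C n \<in> components (\<Omega> - C n)" "C (Suc n) \<subseteq> inner_domain \<Omega> C n"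
proof -
  have cc: "crosscut \<Omega> (C k)" for k
    using assms(1) by (simp add: null_chain_def)
  note top = crosscut_topology[OF cc assms(2)]
  have "closure (C n) \<inter> closure (C (Suc n)) = {}"
    using assms(1) by (simp add: null_chain_def)
  then have "C (Suc n) \<subseteq> \<Omega> - C n"
    using top(3)[of "Suc n"] closure_subset[of "C n"] closure_subset[of "C (Suc n)"] by blast
  moreover from this have "\<Omega> - C n \<noteq> {}"
    using top(2) by blast
  ultimately obtain U where U: "U \<in> components (\<Omega> - C n)" "C (Suc n) \<subseteq> U"
    using exists_component_superset top(1) by metis
  have "U' = U" if "U' \<in> components (\<Omega> - C n)" "C (Suc n) \<subseteq> U'" for U'
  proof -
    have "U' \<inter> U \<noteq> {}"
      using top(2)[of "Suc n"] U(2) that(2) by blast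
    then show ?thesis
      using components_eq[OF that(1) U(1)] by simp
  qed
  then have "{U \<in> components (\<Omega> - C n). C (Suc n) \<subseteq> U} = {U}"
    using U by blast
  then have "inner_domain \<Omega> C n = U"
    by (simp add: inner_domain_def)
  then show "inner_domain \<Omega> C n \<in> components (\<Omega> - C n)" "C (Suc n) \<subseteq> inner_domain \<Omega> C n"
    using U by auto
qed

lemma inner_domain_eqI:
  assumes "null_chain \<Omega> C" "open \<Omega>" "U \<in> components (\<Omega> - C n)" "C (Suc n) \<subseteq> U"
  shows "inner_domain \<Omega> C n = U"
proof -
  have "C (Suc n) \<noteq> {}"
    using assms(1,2) crosscut_topology(2) by (auto simp: null_chain_def)
  then have "inner_domain \<Omega> C n \<inter> U \<noteq> {}"
    using inner_domain_component(2)[OF assms(1,2)] assms(4) by blast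
  then show ?thesis
    using components_eq[OF inner_domain_component(1)[OF assms(1,2)] assms(3)] by simp
qed

text \<open>A null chain only separates \<open>C 0\<close> from later crosscuts, so nesting needs an
  argument. The connected set formed by \<open>C (Suc n)\<close> and its inner domain meets the
  inner domain of \<open>C n\<close>, so it suffices that it avoids \<open>C n\<close>. Otherwise
  \<open>C n\<close>, joined to its side containing \<open>C 0\<close>, would be a connected set off
  \<open>C (Suc n)\<close> that drags \<open>C 0\<close> into the inner domain of
  \<open>C (Suc n)\<close>.\<close>

lemma inner_domain_Suc_subset:
  assumes "null_chain \<Omega> C" "open \<Omega>" "connected \<Omega>"
  shows "inner_domain \<Omega> C (Suc n) \<subseteq> inner_domain \<Omega> C n"
proof -
  define V where "V = inner_domain \<Omega> C"
  have cc: "crosscut \<Omega> (C k)" for k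
    using assms(1) by (simp add: null_chain_def)
  note top = crosscut_topology[OF cc assms(2)]
  note V = inner_domain_component[OF assms(1,2), folded V_def]
  have disj: "C k \<inter> C (Suc k) = {}" for k
    using assms(1) closure_subset[of "C k"] closure_subset[of "C (Suc k)"]
    unfolding null_chain_def by blast
  have sep: "separates \<Omega> (C (Suc k)) (C 0) (C (Suc (Suc k)))" for k
    using assms(1) by (simp add: null_chain_def)
  have V0: "C 0 \<inter> V (Suc k) = {}" for k
  proof -
    obtain U U' where U: "U \<in> components (\<Omega> - C (Suc k))" "U' \<in> components (\<Omega> - C (Suc k))"
        "U \<noteq> U'" "C 0 \<subseteq> U" "C (Suc (Suc k)) \<subseteq> U'"
      using sep[of k] unfolding separates_def by blast
    have "V (Suc k) = U'"
      unfolding V_def by (rule inner_domain_eqI) (use assms U in auto)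
    then show ?thesis
      using components_nonoverlap[OF U(1,2)] U by blast
  qed
  have C_disj: "C n \<inter> V (Suc n) = {}"
  proof (cases n)
    case 0
    then show ?thesis
      using V0 by simp
  next
    case (Suc k)
    obtain U U' where U: "U \<in> components (\<Omega> - C n)" "U' \<in> components (\<Omega> - C n)"
        "U \<noteq> U'" "C 0 \<subseteq> U" "C (Suc n) \<subseteq> U'"
      using sep[of k] Suc unfolding separates_def by blast
    have conn: "connected (C n \<union> U)"
      by (rule connected_Un_component[OF assms(3) top(1,3,4) U(1)])
    have "C n \<union> U \<subseteq> \<Omega> - C (Suc n)"
      using top(3)[of n] disj[of n] in_components_subset[OF U(1)]
        components_nonoverlap[OF U(1,2)] U(3,5) by blast
    moreover have "\<not> C n \<union> U \<subseteq> V (Suc n)"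
      using V0[of n] U(4) top(2)[of 0] by blast
    ultimately show ?thesis
      using components_maximal[OF V(1)[of "Suc n"] conn] by blast
  qed
  have "connected (C (Suc n) \<union> V (Suc n))"
    by (rule connected_Un_component[OF assms(3) top(1,3,4) V(1)])
  moreover have "C (Suc n) \<union> V (Suc n) \<subseteq> \<Omega> - C n"
    using C_disj disj[of n] top(3)[of "Suc n"] in_components_subset[OF V(1)[of "Suc n"]] by blast
  moreover have "V n \<inter> (C (Suc n) \<union> V (Suc n)) \<noteq> {}"
    using V(2)[of n] top(2)[of "Suc n"] by blast
  ultimately have "C (Suc n) \<union> V (Suc n) \<subseteq> V n"
    by (rule components_maximal[OF V(1)[of n]])
  then show ?thesis
    by (simp add: V_def)
qed

lemma inner_domain_antimono:
  assumes "null_chain \<Omega> C" "open \<Omega>" "connected \<Omega>" "m \<le> n"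
  shows "inner_domain \<Omega> C n \<subseteq> inner_domain \<Omega> C m"
  using lift_Suc_antimono_le[of "inner_domain \<Omega> C"] inner_domain_Suc_subset[OF assms(1-3)] assms(4)
  by blast

lemma equivalent_chains_refl: "equivalent_chains \<Omega> C C"
  by (auto simp: equivalent_chains_def)

lemma equivalent_chains_sym: "equivalent_chains \<Omega> C D \<Longrightarrow> equivalent_chains \<Omega> D C"
  by (auto simp: equivalent_chains_def)

lemma equivalent_chains_trans:
  assumes "equivalent_chains \<Omega> C D" "equivalent_chains \<Omega> D E"
  shows "equivalent_chains \<Omega> C E"
proof -
  have "\<exists>n. inner_domain \<Omega> A n \<subseteq> inner_domain \<Omega> A' m"
    if 1: "equivalent_chains \<Omega> A B" and 2: "equivalent_chains \<Omega> B A'" for A B A' m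
  proof -
    obtain k where "inner_domain \<Omega> B k \<subseteq> inner_domain \<Omega> A' m"
      using 2 unfolding equivalent_chains_def by blast
    moreover obtain n where "inner_domain \<Omega> A n \<subseteq> inner_domain \<Omega> B k"
      using 1 unfolding equivalent_chains_def by blast
    ultimately show ?thesis
      by blast
  qed
  then show ?thesis
    using assms equivalent_chains_sym[OF assms(1)] equivalent_chains_sym[OF assms(2)]
    unfolding equivalent_chains_def[of \<Omega> C E] by blast
qed

text \<open>Inner domains of equivalent chains are cofinal in each other, so one representative
  determines the impression.\<close>

lemma impression_eq_Inter_closure:
  assumes "null_chain \<Omega> C"
  shows "impression \<Omega> {D. null_chain \<Omega> D \<and> equivalent_chains \<Omega> C D} =
    (\<Inter>n. closure (inner_domain \<Omega> C n))"
proof -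
  have "(\<Inter>n. closure (inner_domain \<Omega> C n)) \<subseteq> closure (inner_domain \<Omega> D m)"
    if "equivalent_chains \<Omega> C D" for D m
  proof -
    obtain n where "inner_domain \<Omega> C n \<subseteq> inner_domain \<Omega> D m"
      using \<open>equivalent_chains \<Omega> C D\<close> unfolding equivalent_chains_def by blast
    then show ?thesis
      using closure_mono by blast
  qed
  then show ?thesis
    using assms equivalent_chains_refl[of \<Omega> C] unfolding impression_def by blast
qed

section \<open>Slits that are polar graphs over their base\<close>

text \<open>The function \<open>c\<close> gives the cosine of the polar angle around \<open>b\<close> in terms of the radius.\<close>

definition polar_slit :: "real \<Rightarrow> real \<Rightarrow> (real \<Rightarrow> real) \<Rightarrow> complex set" where
  "polar_slit b m c = {z \<in> uhp. cmod (z - of_real b) \<le> m \<and>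
     Re (z - of_real b) = cmod (z - of_real b) * c (cmod (z - of_real b))}"

definition polar_pt :: "real \<Rightarrow> real \<Rightarrow> real \<Rightarrow> complex" where
  "polar_pt b s v = of_real b + of_real s * Complex v (sqrt (1 - v\<^sup>2))"

lemma cmod_polar_pt:
  assumes "0 \<le> s" "\<bar>v\<bar> \<le> 1"
  shows "cmod (polar_pt b s v - of_real b) = s"
proof -
  have "cmod (Complex v (sqrt (1 - v\<^sup>2))) = 1"
    using assms(2) by (simp add: cmod_def abs_square_le_1)
  then show ?thesis
    using assms(1) by (simp add: polar_pt_def norm_mult)
qed

lemma Re_polar_pt: "Re (polar_pt b s v - of_real b) = s * v"
  by (simp add: polar_pt_def)

lemma Im_polar_pt: "Im (polar_pt b s v) = s * sqrt (1 - v\<^sup>2)"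
  by (simp add: polar_pt_def)

lemma polar_pt_in_uhp: "0 < s \<Longrightarrow> \<bar>v\<bar> < 1 \<Longrightarrow> polar_pt b s v \<in> uhp"
  by (simp add: uhp_def Im_polar_pt abs_square_less_1)

lemma eq_polar_pt:
  assumes "Im z \<ge> 0" "z \<noteq> of_real b"
  defines "s \<equiv> cmod (z - of_real b)"
  shows "z = polar_pt b s (Re (z - of_real b) / s)"
proof -
  have "s > 0"
    using assms by simp
  have "(Im z)\<^sup>2 = s\<^sup>2 - (Re (z - of_real b))\<^sup>2"
    unfolding s_def by (simp add: cmod_power2)
  then have "1 - (Re (z - of_real b) / s)\<^sup>2 = (Im z / s)\<^sup>2"
    using \<open>s > 0\<close> by (simp add: field_simps power2_eq_square)
  then have "sqrt (1 - (Re (z - of_real b) / s)\<^sup>2) = Im z / s"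
    using assms(1) \<open>s > 0\<close> by simp
  then show ?thesis
    using \<open>s > 0\<close> by (simp add: polar_pt_def complex_eq_iff)
qed

lemma abs_Re_div_cmod_less_1:
  assumes "z \<in> uhp"
  shows "\<bar>Re (z - of_real b) / cmod (z - of_real b)\<bar> < 1" "0 < cmod (z - of_real b)"
proof -
  have "0 < Im (z - of_real b)"
    using assms by (simp add: uhp_def)
  then have "(Re (z - of_real b))\<^sup>2 < (cmod (z - of_real b))\<^sup>2"
    unfolding cmod_power2 by simp
  then have "\<bar>Re (z - of_real b)\<bar> < cmod (z - of_real b)"
    by (metis abs_ge_zero norm_ge_zero power2_abs power_less_imp_less_base)
  then show "0 < cmod (z - of_real b)" "\<bar>Re (z - of_real b) / cmod (z - of_real b)\<bar> < 1"
    by (linarith, simp only: abs_divide abs_norm_cancel)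
      (metis abs_ge_zero divide_less_eq_1_pos le_less_trans)
qed

lemma continuous_on_polar_pt [continuous_intros]:
  "continuous_on S f \<Longrightarrow> continuous_on S g \<Longrightarrow> continuous_on S (\<lambda>x. polar_pt b (f x) (g x))"
  unfolding polar_pt_def Complex_eq
  by (intro continuous_intros) auto

text \<open>The strict bound on \<open>c\<close> leaves room on both sides of the slit at every
  radius up to \<open>m\<close>.\<close>

locale polar_slit_domain =
  fixes b m :: real and c :: "real \<Rightarrow> real"
  assumes m_pos: "0 < m"
    and c_cont: "continuous_on UNIV c"
    and c_bound: "0 \<le> s \<Longrightarrow> s \<le> m \<Longrightarrow> \<bar>c s\<bar> < 1"
begin

definition \<Omega> :: "complex set" where
  "\<Omega> = uhp - polar_slit b m c"

text \<open>Which side of the slit a point lies on: negative to the left, positive to the right.\<close>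

definition offset :: "complex \<Rightarrow> real" where
  "offset z = Re (z - of_real b) - cmod (z - of_real b) * c (cmod (z - of_real b))"

definition side :: "real \<Rightarrow> real \<Rightarrow> complex set" where
  "side \<sigma> r = {z \<in> uhp. cmod (z - of_real b) < r \<and> 0 < \<sigma> * offset z}"

definition cut :: "real \<Rightarrow> real \<Rightarrow> complex set" where
  "cut \<sigma> r = {z \<in> uhp. cmod (z - of_real b) = r \<and> 0 < \<sigma> * offset z}"

text \<open>At radius \<open>s\<close> this moves the cosine linearly from the slit
  (\<open>t = 0\<close>) to the real axis (\<open>t = 1\<close>). It makes each side of the slit the
  continuous image of an open rectangle, which is how the sides are seen to be connected.\<close>

definition interp :: "real \<Rightarrow> real \<Rightarrow> real \<Rightarrow> real" where
  "interp \<sigma> s t = c s + t * (\<sigma> - c s)"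

definition cut_path :: "real \<Rightarrow> real \<Rightarrow> real \<Rightarrow> complex" where
  "cut_path \<sigma> r t = polar_pt b r (interp \<sigma> r t)"

lemma \<Omega>_altdef: "\<Omega> = {z \<in> uhp. cmod (z - of_real b) \<le> m \<longrightarrow> offset z \<noteq> 0}"
  by (auto simp: \<Omega>_def polar_slit_def offset_def)

lemma continuous_offset [continuous_intros]: "continuous_on S offset"
  unfolding offset_def
  by (intro continuous_intros continuous_on_compose2[OF c_cont]) auto

lemma offset_polar_pt: "0 \<le> s \<Longrightarrow> \<bar>v\<bar> \<le> 1 \<Longrightarrow> offset (polar_pt b s v) = s * (v - c s)"
  unfolding offset_def by (simp only: cmod_polar_pt Re_polar_pt) (simp add: algebra_simps)

lemma interp_bounds:
  assumes "\<bar>\<sigma>\<bar> = 1" "0 \<le> s" "s \<le> m" "0 \<le> t" "t < 1"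
  shows "\<bar>interp \<sigma> s t\<bar> < 1" "0 < t \<Longrightarrow> 0 < \<sigma> * (interp \<sigma> s t - c s)"
proof -
  have c: "\<bar>c s\<bar> < 1"
    using c_bound assms by blast
  have "interp \<sigma> s t = (1 - t) * c s + t * \<sigma>"
    by (simp add: interp_def algebra_simps)
  then have "\<bar>interp \<sigma> s t\<bar> \<le> (1 - t) * \<bar>c s\<bar> + t"
    using assms by (metis abs_mult abs_of_nonneg abs_triangle_ineq diff_ge_0_iff_ge less_imp_le mult.right_neutral)
  also have "\<dots> < (1 - t) * 1 + t"
    using c assms by (intro add_strict_right_mono mult_strict_left_mono) auto
  finally show "\<bar>interp \<sigma> s t\<bar> < 1"
    by simp
  have "\<sigma> = 1 \<or> \<sigma> = -1"
    using assms(1) by linarith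
  then have "0 < \<sigma> * (\<sigma> - c s)"
    using c by auto
  then show "0 < t \<Longrightarrow> 0 < \<sigma> * (interp \<sigma> s t - c s)"
    using mult_pos_pos[of t "\<sigma> * (\<sigma> - c s)"] by (simp add: interp_def algebra_simps)
qed

lemma eq_polar_pt_interp:
  assumes "\<bar>\<sigma>\<bar> = 1" "z \<in> uhp" "cmod (z - of_real b) \<le> m" "0 < \<sigma> * offset z"
  shows "\<exists>t\<in>{0<..<1}. z = polar_pt b (cmod (z - of_real b)) (interp \<sigma> (cmod (z - of_real b)) t)"
proof -
  define s v where "s = cmod (z - of_real b)" and "v = Re (z - of_real b) / s"
  define t where "t = (v - c s) / (\<sigma> - c s)"
  have s: "0 < s" "\<bar>v\<bar> < 1"
    using abs_Re_div_cmod_less_1[OF assms(2)] by (auto simp: s_def v_def)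
  have c: "\<bar>c s\<bar> < 1"
    using c_bound s assms s_def by auto
  have "offset z = s * (v - c s)"
    using s(1) unfolding offset_def v_def s_def[symmetric] right_diff_distrib by simp
  then have "0 < s * (\<sigma> * (v - c s))"
    using assms(4) by (simp only: mult.left_commute)
  then have pos: "0 < \<sigma> * (v - c s)"
    using s(1) by (simp add: zero_less_mult_iff)
  have \<sigma>: "\<sigma> = 1 \<or> \<sigma> = -1"
    using assms(1) by linarith
  have "t \<in> {0<..<1}"
    using \<sigma> pos c s(2) by (auto simp: t_def divide_simps)
  moreover have "interp \<sigma> s t = v"
    using \<sigma> c by (auto simp: interp_def t_def)
  moreover have "z = polar_pt b s v"
    using eq_polar_pt[of z b] assms(2) s(1) by (auto simp: s_def v_def uhp_def)
  ultimately show ?thesis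
    unfolding s_def by metis
qed

lemma polar_pt_interp_mem:
  assumes "\<bar>\<sigma>\<bar> = 1" "0 < s" "s \<le> m" "t \<in> {0<..<1}"
  shows "polar_pt b s (interp \<sigma> s t) \<in> cut \<sigma> s"
proof -
  have "\<bar>interp \<sigma> s t\<bar> < 1" "0 < s * (\<sigma> * (interp \<sigma> s t - c s))"
    using interp_bounds[of \<sigma> s t] assms by auto
  then show ?thesis
    using assms by (auto simp: cut_def polar_pt_in_uhp cmod_polar_pt offset_polar_pt algebra_simps)
qed

lemma side_eq_image:
  assumes "\<bar>\<sigma>\<bar> = 1" "r \<le> m"
  shows "side \<sigma> r = (\<lambda>(s, t). polar_pt b s (interp \<sigma> s t)) ` ({0<..<r} \<times> {0<..<1})"
    (is "_ = ?R")
proof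
  show "side \<sigma> r \<subseteq> ?R"
  proof
    fix z assume z: "z \<in> side \<sigma> r"
    then obtain t where "t \<in> {0<..<1}" "z = polar_pt b (cmod (z - of_real b)) (interp \<sigma> (cmod (z - of_real b)) t)"
      using eq_polar_pt_interp[of \<sigma> z] assms by (auto simp: side_def)
    moreover have "cmod (z - of_real b) \<in> {0<..<r}"
      using z abs_Re_div_cmod_less_1(2)[of z b] by (simp add: side_def)
    ultimately show "z \<in> ?R"
      by (intro image_eqI[of _ _ "(cmod (z - of_real b), t)"]) auto
  qed
  show "?R \<subseteq> side \<sigma> r"
    using polar_pt_interp_mem[OF assms(1)] assms(2) by (fastforce simp: side_def cut_def)
qed

lemma cut_eq_image:
  assumes "\<bar>\<sigma>\<bar> = 1" "0 < r" "r \<le> m"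
  shows "cut \<sigma> r = cut_path \<sigma> r ` {0<..<1}"
proof
  show "cut \<sigma> r \<subseteq> cut_path \<sigma> r ` {0<..<1}"
    using eq_polar_pt_interp[of \<sigma>] assms by (force simp: cut_def cut_path_def)
  show "cut_path \<sigma> r ` {0<..<1} \<subseteq> cut \<sigma> r"
    using polar_pt_interp_mem assms by (auto simp: cut_path_def)
qed

lemma connected_side:
  assumes "\<bar>\<sigma>\<bar> = 1" "r \<le> m"
  shows "connected (side \<sigma> r)"
  unfolding side_eq_image[OF assms]
proof (rule connected_continuous_image)
  show "continuous_on ({0<..<r} \<times> {0<..<1}) (\<lambda>(s, t). polar_pt b s (interp \<sigma> s t))"
    unfolding interp_def case_prod_unfold
    by (intro continuous_intros continuous_on_compose2[OF c_cont]) auto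
qed (intro connected_Times connected_Ioo)

lemma open_side: "open (side \<sigma> r)"
proof -
  have "side \<sigma> r = uhp \<inter> ({z. cmod (z - of_real b) < r} \<inter> {z. 0 < \<sigma> * offset z})"
    by (auto simp: side_def)
  then show ?thesis
    using open_uhp by (auto intro!: open_Int open_Collect_less continuous_intros)
qed

lemma open_\<Omega>: "open \<Omega>"
proof -
  have "\<Omega> = uhp \<inter> ({z. m < cmod (z - of_real b)} \<union> ({z. offset z < 0} \<union> {z. 0 < offset z}))"
    by (auto simp: \<Omega>_altdef)
  then show ?thesis
    using open_uhp by (auto intro!: open_Int open_Un open_Collect_less continuous_intros)
qed

lemma side_subset: "r \<le> m \<Longrightarrow> side \<sigma> r \<subseteq> \<Omega>" and cut_subset: "cut \<sigma> r \<subseteq> \<Omega>"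
  and side_mono: "r \<le> r' \<Longrightarrow> side \<sigma> r \<subseteq> side \<sigma> r'"
  and cut_subset_side: "r < r' \<Longrightarrow> cut \<sigma> r \<subseteq> side \<sigma> r'"
  and side_Int_cut: "r \<le> r' \<Longrightarrow> side \<sigma> r \<inter> cut \<sigma>' r' = {}"
  by (auto simp: side_def cut_def \<Omega>_altdef)

lemma side_Int_side: "side 1 r \<inter> side (-1) r' = {}"
  by (auto simp: side_def)

lemma connected_uhp_outside:
  assumes "0 \<le> R"
  shows "connected {z \<in> uhp. R < cmod (z - of_real b)}"
proof -
  have "{z \<in> uhp. R < cmod (z - of_real b)} = (\<lambda>(s, v). polar_pt b s v) ` ({R<..} \<times> {-1<..<1})"
    (is "?L = ?R")
  proof
    show "?L \<subseteq> ?R"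
    proof
      fix z assume z: "z \<in> ?L"
      then have "z = polar_pt b (cmod (z - of_real b)) (Re (z - of_real b) / cmod (z - of_real b))"
        using eq_polar_pt[of z b] by (force simp: uhp_def)
      moreover have "cmod (z - of_real b) \<in> {R<..}" "Re (z - of_real b) / cmod (z - of_real b) \<in> {-1<..<1}"
        using z abs_Re_div_cmod_less_1(1)[of z b] unfolding abs_less_iff by auto
      ultimately show "z \<in> ?R"
        by (intro image_eqI[of _ _ "(cmod (z - of_real b), Re (z - of_real b) / cmod (z - of_real b))"])
          auto
    qed
    show "?R \<subseteq> ?L"
    proof clarsimp
      fix s v assume "R < s" "- 1 < v" "v < (1::real)"
      then show "polar_pt b s v \<in> uhp \<and> R < cmod (polar_pt b s v - complex_of_real b)"
        using assms cmod_polar_pt[of s v b] polar_pt_in_uhp[of s v b] by auto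
    qed
  qed
  moreover have "connected ((\<lambda>(s, v). polar_pt b s v) ` ({R<..} \<times> {-1<..<1}))"
    by (intro connected_continuous_image connected_Times connected_Ioo connected_Ioi)
      (auto simp: case_prod_unfold intro!: continuous_intros)
  ultimately show ?thesis
    by simp
qed

section \<open>Crosscuts from the slit to the real line, and the two null chains they form\<close>

lemma cut_topology:
  assumes "\<bar>\<sigma>\<bar> = 1" "0 < r" "r \<le> m"
  shows "crosscut \<Omega> (cut \<sigma> r)" "closure (cut \<sigma> r) \<subseteq> sphere (of_real b) r"
    "diameter (cut \<sigma> r) \<le> 2 * r"
proof -
  have sub: "cut_path \<sigma> r ` {0<..<1} \<subseteq> \<Omega>"
    using cut_eq_image[OF assms] cut_subset by blast
  have cont: "continuous_on {0..1} (cut_path \<sigma> r)"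
    unfolding cut_path_def interp_def by (intro continuous_intros)
  have "\<sigma> \<noteq> c r"
    using c_bound[of r] assms by auto
  have "inj (cut_path \<sigma> r)"
  proof
    fix t t' assume "cut_path \<sigma> r t = cut_path \<sigma> r t'"
    then have "r * interp \<sigma> r t = r * interp \<sigma> r t'"
      unfolding cut_path_def by (metis Re_polar_pt)
    then show "t = t'"
      using assms \<open>\<sigma> \<noteq> c r\<close> by (simp add: interp_def)
  qed
  then have "simple_path (cut_path \<sigma> r)"
    using cont by (intro arc_imp_simple_path) (auto simp: arc_def path_def intro: inj_on_subset)
  moreover have "cut_path \<sigma> r t \<in> frontier \<Omega>" if "cut_path \<sigma> r t \<notin> \<Omega>" "t \<in> {0..1}" for t
  proof -
    have "continuous_on (closure {0<..<1}) (cut_path \<sigma> r)"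
      using cont by simp
    then have "cut_path \<sigma> r ` closure {0<..<1} \<subseteq> closure (cut_path \<sigma> r ` {0<..<1})"
      by (rule image_closure_subset) (auto intro: closure_subset[THEN subsetD])
    then have "cut_path \<sigma> r t \<in> closure \<Omega>"
      using that(2) closure_mono[OF sub] by (simp add: image_subset_iff subset_iff)
    then show ?thesis
      using that(1) open_\<Omega> by (simp add: frontier_def interior_open)
  qed
  \<comment> \<open>\<open>t = 0\<close> is the slit point of radius \<open>r\<close>, and
    \<open>t = 1\<close> below is the real point \<open>b + \<sigma> * r\<close>. Both are limits of
    the arc but lie off \<Omega>.\<close>
  moreover have "cut_path \<sigma> r 0 \<notin> \<Omega>"
  proof -
    have "\<bar>c r\<bar> < 1"
      using c_bound[of r] assms by auto
    then show ?thesis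
      using assms by (simp add: cut_path_def \<Omega>_altdef interp_def offset_polar_pt cmod_polar_pt)
  qed
  moreover have "cut_path \<sigma> r 1 \<notin> \<Omega>"
  proof -
    have "\<sigma>\<^sup>2 = 1"
      using assms(1) by (metis one_power2 power2_abs)
    then show ?thesis
      by (simp add: cut_path_def \<Omega>_altdef interp_def uhp_def Im_polar_pt)
  qed
  ultimately show "crosscut \<Omega> (cut \<sigma> r)"
    unfolding crosscut_def using sub cut_eq_image[OF assms]
    by (intro exI[of _ "cut_path \<sigma> r"]) (auto simp: pathstart_def pathfinish_def)
  have sphere: "cut \<sigma> r \<subseteq> sphere (of_real b) r"
    by (auto simp: cut_def dist_norm norm_minus_commute)
  then show "closure (cut \<sigma> r) \<subseteq> sphere (of_real b) r"
    by (simp add: closure_minimal)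
  have "diameter (cut \<sigma> r) \<le> diameter (cball (complex_of_real b) r)"
    using sphere by (intro diameter_subset) auto
  then show "diameter (cut \<sigma> r) \<le> 2 * r"
    using assms by simp
qed

lemma side_nonempty:
  assumes "\<bar>\<sigma>\<bar> = 1" "0 < r" "r \<le> m"
  shows "side \<sigma> r \<noteq> {}"
  using side_eq_image[OF assms(1,3)] assms(2) by auto

lemma side_component:
  assumes "\<bar>\<sigma>\<bar> = 1" "0 < r" "r \<le> m"
  shows "side \<sigma> r \<in> components (\<Omega> - cut \<sigma> r)"
proof -
  \<comment> \<open>Points of \<Omega> off the cut and outside \<open>side \<sigma> r\<close> lie in
    this open set, because offset 0 does not occur in \<Omega> at radius at most \<open>m\<close>. A
    connected set containing the side can thus not grow beyond it.\<close>
  let ?E = "{z. r < cmod (z - of_real b)} \<union> {z. \<sigma> * offset z < 0}"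
  have "open ?E"
    by (auto intro!: open_Un open_Collect_less continuous_intros)
  have sub: "side \<sigma> r \<subseteq> \<Omega> - cut \<sigma> r"
    using side_subset[OF assms(3)] side_Int_cut by blast
  have "\<Omega> - cut \<sigma> r \<subseteq> side \<sigma> r \<union> ?E"
  proof
    fix z assume "z \<in> \<Omega> - cut \<sigma> r"
    moreover have "\<sigma> * offset z \<noteq> 0" if "offset z \<noteq> 0"
      using that assms(1) by auto
    ultimately show "z \<in> side \<sigma> r \<union> ?E"
      using assms by (auto simp: \<Omega>_altdef side_def cut_def not_less order_le_less)
  qed
  moreover have "side \<sigma> r \<inter> ?E = {}"
    by (auto simp: side_def)
  ultimately have "T \<subseteq> side \<sigma> r" if "connected T" "T \<subseteq> \<Omega> - cut \<sigma> r" "side \<sigma> r \<subseteq> T" for T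
    using connectedD[OF that(1) open_side[of \<sigma> r] \<open>open ?E\<close>] side_nonempty[OF assms] that(2,3)
    by blast
  then show ?thesis
    unfolding in_components_maximal
    using sub connected_side[OF assms(1,3)] side_nonempty[OF assms] by blast
qed

definition chain :: "real \<Rightarrow> nat \<Rightarrow> complex set" where
  "chain \<sigma> n = cut \<sigma> (m / real (Suc n))"

lemma radius: "0 < m / real (Suc n)" "m / real (Suc n) \<le> m" "m / real (Suc (Suc n)) < m / real (Suc n)"
  using m_pos by (auto simp: field_simps)

lemma chain_crosscut: "\<bar>\<sigma>\<bar> = 1 \<Longrightarrow> crosscut \<Omega> (chain \<sigma> n)"
  unfolding chain_def by (rule cut_topology(1)) (use radius in auto)

lemma null_chain_chain:
  assumes "\<bar>\<sigma>\<bar> = 1"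
  shows "null_chain \<Omega> (chain \<sigma>)"
  unfolding null_chain_def
proof (intro conjI allI)
  fix n
  show "crosscut \<Omega> (chain \<sigma> n)"
    by (rule chain_crosscut[OF assms])
  have "closure (chain \<sigma> k) \<subseteq> sphere (of_real b) (m / real (Suc k))" for k
    unfolding chain_def by (rule cut_topology(2)) (use radius assms in auto)
  then show "closure (chain \<sigma> n) \<inter> closure (chain \<sigma> (Suc n)) = {}"
    using radius(3)[of n] by (smt (verit) disjoint_iff mem_sphere subsetD)
  define S where "S = side \<sigma> (m / real (Suc (Suc n)))"
  have S: "S \<in> components (\<Omega> - chain \<sigma> (Suc n))"
    unfolding S_def chain_def by (intro side_component radius assms)
  have "chain \<sigma> (Suc (Suc n)) \<subseteq> S"
    unfolding S_def chain_def by (intro cut_subset_side radius)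
  have r: "m / real (Suc (Suc n)) < m / real (Suc 0)"
    using m_pos by (intro divide_strict_left_mono) auto
  then have disj: "chain \<sigma> 0 \<inter> S = {}"
    unfolding S_def chain_def using side_Int_cut[of "m / real (Suc (Suc n))" "m / real (Suc 0)"]
    by (simp add: Int_commute)
  have "chain \<sigma> 0 \<subseteq> \<Omega> - chain \<sigma> (Suc n)"
    using r cut_subset by (auto simp: chain_def cut_def)
  moreover have "connected (chain \<sigma> 0)" "chain \<sigma> 0 \<noteq> {}"
    using crosscut_topology[OF chain_crosscut[OF assms] open_\<Omega>] by auto
  ultimately obtain U where U: "U \<in> components (\<Omega> - chain \<sigma> (Suc n))" "chain \<sigma> 0 \<subseteq> U"
    using exists_component_superset[of "chain \<sigma> 0"] by blast
  moreover have "U \<noteq> S"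
    using U(2) disj \<open>chain \<sigma> 0 \<noteq> {}\<close> by blast
  ultimately show "separates \<Omega> (chain \<sigma> (Suc n)) (chain \<sigma> 0) (chain \<sigma> (Suc (Suc n)))"
    using S \<open>chain \<sigma> (Suc (Suc n)) \<subseteq> S\<close> unfolding separates_def by blast
next
  have lim: "(\<lambda>n. 2 * (m * inverse (real (Suc n)))) \<longlonglongrightarrow> 0"
    by (intro tendsto_mult_right_zero LIMSEQ_inverse_real_of_nat)
  have upper: "diameter (chain \<sigma> n) \<le> 2 * (m * inverse (real (Suc n)))" for n
    using cut_topology(3)[OF assms radius(1,2)] by (simp add: chain_def field_simps)
  have lower: "0 \<le> diameter (chain \<sigma> n)" for n
  proof -
    have "chain \<sigma> n \<subseteq> cball (of_real b) (m / real (Suc n))"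
      by (auto simp: chain_def cut_def dist_norm norm_minus_commute)
    then show ?thesis
      by (meson bounded_cball bounded_subset diameter_ge_0)
  qed
  show "(\<lambda>n. diameter (chain \<sigma> n)) \<longlonglongrightarrow> 0"
    by (rule tendsto_sandwich[OF always_eventually always_eventually tendsto_const lim])
      (use upper lower in blast)+
qed

lemma inner_domain_chain:
  assumes "\<bar>\<sigma>\<bar> = 1"
  shows "inner_domain \<Omega> (chain \<sigma>) n = side \<sigma> (m / real (Suc n))"
proof (rule inner_domain_eqI[OF null_chain_chain[OF assms] open_\<Omega>])
  show "side \<sigma> (m / real (Suc n)) \<in> components (\<Omega> - chain \<sigma> n)"
    unfolding chain_def by (rule side_component) (use radius assms in auto)
  show "chain \<sigma> (Suc n) \<subseteq> side \<sigma> (m / real (Suc n))"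
    unfolding chain_def by (intro cut_subset_side radius)
qed

section \<open>The prime ends at the base\<close>

lemma mem_side_of_near_base:
  assumes "r \<le> m" "z \<in> \<Omega>" "cmod (z - of_real b) < r"
  shows "z \<in> side 1 r \<union> side (-1) r"
  using assms by (auto simp: \<Omega>_altdef side_def)

text \<open>Near \<open>b\<close> the domain is the disjoint union of two open sets, one on each
  side of the slit.\<close>

lemma connected_subset_side:
  assumes "connected T" "T \<subseteq> \<Omega>" "T \<subseteq> ball (of_real b) r" "r \<le> m"
  shows "T \<subseteq> side 1 r \<or> T \<subseteq> side (-1) r"
proof -
  have "T \<subseteq> side 1 r \<union> side (-1) r"
    using mem_side_of_near_base assms by (force simp: dist_norm norm_minus_commute)
  then show ?thesis
    using connectedD[OF assms(1) open_side[of 1 r] open_side[of "-1" r]] side_Int_side by blast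
qed

lemma chain_side_subset:
  assumes "0 < r"
  shows "\<exists>n. side \<sigma> (m / real (Suc n)) \<subseteq> side \<sigma> r"
proof -
  obtain n where "m / r < real n"
    using reals_Archimedean2 by blast
  then have "m / real (Suc n) \<le> r"
    using assms by (simp add: field_simps)
  then show ?thesis
    using side_mono by blast
qed

text \<open>Every inner domain is connected and has \<open>b\<close> in its closure, so one that
  leaves the ball crosses the sphere. If all of them did, their nested compact traces on the sphere
  would have a common point, and the impression would contain a point other than
  \<open>b\<close>.\<close>

lemma inner_domain_small:
  assumes "null_chain \<Omega> C" "connected \<Omega>"
    "(\<Inter>n. closure (inner_domain \<Omega> C n)) = {of_real b}" "0 < r"
  shows "\<exists>n. inner_domain \<Omega> C n \<subseteq> ball (of_real b) r"
proof (rule ccontr)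
  assume neg: "\<nexists>n. inner_domain \<Omega> C n \<subseteq> ball (of_real b) r"
  define F where "F n = closure (inner_domain \<Omega> C n) \<inter> sphere (of_real b) r" for n
  have "inner_domain \<Omega> C n \<inter> frontier (ball (of_real b) r) \<noteq> {}" for n
  proof (rule connected_Int_frontier)
    show "connected (inner_domain \<Omega> C n)"
      using inner_domain_component(1)[OF assms(1) open_\<Omega>] in_components_connected by blast
    have "of_real b \<in> closure (inner_domain \<Omega> C n)"
      using assms(3) by blast
    then show "inner_domain \<Omega> C n \<inter> ball (of_real b) r \<noteq> {}"
      using assms(4) by (force simp: closure_approachable dist_commute)
  qed (use neg in blast)
  then have "F n \<noteq> {}" for n
    using closure_subset assms(4) by (fastforce simp: F_def)
  moreover have "compact (F n)" for n
    unfolding F_def by (intro closed_Int_compact) auto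
  moreover have "F n \<subseteq> F k" if "k \<le> n" for k n
    using closure_mono[OF inner_domain_antimono[OF assms(1) open_\<Omega> assms(2) that]]
    by (auto simp: F_def)
  ultimately have "\<Inter> (range F) \<noteq> {}"
    by (intro compact_nest)
  then obtain z where "z \<in> F n" for n
    by blast
  then have "z \<in> (\<Inter>n. closure (inner_domain \<Omega> C n))" "z \<in> sphere (of_real b) r"
    by (auto simp: F_def)
  then show False
    using assms(3,4) by auto
qed

text \<open>
  A chain shrinking to \<open>b\<close> ends up on one side of the slit. Conversely, consecutive crosscuts have
  disjoint closures, so one of them stays away from \<open>b\<close> and cannot cut off any small one-sided
  neighbourhood of \<open>b\<close>.
\<close>

lemma null_chain_at_base:
  assumes C: "null_chain \<Omega> C" "connected \<Omega>"
    and base: "(\<Inter>n. closure (inner_domain \<Omega> C n)) = {of_real b}"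
  shows "equivalent_chains \<Omega> (chain 1) C \<or> equivalent_chains \<Omega> (chain (-1)) C"
proof -
  define V where "V = inner_domain \<Omega> C"
  note V = inner_domain_component[OF C(1) open_\<Omega>, folded V_def]
  have V_conn: "connected (V n)" and V_ne: "V n \<noteq> {}" and V_sub: "V n \<subseteq> \<Omega>" for n
    using V(1)[of n] in_components_connected in_components_nonempty in_components_subset by blast+
  have V_mono: "V n \<subseteq> V k" if "k \<le> n" for k n
    using inner_domain_antimono[OF C(1) open_\<Omega> C(2) that] by (simp add: V_def)
  have small: "\<exists>n. V n \<subseteq> ball (of_real b) r" if "0 < r" for r
    using inner_domain_small[OF C base that] by (simp add: V_def)
  \<comment> \<open>This inner domain fixes the side once and for all, since the later ones are
    contained in it.\<close>
  obtain n0 where n0: "V n0 \<subseteq> ball (of_real b) m"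
    using small m_pos by blast
  obtain \<sigma> :: real where \<sigma>: "\<sigma> = 1 \<or> \<sigma> = -1" "V n0 \<subseteq> side \<sigma> m"
    using connected_subset_side[OF V_conn V_sub n0] by blast
  have below: "\<exists>n\<ge>k. V n \<subseteq> side \<sigma> r" if r: "0 < r" for r k
  proof -
    obtain n where n: "V n \<subseteq> ball (of_real b) r"
      using small r by blast
    define N where "N = max k (max n n0)"
    have "V N \<subseteq> V n" "V N \<subseteq> V n0" "k \<le> N"
      unfolding N_def by (intro V_mono; simp)+ simp
    then have "V N \<subseteq> side \<sigma> m \<inter> ball (of_real b) r"
      using \<sigma>(2) n by blast
    then have "V N \<subseteq> side \<sigma> r"
      by (auto simp: side_def dist_norm norm_minus_commute)
    then show ?thesis
      using \<open>k \<le> N\<close> by blast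
  qed
  have above: "\<exists>r>0. side \<sigma> r \<subseteq> V k" for k
  proof -
    have "closure (C k) \<inter> closure (C (Suc k)) = {}"
      using C(1) by (simp add: null_chain_def)
    then obtain j where j: "k \<le> j" "of_real b \<notin> closure (C j)"
      by (metis disjoint_iff lessI less_imp_le order_refl)
    then obtain r0 where r0: "0 < r0" "ball (of_real b) r0 \<inter> closure (C j) = {}"
      by (metis Compl_iff closed_closure disjoint_eq_subset_Compl open_Compl open_contains_ball)
    define r where "r = min r0 m"
    have r: "0 < r" "r \<le> m" "ball (of_real b) r \<inter> C j = {}"
      using r0 m_pos closure_subset[of "C j"] by (auto simp: r_def)
    \<comment> \<open>The bound \<open>j \<le> n\<close> matters: \<open>V n\<close> is then a
      nonempty subset of both \<open>V j\<close> and the small side, so these two meet.\<close>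
    obtain n where n: "j \<le> n" "V n \<subseteq> side \<sigma> r"
      using below r by blast
    have "side \<sigma> r \<subseteq> ball (of_real b) r"
      by (auto simp: side_def dist_norm norm_minus_commute)
    then have "side \<sigma> r \<inter> C j = {}"
      using r(3) by blast
    then have "side \<sigma> r \<subseteq> \<Omega> - C j"
      using side_subset[OF r(2)] by blast
    moreover have "connected (side \<sigma> r)"
      using connected_side[OF _ r(2)] \<sigma>(1) by auto
    moreover have "V j \<inter> side \<sigma> r \<noteq> {}"
      using n V_mono[of j n] V_ne[of n] by blast
    ultimately have "side \<sigma> r \<subseteq> V j"
      using components_maximal[OF V(1)[of j]] by blast
    then show ?thesis
      using r(1) V_mono[OF j(1)] by blast
  qed
  have "\<bar>\<sigma>\<bar> = 1"
    using \<sigma>(1) by auto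
  have "equivalent_chains \<Omega> (chain \<sigma>) C"
    unfolding equivalent_chains_def inner_domain_chain[OF \<open>\<bar>\<sigma>\<bar> = 1\<close>] V_def[symmetric]
    using below radius(1) above chain_side_subset by (meson order_trans)
  then show ?thesis
    using \<sigma>(1) by blast
qed

definition base_end :: "real \<Rightarrow> (nat \<Rightarrow> complex set) set" where
  "base_end \<sigma> = {D. null_chain \<Omega> D \<and> equivalent_chains \<Omega> (chain \<sigma>) D}"

lemma base_end_side_subset:
  assumes "\<bar>\<sigma>\<bar> = 1" "D \<in> base_end \<sigma>"
  shows "\<exists>r>0. r \<le> m \<and> side \<sigma> r \<subseteq> inner_domain \<Omega> D n"
proof -
  obtain k where "side \<sigma> (m / real (Suc k)) \<subseteq> inner_domain \<Omega> D n"
    using assms inner_domain_chain unfolding base_end_def equivalent_chains_def by force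
  then show ?thesis
    using radius by blast
qed

text \<open>The point is the end \<open>t = 1\<close> of the crosscut of radius \<open>s\<close>.
  This is where \<open>left_sided\<close> and \<open>right_sided\<close> come from.\<close>

lemma real_in_closure_side:
  assumes "\<bar>\<sigma>\<bar> = 1" "0 < s" "s < r" "r \<le> m"
  shows "of_real (b + \<sigma> * s) \<in> closure (side \<sigma> r)"
proof -
  have "continuous_on (closure {0<..<1}) (cut_path \<sigma> s)"
    unfolding cut_path_def interp_def by (intro continuous_intros)
  then have "cut_path \<sigma> s ` closure {0<..<1} \<subseteq> closure (cut_path \<sigma> s ` {0<..<1})"
    by (rule image_closure_subset) (auto intro: closure_subset[THEN subsetD])
  then have "cut_path \<sigma> s 1 \<in> closure (cut \<sigma> s)"
    using assms by (simp add: cut_eq_image image_subset_iff)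
  moreover have "cut_path \<sigma> s 1 = of_real (b + \<sigma> * s)"
  proof -
    have "\<sigma>\<^sup>2 = 1"
      using assms(1) by (metis one_power2 power2_abs)
    then show ?thesis
      by (simp add: cut_path_def interp_def polar_pt_def complex_eq_iff)
  qed
  ultimately show ?thesis
    using closure_mono[OF cut_subset_side[OF assms(3)]] by auto
qed

lemma base_in_closure_side:
  assumes "\<bar>\<sigma>\<bar> = 1" "0 < r" "r \<le> m"
  shows "of_real b \<in> closure (side \<sigma> r)"
  unfolding closure_approachable
proof (intro allI impI)
  fix e :: real assume "0 < e"
  then have "side \<sigma> (min e r) \<noteq> {}"
    using assms by (intro side_nonempty) auto
  then obtain z where "z \<in> side \<sigma> (min e r)"
    by blast
  then show "\<exists>z\<in>side \<sigma> r. dist z (of_real b) < e"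
    by (auto simp: side_def dist_norm)
qed

lemma prime_ends_at_base:
  assumes "connected \<Omega>"
  shows "prime_ends_at \<Omega> b = {base_end (-1), base_end 1}"
proof -
  have Inter: "(\<Inter>n. closure (inner_domain \<Omega> (chain \<sigma>) n)) = {of_real b}" if \<sigma>: "\<bar>\<sigma>\<bar> = 1" for \<sigma>
  proof -
    have "of_real b \<in> (\<Inter>n. closure (side \<sigma> (m / real (Suc n))))"
      using base_in_closure_side[OF \<sigma>] radius by blast
    moreover have "z = of_real b" if z: "z \<in> (\<Inter>n. closure (side \<sigma> (m / real (Suc n))))" for z
    proof (rule ccontr)
      assume "z \<noteq> of_real b"
      then obtain n where n: "inverse (real (Suc n)) < cmod (z - of_real b) / m"
        using m_pos reals_Archimedean[of "cmod (z - of_real b) / m"] by auto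
      have "side \<sigma> (m / real (Suc n)) \<subseteq> cball (of_real b) (m / real (Suc n))"
        by (auto simp: side_def dist_norm norm_minus_commute)
      then have "z \<in> cball (of_real b) (m / real (Suc n))"
        using closure_minimal[OF _ closed_cball] z by blast
      then show False
        using n m_pos by (simp add: dist_norm norm_minus_commute field_simps)
    qed
    ultimately show ?thesis
      unfolding inner_domain_chain[OF \<sigma>] by blast
  qed
  show ?thesis
  proof (intro subset_antisym subsetI)
    fix P assume "P \<in> prime_ends_at \<Omega> b"
    then obtain C where C: "null_chain \<Omega> C" "P = {D. null_chain \<Omega> D \<and> equivalent_chains \<Omega> C D}"
        and imp: "impression \<Omega> P = {of_real b}"
      by (auto simp: prime_ends_at_def prime_end_def)
    then have "(\<Inter>n. closure (inner_domain \<Omega> C n)) = {of_real b}"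
      using impression_eq_Inter_closure[OF C(1)] by simp
    then obtain \<sigma> :: real where \<sigma>: "\<sigma> = 1 \<or> \<sigma> = -1" "equivalent_chains \<Omega> (chain \<sigma>) C"
      using null_chain_at_base[OF C(1) assms] by blast
    then have "P = base_end \<sigma>"
      unfolding C(2) base_end_def
      using equivalent_chains_trans[OF \<sigma>(2)] equivalent_chains_trans[OF equivalent_chains_sym[OF \<sigma>(2)]]
      by blast
    then show "P \<in> {base_end (-1), base_end 1}"
      using \<sigma>(1) by blast
  next
    fix P assume "P \<in> {base_end (-1), base_end 1}"
    then obtain \<sigma> :: real where \<sigma>: "\<bar>\<sigma>\<bar> = 1" "P = base_end \<sigma>"
      using that[of 1] that[of "-1"] by auto
    then show "P \<in> prime_ends_at \<Omega> b"
      using null_chain_chain[OF \<sigma>(1)] impression_eq_Inter_closure[OF null_chain_chain[OF \<sigma>(1)]]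
        Inter[OF \<sigma>(1)]
      unfolding prime_ends_at_def prime_end_def base_end_def by auto
  qed
qed

lemma base_ends_distinct: "base_end (-1) \<noteq> base_end 1"
proof
  assume eq: "base_end (-1) = base_end 1"
  have "chain 1 \<in> base_end 1"
    using null_chain_chain[of 1] equivalent_chains_refl by (simp add: base_end_def)
  then obtain r where r: "0 < r" "r \<le> m" "side (-1) r \<subseteq> inner_domain \<Omega> (chain 1) 0"
    using base_end_side_subset[of "-1" "chain 1" 0] unfolding eq by auto
  then have "side (-1) r \<subseteq> side 1 (m / real (Suc 0))"
    by (simp add: inner_domain_chain)
  then show False
    using side_nonempty[OF _ r(1,2), of "-1"] side_Int_side[of "m / real (Suc 0)" r] by auto
qed

text \<open>A half disc around \<open>x\<close> is connected and is mapped close to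
  \<open>b\<close>, hence into a single side of the slit. One boundary point \<open>u\<close> near
  \<open>x\<close> with a real image on the side \<sigma> of \<open>b\<close> decides which side it
  is, because the sign of the offset persists at nearby points of the half-plane.\<close>

lemma eventually_in_side:
  assumes f: "continuous_on {z. 0 \<le> Im z} f" "f ` uhp \<subseteq> \<Omega>" "f (of_real x) = of_real b"
    and \<sigma>: "\<bar>\<sigma>\<bar> = 1"
    and u: "\<And>\<delta>. 0 < \<delta> \<Longrightarrow> \<exists>u. \<bar>u - x\<bar> < \<delta> \<and> Im (f (of_real u)) = 0 \<and> 0 < \<sigma> * (Re (f (of_real u)) - b)"
    and r: "0 < r" "r \<le> m"
  shows "\<forall>\<^sub>F z in at (of_real x) within uhp. f z \<in> side \<sigma> r"
proof -
  obtain \<delta> where \<delta>: "0 < \<delta>"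
      "\<And>z. 0 \<le> Im z \<Longrightarrow> dist z (of_real x) < \<delta> \<Longrightarrow> dist (f z) (of_real b) < r"
  proof -
    have "\<exists>\<delta>>0. \<forall>z\<in>{z. 0 \<le> Im z}. dist z (of_real x) < \<delta> \<longrightarrow> dist (f z) (f (of_real x)) < r"
      using f(1) r(1) unfolding continuous_on_iff by simp
    then show ?thesis
      using that f(3) by auto
  qed
  define N where "N = uhp \<inter> ball (of_real x) \<delta>"
  have N_near: "f z \<in> ball (of_real b) r" if "z \<in> N" for z
    using \<delta>(2)[of z] that by (auto simp: N_def uhp_def dist_commute)
  have "connected N"
    unfolding N_def using convex_uhp by (intro convex_connected convex_Int convex_ball)
  moreover have "continuous_on N f"
    using f(1) by (rule continuous_on_subset) (auto simp: N_def uhp_def)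
  ultimately have "connected (f ` N)"
    by (simp add: connected_continuous_image)
  then have sides: "f ` N \<subseteq> side 1 r \<or> f ` N \<subseteq> side (-1) r"
    using f(2) N_near r(2) by (intro connected_subset_side) (auto simp: N_def)
  obtain u where u: "\<bar>u - x\<bar> < \<delta>" "Im (f (of_real u)) = 0" "0 < \<sigma> * (Re (f (of_real u)) - b)"
    using assms(5) \<delta>(1) by blast
  have pos: "0 < \<sigma> * offset (f (of_real u))"
  proof -
    have "dist (complex_of_real u) (of_real x) < \<delta>"
      using u(1) by (simp add: dist_norm flip: of_real_diff)
    then have "cmod (f (of_real u) - of_real b) < r"
      using \<delta>(2)[of "of_real u"] by (simp add: dist_norm)
    moreover have Re: "cmod (f (of_real u) - of_real b) = \<sigma> * (Re (f (of_real u)) - b)"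
      using u(2,3) \<sigma> by (simp add: cmod_def) (metis abs_mult abs_of_pos mult_1)
    ultimately have c: "\<bar>c (\<sigma> * (Re (f (of_real u)) - b))\<bar> < 1"
      using c_bound[of "\<sigma> * (Re (f (of_real u)) - b)"] u(3) r(2) by simp
    have "\<sigma> = 1 \<or> \<sigma> = -1"
      using \<sigma> by linarith
    \<comment> \<open>At a real point at distance \<open>d\<close> from \<open>b\<close> in
      direction \<sigma>, the signed offset is \<open>d * (1 - \<sigma> * c d)\<close>, which is
      positive as \<open>c\<close> stays below 1 in modulus.\<close>
    then have "\<sigma> * offset (f (of_real u)) =
        (\<sigma> * (Re (f (of_real u)) - b)) * (1 - \<sigma> * c (\<sigma> * (Re (f (of_real u)) - b)))"
      by (auto simp: offset_def Re algebra_simps)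
    moreover have "0 < 1 - \<sigma> * c (\<sigma> * (Re (f (of_real u)) - b))"
      using c \<open>\<sigma> = 1 \<or> \<sigma> = -1\<close> by auto
    ultimately show ?thesis
      using u(3) by (simp only: mult_pos_pos)
  qed
  have "continuous_on {z. 0 \<le> Im z} (\<lambda>z. \<sigma> * offset (f z))"
    by (intro continuous_intros continuous_on_compose2[OF continuous_offset f(1)]) auto
  then have "((\<lambda>z. \<sigma> * offset (f z)) \<longlongrightarrow> \<sigma> * offset (f (of_real u))) (at (of_real u) within {z. 0 \<le> Im z})"
    by (simp add: continuous_on_def)
  then have "((\<lambda>z. \<sigma> * offset (f z)) \<longlongrightarrow> \<sigma> * offset (f (of_real u))) (at (of_real u) within uhp)"
    by (rule tendsto_within_subset) (auto simp: uhp_def)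
  then have "\<forall>\<^sub>F z in at (of_real u) within uhp. 0 < \<sigma> * offset (f z)"
    using pos order_tendstoD(1) by blast
  moreover have "of_real u \<in> ball (complex_of_real x) \<delta>"
    using u(1) by (simp add: dist_norm abs_minus_commute flip: of_real_diff)
  then have "\<forall>\<^sub>F z in at (of_real u) within uhp. z \<in> ball (of_real x) \<delta>"
    by (meson eventually_at_topological open_ball)
  moreover have "\<forall>\<^sub>F z in at (of_real u) within uhp. z \<in> uhp"
    by (simp add: eventually_at_filter)
  ultimately have "\<forall>\<^sub>F z in at (of_real u) within uhp. z \<in> N \<and> 0 < \<sigma> * offset (f z)"
    by eventually_elim (simp add: N_def)
  then obtain z where "z \<in> N" "0 < \<sigma> * offset (f z)"
    using eventually_happens' at_within_uhp_neq_bot by blast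
  moreover have "\<sigma> = 1 \<or> \<sigma> = -1"
    using \<sigma> by linarith
  ultimately have "f ` N \<subseteq> side \<sigma> r"
    using sides by (auto simp: side_def)
  moreover have "\<forall>\<^sub>F z in at (of_real x) within uhp. z \<in> N"
    unfolding N_def eventually_at using \<delta>(1) by (auto simp: dist_commute)
  ultimately show ?thesis
    by (blast intro: eventually_mono)
qed

text \<open>Both sides of a slightly longer slit reach past radius \<open>m\<close>, so the exterior
  of the half disc of radius \<open>m\<close> glues them together.\<close>

lemma connected_\<Omega>:
  assumes "polar_slit_domain m' c" "m < m'"
  shows "connected \<Omega>"
proof -
  interpret outer: polar_slit_domain b m' c
    by (rule assms)
  let ?E = "{z \<in> uhp. m < cmod (z - of_real b)}"
  have meet: "side \<sigma> m' \<inter> ?E \<noteq> {}" if "\<bar>\<sigma>\<bar> = 1" for \<sigma>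
  proof -
    have "cut \<sigma> ((m + m') / 2) \<noteq> {}"
      using outer.cut_eq_image[OF that] m_pos assms(2) by auto
    moreover have "cut \<sigma> ((m + m') / 2) \<subseteq> side \<sigma> m' \<inter> ?E"
      using assms(2) by (auto simp: side_def cut_def)
    ultimately show ?thesis
      by blast
  qed
  have "connected (\<Union>{side 1 m' \<union> ?E, side (-1) m' \<union> ?E})"
  proof (rule connected_Union)
    have "connected ?E"
      using connected_uhp_outside m_pos by simp
    then show "connected s" if "s \<in> {side 1 m' \<union> ?E, side (-1) m' \<union> ?E}" for s
      using that meet outer.connected_side by (auto intro!: connected_Un)
    show "\<Inter>{side 1 m' \<union> ?E, side (-1) m' \<union> ?E} \<noteq> {}"
      using meet[of 1] by auto
  qed
  moreover have "\<Omega> = \<Union>{side 1 m' \<union> ?E, side (-1) m' \<union> ?E}"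
    using assms(2) by (auto simp: \<Omega>_altdef side_def)
  ultimately show ?thesis
    by simp
qed

text \<open>The Loewner map \<open>g\<close> matters only on the open half-plane; \<open>f\<close>
  is its extension and supplies the boundary values. That \<Omega> is connected comes for free, as
  it is the image of the half-plane.\<close>

lemma maps_to_base_prime_endsI:
  assumes f: "continuous_on {z. 0 \<le> Im z} f" "f ` uhp = \<Omega>"
      "f (of_real x) = of_real b" "f (of_real y) = of_real b"
    and g: "\<And>z. z \<in> uhp \<Longrightarrow> g z = f z"
    and x: "\<And>\<delta>. 0 < \<delta> \<Longrightarrow> \<exists>u. \<bar>u - x\<bar> < \<delta> \<and> Im (f (of_real u)) = 0 \<and> Re (f (of_real u)) < b"
    and y: "\<And>\<delta>. 0 < \<delta> \<Longrightarrow> \<exists>u. \<bar>u - y\<bar> < \<delta> \<and> Im (f (of_real u)) = 0 \<and> b < Re (f (of_real u))"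
  shows "maps_to_base_prime_ends g (polar_slit b m c) b x y"
proof -
  have "continuous_on uhp f"
    using f(1) by (rule continuous_on_subset) (auto simp: uhp_def)
  then have conn: "connected \<Omega>"
    using f(2) connected_continuous_image convex_connected[OF convex_uhp] by metis
  have left: "left_sided \<Omega> b (base_end (-1))"
    unfolding left_sided_def
  proof (intro ballI allI)
    fix D n assume "D \<in> base_end (-1)"
    then obtain r where r: "0 < r" "r \<le> m" "side (-1) r \<subseteq> inner_domain \<Omega> D n"
      using base_end_side_subset[of "-1" D n] by auto
    have "of_real u \<in> closure (side (-1) r)" if "u \<in> {b - r<..<b}" for u
      using real_in_closure_side[of "-1" "b - u" r] that r by auto
    then show "\<exists>\<delta>>0. complex_of_real ` {b - \<delta><..<b} \<subseteq> closure (inner_domain \<Omega> D n)"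
      using r(1) closure_mono[OF r(3)] by blast
  qed
  have right: "right_sided \<Omega> b (base_end 1)"
    unfolding right_sided_def
  proof (intro ballI allI)
    fix D n assume "D \<in> base_end 1"
    then obtain r where r: "0 < r" "r \<le> m" "side 1 r \<subseteq> inner_domain \<Omega> D n"
      using base_end_side_subset[of 1 D n] by auto
    have "of_real u \<in> closure (side 1 r)" if "u \<in> {b<..<b + r}" for u
      using real_in_closure_side[of 1 "u - b" r] that r by auto
    then show "\<exists>\<delta>>0. complex_of_real ` {b<..<b + \<delta>} \<subseteq> closure (inner_domain \<Omega> D n)"
      using r(1) closure_mono[OF r(3)] by blast
  qed
  have sends: "sends_to_prime_end g \<Omega> u (base_end \<sigma>)"
    if \<sigma>: "\<bar>\<sigma>\<bar> = 1"
      and ev: "\<And>r. 0 < r \<Longrightarrow> r \<le> m \<Longrightarrow> \<forall>\<^sub>F z in at (of_real u) within uhp. f z \<in> side \<sigma> r" for u \<sigma>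
    unfolding sends_to_prime_end_def
  proof (intro ballI allI)
    fix D n assume "D \<in> base_end \<sigma>"
    then obtain r where r: "0 < r" "r \<le> m" "side \<sigma> r \<subseteq> inner_domain \<Omega> D n"
      using base_end_side_subset[OF \<sigma>, of D n] by blast
    have "\<forall>\<^sub>F z in at (of_real u) within uhp. z \<in> uhp"
      by (simp add: eventually_at_filter)
    with ev[OF r(1,2)] show "\<forall>\<^sub>F z in at (of_real u) within uhp. g z \<in> inner_domain \<Omega> D n"
      by eventually_elim (use g r(3) in auto)
  qed
  have "sends_to_prime_end g \<Omega> x (base_end (-1))"
    by (rule sends, simp, rule eventually_in_side) (use f x in auto)
  moreover have "sends_to_prime_end g \<Omega> y (base_end 1)"
    by (rule sends, simp, rule eventually_in_side) (use f y in auto)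
  ultimately show ?thesis
    unfolding maps_to_base_prime_ends_def \<Omega>_def[symmetric]
    using prime_ends_at_base[OF conn] base_ends_distinct left right by blast
qed

end

section \<open>Loewner flows up to a finite time\<close>

definition lifetime :: "ereal \<Rightarrow> real set" where
  "lifetime \<tau> = {t. 0 \<le> t \<and> ereal t < \<tau>}"

lemma lifetime_ereal: "lifetime (ereal T) = {0..<T}"
  by (auto simp: lifetime_def)

lemma convex_lifetime: "convex (lifetime \<tau>)"
  unfolding lifetime_def convex_alt
proof clarify
  fix s t u assume *: "0 \<le> s" "ereal s < \<tau>" "0 \<le> t" "ereal t < \<tau>" "0 \<le> u" "u \<le> (1::real)"
  have "(1 - u) * s + u * t \<le> max s t"
    using * convex_bound_le[of s "max s t" t "1 - u" u] by simp
  then have "ereal ((1 - u) * s + u * t) \<le> ereal (max s t)"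
    by (simp only: ereal_less_eq)
  also have "\<dots> < \<tau>"
    using * by (simp add: max_def)
  finally show "0 \<le> (1 - u) *\<^sub>R s + u *\<^sub>R t \<and> ereal ((1 - u) *\<^sub>R s + u *\<^sub>R t) < \<tau>"
    using * by simp
qed

lemma lifetime_closed_downwards: "t \<in> lifetime \<tau> \<Longrightarrow> 0 \<le> s \<Longrightarrow> s \<le> t \<Longrightarrow> s \<in> lifetime \<tau>"
  using le_less_trans[of "ereal s" "ereal t" \<tau>] by (simp add: lifetime_def)

lemma constant_on_lifetime:
  fixes f :: "real \<Rightarrow> 'a::real_normed_vector"
  assumes "\<And>t. t \<in> lifetime \<tau> \<Longrightarrow> (f has_vector_derivative 0) (at t within {0..})" "t \<in> lifetime \<tau>"
  shows "f t = f 0"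
proof -
  have "\<exists>k. \<forall>s\<in>lifetime \<tau>. f s = k"
  proof (rule has_derivative_zero_constant[OF convex_lifetime])
    fix s assume "s \<in> lifetime \<tau>"
    then have "(f has_vector_derivative 0) (at s within lifetime \<tau>)"
      by (intro has_vector_derivative_within_subset[OF assms(1)]) (auto simp: lifetime_def)
    then show "(f has_derivative (\<lambda>h. 0)) (at s within lifetime \<tau>)"
      by (simp add: has_vector_derivative_def)
  qed
  moreover have "0 \<in> lifetime \<tau>"
    using lifetime_closed_downwards[OF assms(2)] assms(2) by (simp add: lifetime_def)
  ultimately show ?thesis
    using assms(2) by metis
qed

lemma real_constant_on_lifetime:
  fixes f :: "real \<Rightarrow> real"
  assumes "\<And>t. t \<in> lifetime \<tau> \<Longrightarrow> (f has_real_derivative 0) (at t within {0..})" "t \<in> lifetime \<tau>"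
  shows "f t = f 0"
  using constant_on_lifetime[of \<tau> f t] assms by (simp add: has_real_derivative_iff_has_vector_derivative)

lemma continuous_on_lifetime:
  fixes f :: "real \<Rightarrow> 'a::real_normed_vector"
  assumes "\<And>t. t \<in> lifetime \<tau> \<Longrightarrow> (f has_vector_derivative f' t) (at t within {0..})"
  shows "continuous_on (lifetime \<tau>) f"
  unfolding continuous_on_eq_continuous_within
proof
  fix t assume "t \<in> lifetime \<tau>"
  then have "(f has_vector_derivative f' t) (at t within lifetime \<tau>)"
    using assms by (intro has_vector_derivative_within_subset[OF assms]) (auto simp: lifetime_def)
  then show "continuous (at t within lifetime \<tau>) f"
    by (rule has_vector_derivative_continuous)
qed

lemma pos_on_lifetime:
  fixes f :: "real \<Rightarrow> real"
  assumes "continuous_on (lifetime \<tau>) f" "\<And>t. t \<in> lifetime \<tau> \<Longrightarrow> f t \<noteq> 0" "0 < f 0" "t \<in> lifetime \<tau>"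
  shows "0 < f t"
proof (rule ccontr)
  assume "\<not> 0 < f t"
  moreover have "{0..t} \<subseteq> lifetime \<tau>"
    using lifetime_closed_downwards[OF assms(4)] by auto
  ultimately have "\<exists>s\<ge>0. s \<le> t \<and> f s = 0"
    using assms by (intro IVT2') (auto simp: lifetime_def intro: continuous_on_subset)
  then show False
    using assms(2) \<open>{0..t} \<subseteq> lifetime \<tau>\<close> by (metis atLeastAtMost_iff subsetD)
qed

locale loewner_flow =
  fixes \<tau> :: ereal and \<xi> :: "real \<Rightarrow> real" and h :: "real \<Rightarrow> complex \<Rightarrow> complex"
  assumes flow: "upwards_loewner_flow \<xi> \<tau> h"
begin

lemma h_0: "z \<in> uhp \<Longrightarrow> h 0 z = z"
  and h_ne: "z \<in> uhp \<Longrightarrow> t \<in> lifetime \<tau> \<Longrightarrow> h t z \<noteq> of_real (\<xi> t)"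
  and h_deriv: "z \<in> uhp \<Longrightarrow> t \<in> lifetime \<tau> \<Longrightarrow>
    ((\<lambda>s. h s z) has_vector_derivative (-2 / (h t z - of_real (\<xi> t)))) (at t within {0..})"
  using flow by (auto simp: upwards_loewner_flow_def lifetime_def)

text \<open>The imaginary part \<open>y\<close> satisfies \<open>y' = 2 * y / |h - \<xi>|^2\<close>,
  so it grows as long as it is nonnegative. The definition of the flow does not say that it stays
  so: at the first time with \<open>y \<le> 0\<close> it would have been nondecreasing up to then
  and hence still be at least its positive initial value.\<close>

lemma Im_h_mono:
  assumes z: "z \<in> uhp" and t: "t \<in> lifetime \<tau>"
  shows "Im z \<le> Im (h t z)"
proof (rule ccontr)
  assume neg: "\<not> Im z \<le> Im (h t z)"
  define y where "y s = Im (h s z)" for s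
  have y0: "y 0 = Im z" "0 < y 0"
    using z h_0[OF z] by (auto simp: y_def uhp_def)
  have sub: "{0..t} \<subseteq> lifetime \<tau>"
    using lifetime_closed_downwards[OF t] by auto
  have deriv: "(y has_real_derivative (2 * y s / (cmod (h s z - of_real (\<xi> s)))\<^sup>2)) (at s within {0..})"
    if "s \<in> lifetime \<tau>" for s
  proof -
    have "(y has_vector_derivative Im (-2 / (h s z - of_real (\<xi> s)))) (at s within {0..})"
      unfolding y_def by (rule bounded_linear.has_vector_derivative[OF bounded_linear_Im h_deriv[OF z that]])
    moreover have "Im (-2 / (h s z - of_real (\<xi> s))) = 2 * y s / (cmod (h s z - of_real (\<xi> s)))\<^sup>2"
      by (simp add: Im_divide cmod_power2 y_def)
    ultimately show ?thesis
      by (simp add: has_real_derivative_iff_has_vector_derivative)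
  qed
  have cont: "continuous_on (lifetime \<tau>) y"
    using deriv unfolding has_real_derivative_iff_has_vector_derivative by (rule continuous_on_lifetime)
  have y_mono: "y 0 \<le> y s" if s: "s \<in> {0..t}" and pos: "\<And>r. 0 < r \<Longrightarrow> r < s \<Longrightarrow> 0 \<le> y r" for s
  proof (rule DERIV_nonneg_imp_increasing_open[where f = y])
    show "0 \<le> s"
      using s by simp
    show "\<exists>d. (y has_real_derivative d) (at r) \<and> d \<ge> 0" if r: "0 < r" "r < s" for r
    proof -
      have "r \<in> lifetime \<tau>"
        using sub s r by auto
      moreover have "at r within {0..} = at r"
        using r by (intro at_within_interior) simp
      ultimately have "(y has_real_derivative (2 * y r / (cmod (h r z - of_real (\<xi> r)))\<^sup>2)) (at r)"
        using deriv[of r] by simp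
      then show ?thesis
        using pos[OF r] by (intro exI[of _ "2 * y r / (cmod (h r z - of_real (\<xi> r)))\<^sup>2"]) simp
    qed
    show "continuous_on {0..s} y"
      using s sub by (intro continuous_on_subset[OF cont]) auto
  qed
  show False
  proof (cases "\<exists>s\<in>{0..t}. y s \<le> 0")
    case False
    then have "y 0 \<le> y t"
      using t by (intro y_mono) (auto simp: lifetime_def not_le intro: less_imp_le)
    then show False
      using neg y0 by (simp add: y_def)
  next
    case True
    define A where "A = {0..t} \<inter> y -` {..0}"
    have "closed A"
      unfolding A_def using continuous_on_subset[OF cont sub]
      by (intro continuous_closed_preimage) auto
    moreover have "A \<noteq> {}" "bdd_below A"
      using True by (auto simp: A_def intro!: bdd_belowI[of _ 0])
    ultimately have "Inf A \<in> A"
      by (intro closed_contains_Inf)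
    moreover have "0 \<le> y r" if "0 < r" "r < Inf A" for r
    proof (rule ccontr)
      assume "\<not> 0 \<le> y r"
      then have "r \<in> A"
        using that \<open>Inf A \<in> A\<close> by (auto simp: A_def)
      then show False
        using that \<open>bdd_below A\<close> cInf_lower by force
    qed
    ultimately have "y 0 \<le> y (Inf A)"
      by (intro y_mono) (auto simp: A_def)
    then show False
      using y0 \<open>Inf A \<in> A\<close> by (simp add: A_def)
  qed
qed

lemma h_in_uhp: "z \<in> uhp \<Longrightarrow> t \<in> lifetime \<tau> \<Longrightarrow> h t z \<in> uhp"
  using Im_h_mono[of z t] by (auto simp: uhp_def)

text \<open>The flow is Lipschitz in time since \<open>Im (h t z)\<close> stays bounded from below.\<close>

lemma h_tendsto:
  assumes z: "z \<in> uhp" and T: "\<tau> = ereal T" "0 < T"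
  shows "((\<lambda>t. h t z) \<longlongrightarrow> loewner_map \<tau> h T z) (at_left T)" "Im z \<le> Im (loewner_map \<tau> h T z)"
proof -
  have "norm (h s z - h t z) \<le> 2 / Im z * norm (s - t)" if "s \<in> lifetime \<tau>" "t \<in> lifetime \<tau>" for s t
  proof (rule differentiable_bound[OF convex_lifetime])
    show "((\<lambda>s. h s z) has_derivative (\<lambda>d. d *\<^sub>R (-2 / (h r z - of_real (\<xi> r))))) (at r within lifetime \<tau>)"
      if "r \<in> lifetime \<tau>" for r
      using has_vector_derivative_within_subset[OF h_deriv[OF z that], of "lifetime \<tau>"]
      by (auto simp: has_vector_derivative_def lifetime_def)
    show "onorm (\<lambda>d. d *\<^sub>R (-2 / (h r z - of_real (\<xi> r)))) \<le> 2 / Im z" if "r \<in> lifetime \<tau>" for r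
    proof (rule onorm_le)
      fix d :: real
      have "Im z \<le> Im (h r z - of_real (\<xi> r))"
        using Im_h_mono[OF z that] by simp
      also have "\<dots> \<le> cmod (h r z - of_real (\<xi> r))"
        using abs_Im_le_cmod abs_le_D1 by blast
      finally have "2 / cmod (h r z - of_real (\<xi> r)) \<le> 2 / Im z"
        using z by (intro divide_left_mono) (auto simp: uhp_def intro!: mult_pos_pos)
      then show "norm (d *\<^sub>R (-2 / (h r z - of_real (\<xi> r)))) \<le> 2 / Im z * norm d"
        by (simp add: norm_divide mult.commute mult_left_mono flip: times_divide_eq_right)
    qed
  qed (use that in auto)
  then have lip: "(2 / Im z)-lipschitz_on {0..<T} (\<lambda>t. h t z)"
    using z T by (intro lipschitz_onI) (auto simp: dist_norm lifetime_ereal uhp_def)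
  have "T \<in> closure {0..<T}"
    using T by simp
  then obtain l where "((\<lambda>t. h t z) \<longlongrightarrow> l) (at T within {0..<T})"
    using uniformly_continuous_on_extension_at_closure[OF lipschitz_on_uniformly_continuous[OF lip]]
    by blast
  moreover have "at T within {0..<T} = at_left T"
    using T by (intro at_within_nhd[of _ "{0<..}"]) auto
  ultimately have l: "((\<lambda>t. h t z) \<longlongrightarrow> l) (at_left T)"
    by simp
  have lim: "loewner_map \<tau> h T z = l"
    using tendsto_Lim[OF _ l] T by (simp add: loewner_map_def upto_time_def)
  with l show "((\<lambda>t. h t z) \<longlongrightarrow> loewner_map \<tau> h T z) (at_left T)"
    by simp
  have "\<forall>\<^sub>F t in at_left T. t \<in> {0<..<T}"
    using T by (intro eventually_at_leftI[of 0]) auto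
  then have "\<forall>\<^sub>F t in at_left T. Im z \<le> Im (h t z)"
    by eventually_elim (use Im_h_mono[OF z] T in \<open>auto simp: lifetime_ereal\<close>)
  \<comment> \<open>The bound survives the limit and puts it in the open half-plane.\<close>
  then show "Im z \<le> Im (loewner_map \<tau> h T z)"
    unfolding lim using tendsto_lowerbound[OF tendsto_Im[OF l]] by simp
qed

end

lemma eventually_at_left_lifetime:
  assumes "\<tau> = ereal T" "0 < T"
  shows "\<forall>\<^sub>F t in at_left T. t \<in> lifetime \<tau>"
proof -
  have "\<forall>\<^sub>F t in at_left T. t \<in> {0<..<T}"
    using assms by (intro eventually_at_leftI[of 0]) auto
  then show ?thesis
    by eventually_elim (use assms in \<open>auto simp: lifetime_ereal\<close>)
qed

lemma INF_neq_0_on_lifetime: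
  fixes f :: "real \<Rightarrow> real"
  assumes "0 < \<tau>" "0 < \<delta>" "\<And>t. t \<in> lifetime \<tau> \<Longrightarrow> \<delta> \<le> f t"
  shows "(INF t\<in>lifetime \<tau>. f t) \<noteq> 0"
proof -
  have "0 \<in> lifetime \<tau>"
    using assms(1) by (simp add: lifetime_def zero_ereal_def)
  then have "\<delta> \<le> (INF t\<in>lifetime \<tau>. f t)"
    using assms(3) by (intro cINF_greatest) auto
  then show ?thesis
    using assms(2) by simp
qed

section \<open>Two force points of equal weight\<close>

locale force_flow = loewner_flow \<tau> \<xi> h
  for \<tau> :: ereal and \<xi> :: "real \<Rightarrow> real" and h :: "real \<Rightarrow> complex \<Rightarrow> complex" +
  fixes \<rho> x y :: real and V1 V2 :: "real \<Rightarrow> real"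
  assumes x_neg: "x < 0" and y_pos: "0 < y"
    and sle: "upwards_SLE0 \<rho> \<rho> 0 x y \<tau> \<xi> V1 V2"
begin

definition L :: "real \<Rightarrow> real" where "L t = \<xi> t - V1 t"

definition R :: "real \<Rightarrow> real" where "R t = V2 t - \<xi> t"

lemma \<tau>_pos: "0 < \<tau>" and \<xi>_0: "\<xi> 0 = 0" and V1_0: "V1 0 = x" and V2_0: "V2 0 = y"
  and L_0: "L 0 = - x" and R_0: "R 0 = y"
  and L_ne: "t \<in> lifetime \<tau> \<Longrightarrow> L t \<noteq> 0" and R_ne: "t \<in> lifetime \<tau> \<Longrightarrow> R t \<noteq> 0"
  using sle by (auto simp: upwards_SLE0_def lifetime_def L_def R_def)

lemma derivs:
  assumes "t \<in> lifetime \<tau>"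
  shows "(\<xi> has_real_derivative (- \<rho> / L t + \<rho> / R t)) (at t within {0..})" (is ?\<xi>)
    "(V1 has_real_derivative 2 / L t) (at t within {0..})" (is ?V1)
    "(V2 has_real_derivative - 2 / R t) (at t within {0..})" (is ?V2)
proof -
  have d: "(\<xi> has_real_derivative (- \<rho> / (\<xi> t - V1 t) + - \<rho> / (\<xi> t - V2 t))) (at t within {0..})"
    "(V1 has_real_derivative (-2 / (V1 t - \<xi> t))) (at t within {0..})"
    "(V2 has_real_derivative (-2 / (V2 t - \<xi> t))) (at t within {0..})"
    and ne: "\<xi> t \<noteq> V1 t" "\<xi> t \<noteq> V2 t"
    using sle assms unfolding upwards_SLE0_def lifetime_def by blast+
  have "- \<rho> / (\<xi> t - V2 t) = \<rho> / R t" "-2 / (V1 t - \<xi> t) = 2 / L t"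
    using ne by (auto simp: R_def L_def field_simps)
  then show ?\<xi> ?V1 ?V2
    using d by (simp_all add: L_def R_def)
qed

lemma L_deriv:
  assumes "t \<in> lifetime \<tau>"
  shows "(L has_real_derivative (- (\<rho> + 2) / L t + \<rho> / R t)) (at t within {0..})"
proof -
  have "(L has_real_derivative ((- \<rho> / L t + \<rho> / R t) - 2 / L t)) (at t within {0..})"
    unfolding L_def[abs_def] by (intro DERIV_diff derivs[OF assms, unfolded L_def])
  moreover have "(- \<rho> / L t + \<rho> / R t) - 2 / L t = - (\<rho> + 2) / L t + \<rho> / R t"
    by (simp add: add_divide_distrib diff_divide_distrib)
  ultimately show ?thesis
    by (simp only:)
qed

lemma R_deriv:
  assumes "t \<in> lifetime \<tau>"
  shows "(R has_real_derivative (\<rho> / L t - (\<rho> + 2) / R t)) (at t within {0..})"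
proof -
  have "(R has_real_derivative (- 2 / R t - (- \<rho> / L t + \<rho> / R t))) (at t within {0..})"
    unfolding R_def[abs_def] by (intro DERIV_diff derivs[OF assms, unfolded R_def])
  moreover have "- 2 / R t - (- \<rho> / L t + \<rho> / R t) = \<rho> / L t - (\<rho> + 2) / R t"
    by (simp add: add_divide_distrib)
  ultimately show ?thesis
    by (simp only:)
qed

lemma L_pos:
  assumes "t \<in> lifetime \<tau>"
  shows "0 < L t"
proof (rule pos_on_lifetime[OF _ _ _ assms])
  show "continuous_on (lifetime \<tau>) L"
    using L_deriv unfolding has_real_derivative_iff_has_vector_derivative
    by (rule continuous_on_lifetime)
qed (use L_ne L_0 x_neg y_pos in auto)

lemma R_pos:
  assumes "t \<in> lifetime \<tau>"
  shows "0 < R t"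
proof (rule pos_on_lifetime[OF _ _ _ assms])
  show "continuous_on (lifetime \<tau>) R"
    using R_deriv unfolding has_real_derivative_iff_has_vector_derivative
    by (rule continuous_on_lifetime)
qed (use R_ne R_0 x_neg y_pos in auto)

text \<open>The first premise rules out lifetimes beyond \<open>T\<close>, infinite ones included.
  If \<tau> were smaller than \<open>T\<close>, the second would bound both gaps away from 0 on the
  whole lifetime, against the hitting clause of \<open>upwards_SLE0\<close>.\<close>

lemma \<tau>_eqI:
  assumes before: "\<And>t. t \<in> lifetime \<tau> \<Longrightarrow> t < T"
    and gap: "\<And>r. 0 < r \<Longrightarrow> r < T \<Longrightarrow> \<exists>\<delta>>0. \<forall>t\<in>lifetime \<tau>. t < r \<longrightarrow> \<delta> \<le> L t \<and> \<delta> \<le> R t"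
  shows "\<tau> = ereal T"
proof (rule ccontr)
  assume "\<tau> \<noteq> ereal T"
  have "0 < T"
    using before[of 0] \<tau>_pos by (simp add: lifetime_def zero_ereal_def)
  have "\<not> ereal T < \<tau>"
    using before[of T] \<open>0 < T\<close> by (auto simp: lifetime_def)
  then have "\<tau> < ereal T"
    using \<open>\<tau> \<noteq> ereal T\<close> by auto
  then obtain r where r: "\<tau> = ereal r" "0 < r" "r < T"
    using \<tau>_pos by (cases \<tau>) auto
  then obtain \<delta> where "\<delta> > 0" and \<delta>: "\<And>t. t \<in> lifetime \<tau> \<Longrightarrow> \<delta> \<le> L t \<and> \<delta> \<le> R t"
    using gap[OF r(2,3)] by (auto simp: lifetime_ereal)
  have "(INF t\<in>lifetime \<tau>. \<bar>\<xi> t - V1 t\<bar>) \<noteq> 0" "(INF t\<in>lifetime \<tau>. \<bar>\<xi> t - V2 t\<bar>) \<noteq> 0"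
    using \<delta> by (intro INF_neq_0_on_lifetime[OF \<tau>_pos \<open>\<delta> > 0\<close>]; force simp: L_def R_def)+
  then show False
    using sle r(1) unfolding upwards_SLE0_def lifetime_def by simp
qed

text \<open>The force points move by the same flow as \<open>h\<close>, so the derivative of a
  difference contains that difference as a factor. The logarithmic derivatives
  \<open>- 2 / (L * Z)\<close> and \<open>2 / (R * Z)\<close> are the source of both conserved
  quantities.\<close>

lemma h_diff_derivs:
  assumes "z \<in> uhp" "t \<in> lifetime \<tau>"
  defines "Z \<equiv> h t z - of_real (\<xi> t)"
  shows "Z \<noteq> 0"
    "((\<lambda>s. h s z - of_real (V1 s)) has_vector_derivative
      - 2 * (h t z - of_real (V1 t)) / (of_real (L t) * Z)) (at t within {0..})" (is ?V1)
    "((\<lambda>s. h s z - of_real (V2 s)) has_vector_derivative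
      2 * (h t z - of_real (V2 t)) / (of_real (R t) * Z)) (at t within {0..})" (is ?V2)
proof -
  show Z: "Z \<noteq> 0"
    using h_ne[OF assms(1,2)] by (simp add: Z_def)
  have "((\<lambda>s. h s z - of_real (V1 s)) has_vector_derivative (- 2 / Z - of_real (2 / L t))) (at t within {0..})"
    unfolding Z_def using derivs(2)[OF assms(2)]
    by (intro has_vector_derivative_diff has_vector_derivative_of_real h_deriv assms)
  moreover have "h t z - of_real (V1 t) = Z + of_real (L t)"
    by (simp add: Z_def L_def)
  then have "- 2 / Z - of_real (2 / L t) = - 2 * (h t z - of_real (V1 t)) / (of_real (L t) * Z)"
    using Z L_ne[OF assms(2)] by (simp add: field_simps)
  ultimately show ?V1
    by simp
  have "((\<lambda>s. h s z - of_real (V2 s)) has_vector_derivative (- 2 / Z - of_real (- 2 / R t))) (at t within {0..})"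
    unfolding Z_def using derivs(3)[OF assms(2)]
    by (intro has_vector_derivative_diff has_vector_derivative_of_real h_deriv assms)
  moreover have "h t z - of_real (V2 t) = Z - of_real (R t)"
    by (simp add: Z_def R_def)
  then have "- 2 / Z - of_real (- 2 / R t) = 2 * (h t z - of_real (V2 t)) / (of_real (R t) * Z)"
    using Z R_ne[OF assms(2)] by (simp only:) (simp add: field_simps)
  ultimately show ?V2
    by simp
qed

lemma limit_at_hitting:
  assumes "\<tau> = ereal T" "(L \<longlongrightarrow> 0) (at_left T)" "(R \<longlongrightarrow> 0) (at_left T)" "(\<xi> \<longlongrightarrow> b) (at_left T)"
  shows "upto_time \<tau> \<xi> T = b" "(V1 \<longlongrightarrow> b) (at_left T)" "(V2 \<longlongrightarrow> b) (at_left T)"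
proof -
  show "upto_time \<tau> \<xi> T = b"
    using tendsto_Lim[OF _ assms(4)] assms(1) by (simp add: upto_time_def)
  have "((\<lambda>t. \<xi> t - L t) \<longlongrightarrow> b - 0) (at_left T)" "((\<lambda>t. \<xi> t + R t) \<longlongrightarrow> b + 0) (at_left T)"
    by (intro tendsto_intros assms)+
  then show "(V1 \<longlongrightarrow> b) (at_left T)" "(V2 \<longlongrightarrow> b) (at_left T)"
    by (simp_all add: L_def R_def)
qed

end

section \<open>Powers on the closed half-plane\<close>

text \<open>Rotating by a quarter turn moves the branch cut of the power away from the half-plane.\<close>

lemma continuous_on_powr_halfplane:
  assumes "0 < p"
  shows "continuous_on {z. 0 \<le> Im z} (\<lambda>z. (z - of_real u) powr of_real p)"
proof -
  have "(z - of_real u) powr of_real p = exp (\<i> * (pi / 2) * p) * (- \<i> * (z - of_real u)) powr of_real p"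
    if "0 \<le> Im z" for z
  proof (cases "z = of_real u")
    case True
    then show ?thesis
      using assms by simp
  next
    case False
    define w where "w = z - of_real u"
    have w: "w \<noteq> 0" "0 \<le> Im w"
      using False that by (auto simp: w_def)
    have "0 \<le> Im (Ln w)" "Im (Ln w) \<le> pi"
      using w Im_Ln_pos_le[OF w(1)] by auto
    moreover have "Im (Ln (- \<i>)) = - (pi / 2)"
      by simp
    ultimately have "- pi < Im (Ln (- \<i>)) + Im (Ln w)" "Im (Ln (- \<i>)) + Im (Ln w) \<le> pi"
      using pi_gt_zero by linarith+
    then have "Ln (- \<i> * w) = Ln (- \<i>) + Ln w"
      using w by (intro Ln_times_simple) simp_all
    then have "Ln w = Ln (- \<i> * w) + \<i> * (pi / 2)"
      by simp
    then show ?thesis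
      using w unfolding w_def[symmetric] powr_def by (simp add: exp_add[symmetric] algebra_simps)
  qed
  then have eq: "z \<in> {z. 0 \<le> Im z} \<Longrightarrow> (z - of_real u) powr of_real p =
      exp (\<i> * (pi / 2) * p) * (- \<i> * (z - of_real u)) powr of_real p" for z
    by blast
  have "continuous_on {z. 0 \<le> Im z}
      (\<lambda>z. exp (\<i> * (pi / 2) * p) * (- \<i> * (z - of_real u)) powr of_real p)"
    using assms by (intro continuous_intros) auto
  then show ?thesis
    by (rule continuous_on_eq) (rule eq[symmetric])
qed

text \<open>The principal argument of a negative real is pi, which is also its limit from the upper
  half-plane.\<close>

lemma powr_of_neg:
  assumes "u < v"
  shows "(complex_of_real u - of_real v) powr of_real p = of_real ((v - u) powr p) * exp (\<i> * pi * p)"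
  using powr_of_real_if[of "u - v" p] assms by simp

lemma powr_of_nonneg:
  assumes "v \<le> u"
  shows "(complex_of_real u - of_real v) powr of_real p = of_real ((u - v) powr p)"
  using powr_of_real[of "u - v" p] assms by simp

section \<open>Boundary values along a slit\<close>

context polar_slit_domain
begin

lemma slit_point_unique:
  assumes "z \<in> insert (of_real b) (polar_slit b m c)" "w \<in> insert (of_real b) (polar_slit b m c)"
    "cmod (z - of_real b) = cmod (w - of_real b)"
  shows "z = w"
proof (cases "z = of_real b \<or> w = of_real b")
  case True
  then show ?thesis
    using assms(3) by auto
next
  case False
  have "v = polar_pt b (cmod (v - of_real b)) (c (cmod (v - of_real b)))" if "v \<in> polar_slit b m c" for v
  proof -
    have "v \<noteq> of_real b" "0 \<le> Im v"
      using that by (auto simp: polar_slit_def uhp_def)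
    moreover have "Re (v - of_real b) / cmod (v - of_real b) = c (cmod (v - of_real b))"
      using that \<open>v \<noteq> of_real b\<close> by (simp add: polar_slit_def)
    ultimately show ?thesis
      using eq_polar_pt by metis
  qed
  then show ?thesis
    using assms False by (metis insertE)
qed

text \<open>The radius along \<open>F\<close> is continuous and takes the values 0 and
  \<open>m\<close>, hence all values between them, and a point of the slit is determined by its
  radius.\<close>

lemma slit_parametrization:
  fixes F :: "real \<Rightarrow> complex"
  assumes F: "continuous_on {u..v} F" "\<And>s. s \<in> {u..v} \<Longrightarrow> F s \<in> insert (of_real b) (polar_slit b m c)"
    and inj: "inj_on (\<lambda>s. cmod (F s - of_real b)) {u..v}"
    and ends: "s0 \<in> {u..v}" "s1 \<in> {u..v}" "F s0 = of_real b" "cmod (F s1 - of_real b) = m"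
  shows "inj_on F {u..v}" "F ` {u..v} = insert (of_real b) (polar_slit b m c)"
proof -
  show "inj_on F {u..v}"
    using inj by (auto simp: inj_on_def)
  have "connected ((\<lambda>s. cmod (F s - of_real b)) ` {u..v})"
    using F(1) by (intro connected_continuous_image continuous_intros) auto
  then have *: "{0..m} \<subseteq> (\<lambda>s. cmod (F s - of_real b)) ` {u..v}"
    by (rule connected_contains_Icc) (use ends in force)+
  show "F ` {u..v} = insert (of_real b) (polar_slit b m c)"
  proof
    show "insert (of_real b) (polar_slit b m c) \<subseteq> F ` {u..v}"
    proof
      fix z assume z: "z \<in> insert (of_real b) (polar_slit b m c)"
      then have "cmod (z - of_real b) \<in> {0..m}"
        using m_pos by (auto simp: polar_slit_def)
      then obtain s where s: "s \<in> {u..v}" "cmod (z - of_real b) = cmod (F s - of_real b)"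
        using * by blast
      then show "z \<in> F ` {u..v}"
        using slit_point_unique[OF z F(2)[OF s(1)]] by blast
    qed
  qed (use F(2) in blast)
qed

end

text \<open>The final step for both weights. Injectivity of the radius on each of
  \<open>{x..0}\<close> and \<open>{0..y}\<close> expresses that each interval is folded onto the
  slit once, with 0 going to the tip.\<close>

lemma (in force_flow) force_points_end_at_baseI:
  assumes slit: "polar_slit_domain m c"
    and T: "\<tau> = ereal T" "0 < T"
    and lim: "(L \<longlongrightarrow> 0) (at_left T)" "(R \<longlongrightarrow> 0) (at_left T)" "(\<xi> \<longlongrightarrow> b) (at_left T)"
    and f: "continuous_on {z. 0 \<le> Im z} f" "\<And>z. z \<in> uhp \<Longrightarrow> loewner_map \<tau> h T z = f z"
      "f ` uhp = uhp - polar_slit b m c"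
    and on_slit: "\<And>u. u \<in> {x..y} \<Longrightarrow> f (of_real u) \<in> insert (of_real b) (polar_slit b m c)"
    and inj: "inj_on (\<lambda>u. cmod (f (of_real u) - of_real b)) {x..0}"
      "inj_on (\<lambda>u. cmod (f (of_real u) - of_real b)) {0..y}"
    and ends: "f (of_real x) = of_real b" "f (of_real y) = of_real b" "cmod (f 0 - of_real b) = m"
    and left: "\<And>\<delta>. 0 < \<delta> \<Longrightarrow> \<exists>u. \<bar>u - x\<bar> < \<delta> \<and> Im (f (of_real u)) = 0 \<and> Re (f (of_real u)) < b"
    and right: "\<And>\<delta>. 0 < \<delta> \<Longrightarrow> \<exists>u. \<bar>u - y\<bar> < \<delta> \<and> Im (f (of_real u)) = 0 \<and> b < Re (f (of_real u))"
  shows "loewner_hull \<tau> h T = polar_slit b m c" "force_points_end_at_base \<tau> T \<xi> V1 V2 h"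
proof -
  interpret slit: polar_slit_domain b m c
    by (rule slit)
  have "loewner_map \<tau> h T ` uhp = uhp - polar_slit b m c"
    using f(2,3) by (metis image_cong)
  then show hull: "loewner_hull \<tau> h T = polar_slit b m c"
    by (auto simp: loewner_hull_def polar_slit_def)
  note V = limit_at_hitting[OF T(1) lim]
  have prime_ends: "maps_to_base_prime_ends (loewner_map \<tau> h T) (polar_slit b m c) b x y"
    by (rule slit.maps_to_base_prime_endsI[OF f(1) _ ends(1,2) f(2) left right])
      (simp_all add: f(3) slit.\<Omega>_def)
  have cont: "continuous_on S (\<lambda>u. f (complex_of_real u))" for S
    by (rule continuous_on_compose2[OF f(1)]) (auto intro: continuous_intros)
  have sides: "inj_on (\<lambda>u. f (of_real u)) {x..0}"
    "(\<lambda>u. f (of_real u)) ` {x..0} = insert (of_real b) (polar_slit b m c)"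
    "inj_on (\<lambda>u. f (of_real u)) {0..y}"
    "(\<lambda>u. f (of_real u)) ` {0..y} = insert (of_real b) (polar_slit b m c)"
    using x_neg y_pos ends
    by (intro slit.slit_parametrization[OF cont on_slit inj(1), of x 0]
        slit.slit_parametrization[OF cont on_slit inj(2), of y 0]; simp)+
  then have "maps_to_two_sides (loewner_map \<tau> h T) (polar_slit b m c) b x 0 y"
    unfolding maps_to_two_sides_def
    using f(1,2) ends(1,2)
    by (intro exI[of _ f]) (auto simp: image_image o_def intro!: inj_on_imageI)
  then show "force_points_end_at_base \<tau> T \<xi> V1 V2 h"
    unfolding force_points_end_at_base_def hull V(1) V1_0 V2_0 \<xi>_0
    using T h_tendsto(1) V lim(3) prime_ends by simp
qed

text \<open>The image is open by the open mapping theorem. It is closed in \<Omega> because a proper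
  map has closed image on the closed half-plane and the real line contributes nothing inside
  \<Omega>.\<close>

lemma image_eq_of_proper:
  fixes f :: "complex \<Rightarrow> complex"
  assumes cont: "continuous_on {z. 0 \<le> Im z} f" and hol: "f holomorphic_on uhp"
    and \<Omega>: "connected \<Omega>" "f ` uhp \<subseteq> \<Omega>" and boundary: "\<And>u. f (of_real u) \<notin> \<Omega>"
    and proper: "\<And>r. bounded {z. 0 \<le> Im z \<and> cmod (f z) \<le> r}"
  shows "f ` uhp = \<Omega>"
proof -
  have "\<not> f constant_on uhp"
  proof
    assume "f constant_on uhp"
    then obtain w where w: "\<And>z. z \<in> uhp \<Longrightarrow> f z = w"
      unfolding constant_on_def by blast
    obtain B where B: "\<And>z. 0 \<le> Im z \<Longrightarrow> cmod (f z) \<le> cmod w \<Longrightarrow> cmod z \<le> B"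
      using proper[of "cmod w"] unfolding bounded_iff by blast
    have "Complex 0 (\<bar>B\<bar> + 1) \<in> uhp"
      by (simp add: uhp_def)
    then have "cmod (Complex 0 (\<bar>B\<bar> + 1)) \<le> B"
      using w by (intro B) (auto simp: uhp_def)
    then show False
      by (simp add: cmod_def)
  qed
  then have "open (f ` uhp)"
    using open_mapping_thm[OF hol open_uhp convex_connected[OF convex_uhp] open_uhp order_refl] by blast
  define H where "H = {z. 0 \<le> Im z}"
  have "closed H"
    unfolding H_def by (simp add: closed_halfspace_Im_ge)
  have closed_r: "closed (f ` H \<inter> cball 0 r)" for r
  proof -
    have "f ` H \<inter> cball 0 r = f ` (H \<inter> f -` cball 0 r)"
      by auto
    moreover have "closed (H \<inter> f -` cball 0 r)"
      using cont \<open>closed H\<close> by (intro continuous_closed_preimage) (auto simp: H_def)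
    moreover have "bounded (H \<inter> f -` cball 0 r)"
      using proper[of r] by (rule bounded_subset) (auto simp: H_def)
    ultimately show ?thesis
      using cont by (metis H_def Int_lower1 compact_continuous_image compact_eq_bounded_closed
          compact_imp_closed continuous_on_subset)
  qed
  have "closed (f ` H)"
    unfolding closure_subset_eq[symmetric]
  proof
    fix w assume "w \<in> closure (f ` H)"
    \<comment> \<open>Properness gives closedness only of bounded pieces of the image, so the
      closure is examined inside a ball around \<open>w\<close>.\<close>
    then have "w \<in> closure (ball w 1 \<inter> f ` H)"
      using open_Int_closure_subset[of "ball w 1" "f ` H"] by auto
    moreover have "ball w 1 \<inter> f ` H \<subseteq> f ` H \<inter> cball 0 (cmod w + 1)"
      by (auto simp: dist_norm) (smt (verit) norm_triangle_ineq2 norm_minus_commute)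
    ultimately have "w \<in> closure (f ` H \<inter> cball 0 (cmod w + 1))"
      using closure_mono by blast
    then show "w \<in> f ` H"
      using closed_r[of "cmod w + 1"] by (simp add: closure_closed)
  qed
  have "H = uhp \<union> range of_real"
    by (auto simp: H_def uhp_def complex_eq_iff image_iff)
  then have eq: "f ` uhp = \<Omega> \<inter> f ` H"
    using \<Omega>(2) boundary by auto
  have "openin (top_of_set \<Omega>) (f ` uhp)"
    using \<open>open (f ` uhp)\<close> \<Omega>(2) by (simp add: open_subset)
  moreover have "closedin (top_of_set \<Omega>) (f ` uhp)"
    unfolding eq using \<open>closed (f ` H)\<close> by (simp add: closedin_closed_Int)
  moreover have "f ` uhp \<noteq> {}"
    by (auto simp: uhp_def intro: exI[of _ \<i>])
  ultimately show ?thesis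
    using \<Omega>(1) unfolding connected_clopen by blast
qed

section \<open>Weights -2\<close>

text \<open>Both sides agree at 0, and the difference has derivative
  \<open>q * (cos (q * s) - cos s)\<close>, positive because cosine decreases.\<close>

lemma sin_scaled_gt:
  fixes q s :: real
  assumes "0 < q" "q < 1" "0 < s" "s < pi"
  shows "q * sin s < sin (q * s)"
proof -
  have "sin (q * 0) - q * sin 0 < sin (q * s) - q * sin s"
  proof (rule DERIV_pos_imp_increasing_open[where f = "\<lambda>s. sin (q * s) - q * sin s", OF assms(3)])
    fix r assume r: "0 < r" "r < s"
    have "((\<lambda>s. sin (q * s) - q * sin s) has_real_derivative q * (cos (q * r) - cos r)) (at r)"
      by (auto intro!: derivative_eq_intros simp: algebra_simps)
    moreover have "cos r < cos (q * r)"
      using assms r by (intro cos_monotone_0_pi) auto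
    ultimately show "\<exists>d. ((\<lambda>s. sin (q * s) - q * sin s) has_real_derivative d) (at r) \<and> 0 < d"
      using assms(1) by (intro exI[of _ "q * (cos (q * r) - cos r)"]) simp
  qed (intro continuous_intros)
  then show ?thesis
    by simp
qed

locale rho2_flow = force_flow \<tau> \<xi> h "-2" x y V1 V2
  for \<tau> :: ereal and \<xi> :: "real \<Rightarrow> real" and h :: "real \<Rightarrow> complex \<Rightarrow> complex"
    and x y :: real and V1 V2 :: "real \<Rightarrow> real"
begin

text \<open>The product \<open>L * R\<close> starts at \<open>- x * y\<close> and decreases at
  constant rate 4; this is the time at which it vanishes.\<close>

definition T :: real where "T = - x * y / 4"

lemma T_pos: "0 < T"
  using x_neg y_pos by (simp add: T_def mult_neg_pos)

lemma L_R_product: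
  assumes "t \<in> lifetime \<tau>"
  shows "L t * R t = 4 * (T - t)"
proof -
  have "((\<lambda>t. L t * R t + 4 * t) has_real_derivative 0) (at t within {0..})" if "t \<in> lifetime \<tau>" for t
    by (rule derivative_eq_intros refl L_deriv R_deriv that)+
      (use L_ne[OF that] R_ne[OF that] in simp)
  from real_constant_on_lifetime[OF this assms] show ?thesis
    by (simp add: L_0 R_0 T_def)
qed

text \<open>Both gaps have logarithmic derivative \<open>- 2 / (L * R)\<close>. With
  \<open>L_R_product\<close> this determines each of them and makes them vanish together.\<close>

lemma L_R_ratio:
  assumes "t \<in> lifetime \<tau>"
  shows "- x * R t = y * L t"
proof -
  have "((\<lambda>t. L t / R t) has_real_derivative 0) (at t within {0..})" if "t \<in> lifetime \<tau>" for t
    by (rule derivative_eq_intros refl L_deriv R_deriv that R_ne)+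
      (use L_ne[OF that] R_ne[OF that] in simp)
  from real_constant_on_lifetime[OF this assms] show ?thesis
    using R_ne[OF assms] y_pos by (simp add: L_0 R_0 field_simps)
qed

lemma \<xi>_eq:
  assumes "t \<in> lifetime \<tau>"
  shows "\<xi> t = x + y + L t - R t"
proof -
  have "((\<lambda>t. \<xi> t - L t + R t) has_real_derivative 0) (at t within {0..})" if "t \<in> lifetime \<tau>" for t
    by (rule derivative_eq_intros refl L_deriv R_deriv derivs that)+ (simp add: field_simps)
  from real_constant_on_lifetime[OF this assms] show ?thesis
    by (simp add: L_0 R_0 \<xi>_0)
qed

lemma L_squared:
  assumes "t \<in> lifetime \<tau>"
  shows "(L t)\<^sup>2 = 4 * (T - t) * (- x) / y" "(R t)\<^sup>2 = 4 * (T - t) * y / (- x)"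
proof -
  have "y * (L t)\<^sup>2 = (- x * R t) * L t" "(- x) * (R t)\<^sup>2 = (y * L t) * R t"
    using L_R_ratio[OF assms] by (simp_all only: power2_eq_square flip: mult.assoc)
  then have "y * (L t)\<^sup>2 = - x * (4 * (T - t))" "(- x) * (R t)\<^sup>2 = y * (4 * (T - t))"
    using L_R_product[OF assms] by (simp_all add: mult.commute mult.left_commute)
  then show "(L t)\<^sup>2 = 4 * (T - t) * (- x) / y" "(R t)\<^sup>2 = 4 * (T - t) * y / (- x)"
    using x_neg y_pos by (simp_all add: field_simps)
qed

lemma \<tau>_eq: "\<tau> = ereal T"
proof (rule \<tau>_eqI)
  show "t < T" if "t \<in> lifetime \<tau>" for t
    using L_R_product[OF that] mult_pos_pos[OF L_pos[OF that] R_pos[OF that]] by simp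
next
  fix r assume r: "0 < r" "r < T"
  \<comment> \<open>These are the values that \<open>L_squared\<close> prescribes at time
    \<open>r\<close>; both gaps are larger before \<open>r\<close>.\<close>
  define \<delta> where "\<delta> = min (sqrt (4 * (T - r) * (- x) / y)) (sqrt (4 * (T - r) * y / (- x)))"
  have "\<delta> > 0"
    using r x_neg y_pos unfolding \<delta>_def
    by (intro min_less_iff_conj[THEN iffD2] conjI real_sqrt_gt_zero divide_pos_pos mult_pos_pos) auto
  moreover have "\<delta> \<le> L t \<and> \<delta> \<le> R t" if t: "t \<in> lifetime \<tau>" "t < r" for t
  proof
    have "sqrt (4 * (T - r) * (- x) / y) \<le> sqrt ((L t)\<^sup>2)"
      unfolding L_squared[OF t(1)] using t x_neg y_pos
      by (intro real_sqrt_le_mono divide_right_mono mult_right_mono) auto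
    then show "\<delta> \<le> L t"
      using L_pos[OF t(1)] by (simp add: \<delta>_def)
    have "sqrt (4 * (T - r) * y / (- x)) \<le> sqrt ((R t)\<^sup>2)"
      unfolding L_squared[OF t(1)] using t x_neg y_pos
      by (intro real_sqrt_le_mono divide_right_mono mult_right_mono) auto
    then show "\<delta> \<le> R t"
      using R_pos[OF t(1)] by (simp add: \<delta>_def)
  qed
  ultimately show "\<exists>\<delta>>0. \<forall>t\<in>lifetime \<tau>. t < r \<longrightarrow> \<delta> \<le> L t \<and> \<delta> \<le> R t"
    by blast
qed

lemma gaps_tendsto: "(L \<longlongrightarrow> 0) (at_left T)" "(R \<longlongrightarrow> 0) (at_left T)" "(\<xi> \<longlongrightarrow> x + y) (at_left T)"
proof -
  note ev = eventually_at_left_lifetime[OF \<tau>_eq T_pos]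
  have L: "((\<lambda>t. sqrt (4 * (T - t) * (- x) / y)) \<longlongrightarrow> sqrt (4 * (T - T) * (- x) / y)) (at_left T)"
    and R: "((\<lambda>t. sqrt (4 * (T - t) * y / (- x))) \<longlongrightarrow> sqrt (4 * (T - T) * y / (- x))) (at_left T)"
    using x_neg y_pos by (intro tendsto_intros; simp)+
  have "\<forall>\<^sub>F t in at_left T. L t = sqrt (4 * (T - t) * (- x) / y)"
    using ev by eventually_elim (metis L_squared(1) L_pos real_sqrt_abs abs_of_pos)
  with L show L0: "(L \<longlongrightarrow> 0) (at_left T)"
    by (simp add: tendsto_cong)
  have "\<forall>\<^sub>F t in at_left T. R t = sqrt (4 * (T - t) * y / (- x))"
    using ev by eventually_elim (metis L_squared(2) R_pos real_sqrt_abs abs_of_pos)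
  with R show R0: "(R \<longlongrightarrow> 0) (at_left T)"
    by (simp add: tendsto_cong)
  have "\<forall>\<^sub>F t in at_left T. \<xi> t = x + y + L t - R t"
    using ev by eventually_elim (rule \<xi>_eq)
  moreover have "((\<lambda>t. x + y + L t - R t) \<longlongrightarrow> x + y + 0 - 0) (at_left T)"
    by (intro tendsto_intros L0 R0)
  ultimately show "(\<xi> \<longlongrightarrow> x + y) (at_left T)"
    by (simp add: tendsto_cong)
qed

text \<open>This is \<open>L / (L + R)\<close>, constant in time. It is the weight for which
  \<open>p / L = (1 - p) / R\<close>, so that the two logarithmic derivatives in
  \<open>h_diff_derivs\<close> cancel.\<close>

definition p :: real where "p = - x / (y - x)"

lemma p: "0 < p" "p < 1" "1 - p = y / (y - x)"
  using x_neg y_pos by (auto simp: p_def field_simps)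

lemma pq: "(y - x) * p = - x" "(y - x) * (1 - p) = y"
  unfolding p(3) using x_neg y_pos by (simp_all add: p_def)

text \<open>Stated for logarithms, which are smooth here since \<open>h\<close> stays in the
  half-plane.\<close>

lemma log_invariant:
  assumes "z \<in> uhp" "t \<in> lifetime \<tau>"
  shows "of_real p * Ln (h t z - of_real (V1 t)) + of_real (1 - p) * Ln (h t z - of_real (V2 t)) =
    of_real p * Ln (z - of_real x) + of_real (1 - p) * Ln (z - of_real y)"
proof -
  let ?E = "\<lambda>t. of_real p * Ln (h t z - of_real (V1 t)) + of_real (1 - p) * Ln (h t z - of_real (V2 t))"
  have "(?E has_vector_derivative 0) (at t within {0..})" if t: "t \<in> lifetime \<tau>" for t
  proof -
    define Z where "Z = h t z - of_real (\<xi> t)"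
    note d = h_diff_derivs[OF assms(1) t, folded Z_def]
    have W: "h t z - of_real v \<notin> \<real>\<^sub>\<le>\<^sub>0" for v
      using h_in_uhp[OF assms(1) t] by (auto simp: uhp_def complex_nonpos_Reals_iff)
    then have ne: "h t z - of_real v \<noteq> 0" for v
      by (metis nonpos_Reals_zero_I)
    have Ln: "((\<lambda>t. Ln (W t)) has_vector_derivative W' / W t) (at t within {0..})"
      if "(W has_vector_derivative W') (at t within {0..})" "W t \<notin> \<real>\<^sub>\<le>\<^sub>0" for W W'
      using field_vector_diff_chain_within[OF that(1), of Ln "inverse (W t)"]
        has_field_derivative_at_within[OF has_field_derivative_Ln[OF that(2)]]
      by (simp add: o_def divide_inverse)
    have cancel: "w \<noteq> 0 \<Longrightarrow> a * w / v / w = a / v" for a v w :: complex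
      by simp
    let ?W1 = "h t z - of_real (V1 t)" and ?W2 = "h t z - of_real (V2 t)"
    let ?D = "of_real p * (- 2 * ?W1 / (of_real (L t) * Z) / ?W1) +
      of_real (1 - p) * (2 * ?W2 / (of_real (R t) * Z) / ?W2)"
    let ?D' = "of_real p * (- 2 / (of_real (L t) * Z)) + of_real (1 - p) * (2 / (of_real (R t) * Z))"
    let ?D'' = "of_real (((1 - p) * L t - p * R t) / (L t * R t)) * (2 / Z)"
    have "(?E has_vector_derivative ?D) (at t within {0..})"
      by (intro has_vector_derivative_add has_vector_derivative_mult_right Ln d W)
    moreover have "?D = ?D'"
      using cancel[OF ne[of "V1 t"], of "- 2" "of_real (L t) * Z"]
        cancel[OF ne[of "V2 t"], of 2 "of_real (R t) * Z"] by (simp only:)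
    moreover have "?D' = ?D''"
      using d(1) L_ne[OF t] R_ne[OF t] by (simp add: field_simps)
    ultimately have "(?E has_vector_derivative ?D'') (at t within {0..})"
      by (simp only:)
    moreover have "(1 - p) * L t - p * R t = 0"
    proof -
      have "(y - x) * ((1 - p) * L t - p * R t) = ((y - x) * (1 - p)) * L t - ((y - x) * p) * R t"
        by (simp add: algebra_simps)
      also have "\<dots> = 0"
        unfolding pq using L_R_ratio[OF t] by simp
      finally show ?thesis
        using x_neg y_pos by simp
    qed
    ultimately show ?thesis
      by simp
  qed
  from constant_on_lifetime[OF this assms(2)] show ?thesis
    using assms(1) by (simp add: h_0 V1_0 V2_0)
qed

definition f :: "complex \<Rightarrow> complex" where
  "f z = of_real (x + y) + (z - of_real x) powr of_real p * (z - of_real y) powr of_real (1 - p)"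

lemma loewner_map_eq:
  assumes "z \<in> uhp"
  shows "loewner_map \<tau> h T z = f z"
proof -
  let ?E = "\<lambda>t. of_real p * Ln (h t z - of_real (V1 t)) + of_real (1 - p) * Ln (h t z - of_real (V2 t))"
  let ?C = "of_real p * Ln (z - of_real x) + of_real (1 - p) * Ln (z - of_real y)"
  define l where "l = loewner_map \<tau> h T z"
  note lim = h_tendsto[OF assms \<tau>_eq T_pos, folded l_def]
  note V = limit_at_hitting[OF \<tau>_eq gaps_tendsto]
  define w where "w = l - of_real (x + y)"
  have "0 < Im w"
    using lim(2) assms by (simp add: w_def uhp_def)
  then have w: "w \<notin> \<real>\<^sub>\<le>\<^sub>0" "w \<noteq> 0"
    by (auto simp: complex_nonpos_Reals_iff)
  \<comment> \<open>\<open>V1\<close> and \<open>V2\<close> have the same limit, so in the limit the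
    weights add up to a single \<open>Ln w\<close>.\<close>
  have "(?E
      \<longlongrightarrow> of_real p * Ln w + of_real (1 - p) * Ln w) (at_left T)"
    unfolding w_def using w(1) by (intro tendsto_intros lim V) (auto simp: w_def)
  moreover have "\<forall>\<^sub>F t in at_left T. ?E t =
      ?C"
    using eventually_at_left_lifetime[OF \<tau>_eq T_pos] by eventually_elim (rule log_invariant[OF assms])
  ultimately have "((\<lambda>t. ?C)
      \<longlongrightarrow> of_real p * Ln w + of_real (1 - p) * Ln w) (at_left T)"
    by (simp only: tendsto_cong)
  then have "of_real p * Ln w + of_real (1 - p) * Ln w =
      ?C"
    using tendsto_unique[OF _ tendsto_const] by (metis trivial_limit_at_left_real)
  then have "Ln w = ?C"
    by (simp add: algebra_simps)
  then have "w = exp (?C)"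
    using w(2) exp_Ln by metis
  moreover have "z - of_real v \<noteq> 0" for v
    using assms by (auto simp: uhp_def)
  ultimately have "w = (z - of_real x) powr of_real p * (z - of_real y) powr of_real (1 - p)"
    by (simp only: powr_def exp_add) simp
  then show ?thesis
    unfolding f_def by (simp add: w_def l_def algebra_simps)
qed

section \<open>The image of the explicit map for weights -2\<close>

definition b :: real where "b = x + y"

text \<open>Between \<open>x\<close> and \<open>y\<close> the power with exponent \<open>p\<close>
  has argument 0, and the one with exponent \<open>1 - p\<close> has base of argument pi.\<close>

definition \<theta> :: real where "\<theta> = (1 - p) * pi"

text \<open>The distance from \<open>b\<close> to \<open>f 0\<close>: the starting point of the
  driver goes to the tip.\<close>

definition m :: real where "m = (- x) powr p * y powr (1 - p)"

lemma m_pos: "0 < m"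
  using x_neg y_pos by (simp add: m_def)

lemma \<theta>: "0 < \<theta>" "\<theta> < pi" "0 < sin \<theta>" "\<bar>cos \<theta>\<bar> < 1"
proof -
  show "0 < \<theta>" "\<theta> < pi"
    using p(1,2) by (auto simp: \<theta>_def)
  then show "0 < sin \<theta>"
    by (rule sin_gt_zero)
  then have "(cos \<theta>)\<^sup>2 < 1"
    by (simp add: cos_squared_eq)
  then show "\<bar>cos \<theta>\<bar> < 1"
    by (simp add: abs_square_less_1)
qed

lemma slit_domain: "0 < m' \<Longrightarrow> polar_slit_domain m' (\<lambda>_. cos \<theta>)"
  using \<theta>(4) by unfold_locales auto

sublocale slit: polar_slit_domain b m "\<lambda>_. cos \<theta>"
  by (rule slit_domain[OF m_pos])

text \<open>
  If \<open>f z\<close> lies on the line of the slit, then the angles of the triangle \<open>x, y, z\<close> at \<open>x\<close> and \<open>y\<close>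
  are \<open>(1 - p) * s\<close> and \<open>p * s\<close>, and the law of sines with the concavity of the sine on
  \<open>{0..pi}\<close> gives \<open>cmod (f z - b) > m\<close>.
\<close>

lemma triangle:
  assumes z: "z \<in> uhp"
    and angle: "p * Im (Ln (z - of_real x)) + (1 - p) * Im (Ln (z - of_real y)) = \<theta>"
  shows "- x < cmod (z - of_real x)" "y < cmod (z - of_real y)"
proof -
  define A B where "A = Im (Ln (z - of_real x))" and "B = Im (Ln (z - of_real y))"
  define d e where "d = cmod (z - of_real x)" and "e = cmod (z - of_real y)"
  have polar: "z - of_real v = of_real (cmod (z - of_real v)) * cis (Im (Ln (z - of_real v)))" for v
  proof -
    have "z - of_real v \<noteq> 0"
      using z by (auto simp: uhp_def)
    then have "z - of_real v = exp (Ln (z - of_real v))"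
      by simp
    also have "\<dots> = of_real (exp (Re (Ln (z - of_real v)))) * cis (Im (Ln (z - of_real v)))"
      by (rule exp_eq_polar)
    finally show ?thesis
      using \<open>z - of_real v \<noteq> 0\<close> by simp
  qed
  have "0 < d" "0 < e"
    using z by (auto simp: d_def e_def uhp_def)
  have "0 < Im z"
    using z by (simp add: uhp_def)
  then have A: "0 < A" "A < pi" and B: "0 < B" "B < pi"
    using Im_Ln_pos_lt_imp[of "z - of_real x"] Im_Ln_pos_lt_imp[of "z - of_real y"]
    by (auto simp: A_def B_def)
  have zx: "z = of_real x + of_real d * cis A" and zy: "z = of_real y + of_real e * cis B"
    using polar[of x] polar[of y] by (simp_all add: A_def B_def d_def e_def algebra_simps)
  have re: "d * cos A - e * cos B = y - x" and im: "d * sin A = e * sin B"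
    using arg_cong[OF zx, of Re] arg_cong[OF zy, of Re] arg_cong[OF zx, of Im] arg_cong[OF zy, of Im]
    by simp_all
  have "d * sin (B - A) = sin B * (d * cos A) - cos B * (d * sin A)"
    by (simp add: sin_diff algebra_simps)
  also have "\<dots> = (d * cos A - e * cos B) * sin B"
    unfolding im by (simp add: algebra_simps)
  also have "\<dots> = (y - x) * sin B"
    using re by simp
  finally have d: "d * sin (B - A) = (y - x) * sin B" .
  have "e * sin (B - A) = sin A * (- e * cos B) + cos A * (e * sin B)"
    by (simp add: sin_diff algebra_simps)
  also have "\<dots> = (d * cos A - e * cos B) * sin A"
    unfolding im[symmetric] by (simp add: algebra_simps)
  also have "\<dots> = (y - x) * sin A"
    using re by simp
  finally have e: "e * sin (B - A) = (y - x) * sin A" .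
  have "0 < d * sin (B - A)"
    unfolding d using x_neg y_pos sin_gt_zero[OF B] by simp
  then have "0 < sin (B - A)"
    using \<open>0 < d\<close> by (simp add: zero_less_mult_iff)
  \<comment> \<open>In the triangle the angle at \<open>z\<close> is \<open>B - A\<close>, so
    \<open>s\<close> is the sum of the angles \<open>A\<close> at \<open>x\<close> and
    \<open>pi - B\<close> at \<open>y\<close>.\<close>
  define s where "s = pi - (B - A)"
  have "0 < B - A"
  proof (rule ccontr)
    assume "\<not> 0 < B - A"
    then have "0 \<le> sin (A - B)"
      using A B by (intro sin_ge_zero) auto
    then show False
      using \<open>0 < sin (B - A)\<close> sin_minus[of "B - A"] by simp
  qed
  then have s: "0 < s" "s < pi"
    using A B by (auto simp: s_def)
  have sin_s: "sin (B - A) = sin s"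
    by (simp add: s_def sin_diff)
  have "p * A + (1 - p) * B = (1 - p) * pi"
    using angle by (simp add: \<theta>_def A_def B_def)
  then have "A = (1 - p) * s" "pi - B = p * s"
    by (simp_all add: s_def algebra_simps)
  then have "sin A = sin ((1 - p) * s)" "sin B = sin (p * s)"
    by (simp, metis sin_pi_minus)
  then have "(1 - p) * sin s < sin A" "p * sin s < sin B"
    using sin_scaled_gt[of p s] sin_scaled_gt[of "1 - p" s] p(1,2) s by simp_all
  then have "(y - x) * (p * sin s) < d * sin s" "(y - x) * ((1 - p) * sin s) < e * sin s"
    using d e x_neg y_pos unfolding sin_s by simp_all
  then have "(y - x) * p < d" "(y - x) * (1 - p) < e"
    using \<open>0 < sin (B - A)\<close> unfolding sin_s mult.assoc[symmetric] by simp_all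
  then show "- x < cmod (z - of_real x)" "y < cmod (z - of_real y)"
    unfolding pq by (simp_all add: d_def e_def)
qed

lemma cmod_f: "cmod (f z - of_real b) = cmod (z - of_real x) powr p * cmod (z - of_real y) powr (1 - p)"
  by (simp add: f_def b_def norm_mult norm_powr_real_powr')

text \<open>The argument of \<open>f z - b\<close> is a weighted mean of two angles in the open
  interval from 0 to pi, so \<open>f z\<close> lies in the half-plane. If that argument equals
  \<theta>, then \<open>triangle\<close> places \<open>f z\<close> beyond the tip.\<close>

lemma f_maps_into: "f ` uhp \<subseteq> slit.\<Omega>"
proof
  fix w assume "w \<in> f ` uhp"
  then obtain z where z: "z \<in> uhp" "w = f z"
    by blast
  define A B where "A = Im (Ln (z - of_real x))" and "B = Im (Ln (z - of_real y))"
  define r \<phi> where "r = cmod (f z - of_real b)" and "\<phi> = p * A + (1 - p) * B"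
  have ne: "z - of_real v \<noteq> 0" for v
    using z by (auto simp: uhp_def)
  have f: "f z - of_real b = exp (of_real p * Ln (z - of_real x) + of_real (1 - p) * Ln (z - of_real y))"
    using ne by (simp only: f_def b_def powr_def exp_add) simp
  then have "f z - of_real b = of_real r * cis \<phi>"
    unfolding r_def f norm_exp_eq_Re by (subst exp_eq_polar) (simp add: A_def B_def \<phi>_def)
  then have fz: "f z = of_real b + of_real r * cis \<phi>"
    by (simp add: algebra_simps)
  have "0 < r"
    unfolding r_def f by simp
  have "0 < A" "A < pi" "0 < B" "B < pi"
    using Im_Ln_pos_lt_imp[of "z - of_real x"] Im_Ln_pos_lt_imp[of "z - of_real y"] z(1)
    by (auto simp: A_def B_def uhp_def)
  then have "0 < \<phi>" "\<phi> < p * pi + (1 - p) * pi"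
    unfolding \<phi>_def using p(1,2) by (auto intro!: add_pos_pos add_strict_mono)
  then have \<phi>: "0 < \<phi>" "\<phi> < pi"
    by (simp_all add: algebra_simps)
  have "f z \<in> uhp"
    using \<open>0 < r\<close> sin_gt_zero[OF \<phi>] by (simp add: fz uhp_def)
  moreover have "slit.offset (f z) \<noteq> 0" if "cmod (f z - of_real b) \<le> m"
  proof
    assume "slit.offset (f z) = 0"
    then have "r * cos \<phi> = r * cos \<theta>"
      by (simp add: slit.offset_def r_def[symmetric]) (simp add: fz)
    then have "cos \<phi> = cos \<theta>"
      using \<open>0 < r\<close> by simp
    then have "\<phi> = \<theta>"
      using \<phi> \<theta>(1,2) cos_inj_pi[of \<phi> \<theta>] by simp
    then have t: "- x < cmod (z - of_real x)" "y < cmod (z - of_real y)"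
      using triangle[OF z(1)] by (simp_all add: \<phi>_def A_def B_def)
    have "m < cmod (z - of_real x) powr p * cmod (z - of_real y) powr (1 - p)"
      unfolding m_def using t x_neg y_pos p(1,2)
      by (intro mult_strict_mono powr_less_mono2) auto
    then show False
      using that by (simp add: cmod_f)
  qed
  ultimately show "w \<in> slit.\<Omega>"
    using z(2) by (auto simp: slit.\<Omega>_altdef)
qed

lemma continuous_f: "continuous_on {z. 0 \<le> Im z} f"
  unfolding f_def using p(1,2) by (intro continuous_intros continuous_on_powr_halfplane) auto

lemma f_left: "u \<le> x \<Longrightarrow> f (of_real u) = of_real (b - (x - u) powr p * (y - u) powr (1 - p))"
proof (cases "u = x")
  case False
  assume "u \<le> x"
  then have u: "u < x" "u < y"
    using False x_neg y_pos by auto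
  have "exp (\<i> * of_real pi * of_real p) * exp (\<i> * of_real pi * of_real (1 - p)) = exp (\<i> * of_real pi)"
    unfolding exp_add[symmetric] by (simp add: algebra_simps)
  then have "exp (\<i> * of_real pi * of_real p) * exp (\<i> * of_real pi * of_real (1 - p)) = -1"
    by simp
  moreover have "f (of_real u) = of_real b + of_real ((x - u) powr p) * of_real ((y - u) powr (1 - p)) *
      (exp (\<i> * of_real pi * of_real p) * exp (\<i> * of_real pi * of_real (1 - p)))"
    unfolding f_def powr_of_neg[OF u(1)] powr_of_neg[OF u(2)] by (simp add: b_def)
  ultimately show ?thesis
    by simp
qed (use x_neg y_pos p(1,2) in \<open>simp add: f_def b_def\<close>)

lemma f_middle:
  assumes "u \<in> {x..y}"
  shows "f (of_real u) = of_real b + of_real ((u - x) powr p * (y - u) powr (1 - p)) * cis \<theta>"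
proof (cases "u = y")
  case False
  then have u: "x \<le> u" "u < y"
    using assms by auto
  show ?thesis
    unfolding f_def powr_of_neg[OF u(2)] powr_of_nonneg[OF u(1)]
    by (simp add: b_def \<theta>_def cis_conv_exp algebra_simps)
qed (use x_neg y_pos p(1,2) in \<open>simp add: f_def b_def\<close>)

lemma f_right: "y \<le> u \<Longrightarrow> f (of_real u) = of_real (b + (u - x) powr p * (u - y) powr (1 - p))"
  unfolding f_def using powr_of_nonneg[of x u p] powr_of_nonneg[of y u "1 - p"] x_neg y_pos
  by (simp add: b_def)

definition M :: "real \<Rightarrow> real" where "M u = (u - x) powr p * (y - u) powr (1 - p)"

text \<open>\<open>M\<close> is the radius of the boundary value at \<open>u\<close>. By the choice
  of \<open>p\<close> its logarithmic derivative has numerator \<open>- u\<close>, so the maximum is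
  at 0, the starting point of the driver.\<close>

lemma M_deriv:
  assumes "x < u" "u < y"
  shows "(M has_real_derivative (- u * (M u / ((u - x) * (y - u))))) (at u)"
proof -
  let ?D = "(u - x) powr p * ((1 - p) * (y - u) powr (1 - p - 1) * (- 1)) +
    (p * (u - x) powr (p - 1)) * (y - u) powr (1 - p)"
  have "(M has_real_derivative ?D) (at u)"
    unfolding M_def[abs_def] using assms
    by (auto intro!: derivative_eq_intros)
  moreover have "?D = M u * (p / (u - x) - (1 - p) / (y - u))"
  proof -
    have "(u - x) powr (p - 1) = (u - x) powr p / (u - x)"
      "(y - u) powr (1 - p - 1) = (y - u) powr (1 - p) / (y - u)"
      using powr_diff[of "u - x" p 1] powr_diff[of "y - u" "1 - p" 1] assms by simp_all
    moreover have "a * (q * (b / e) * (- 1)) + p * (a / d) * b = a * b * (p / d - q / e)"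
      for a b d e q :: real
      by (simp add: algebra_simps)
    ultimately show ?thesis
      unfolding M_def by (simp only:)
  qed
  moreover have "p / (u - x) - (1 - p) / (y - u) = - u / ((u - x) * (y - u))"
  proof -
    have "p * (y - u) - (1 - p) * (u - x) = - u"
      using pq(1) by (simp add: algebra_simps)
    then show ?thesis
      using assms by (simp add: diff_frac_eq)
  qed
  moreover have "M u * (- u / ((u - x) * (y - u))) = - u * (M u / ((u - x) * (y - u)))"
    by simp
  ultimately show ?thesis
    by (simp only:)
qed

lemma continuous_M: "continuous_on {x..y} M"
  unfolding M_def using p
  by (intro continuous_intros continuous_on_powr') auto

lemma M_pos: "x < u \<Longrightarrow> u < y \<Longrightarrow> 0 < M u"
  by (simp add: M_def)

lemma M_mono: "x \<le> u \<Longrightarrow> u < v \<Longrightarrow> v \<le> 0 \<Longrightarrow> M u < M v"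
proof (rule DERIV_pos_imp_increasing_open[where f = M])
  fix r assume *: "x \<le> u" "u < v" "v \<le> 0" "u < r" "r < v"
  then have "0 < - r * (M r / ((r - x) * (y - r)))"
    using y_pos M_pos[of r] by (intro mult_pos_pos divide_pos_pos) auto
  then show "\<exists>d. (M has_real_derivative d) (at r) \<and> 0 < d"
    using M_deriv[of r] * y_pos by (intro exI[of _ "- r * (M r / ((r - x) * (y - r)))"]) auto
qed (use y_pos in \<open>auto intro: continuous_on_subset[OF continuous_M]\<close>)

lemma M_antimono: "0 \<le> u \<Longrightarrow> u < v \<Longrightarrow> v \<le> y \<Longrightarrow> M v < M u"
proof (rule DERIV_neg_imp_decreasing_open[where f = M])
  fix r assume *: "0 \<le> u" "u < v" "v \<le> y" "u < r" "r < v"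
  then have "0 < r * (M r / ((r - x) * (y - r)))"
    using x_neg M_pos[of r] by (intro mult_pos_pos divide_pos_pos) auto
  then show "\<exists>d. (M has_real_derivative d) (at r) \<and> d < 0"
    using M_deriv[of r] * x_neg by (intro exI[of _ "- r * (M r / ((r - x) * (y - r)))"]) auto
qed (use x_neg in \<open>auto intro: continuous_on_subset[OF continuous_M]\<close>)

lemma M_bounds:
  assumes "u \<in> {x..y}"
  shows "0 \<le> M u" "M u \<le> m"
proof -
  show "0 \<le> M u"
    by (simp add: M_def)
  have "M 0 = m"
    by (simp add: M_def m_def)
  then show "M u \<le> m"
    using M_mono[of u 0] M_antimono[of 0 u] assms by (cases u "0::real" rule: linorder_cases) auto
qed

lemma cmod_f_middle: "u \<in> {x..y} \<Longrightarrow> cmod (f (of_real u) - of_real b) = M u"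
  using M_bounds(1)[of u] by (simp add: f_middle M_def norm_mult)

lemma f_on_slit:
  assumes "u \<in> {x..y}"
  shows "f (of_real u) \<in> insert (of_real b) (polar_slit b m (\<lambda>_. cos \<theta>))"
proof (cases "M u = 0")
  case True
  then show ?thesis
    using f_middle[OF assms] by (simp add: M_def)
next
  case False
  then have "0 < M u"
    using M_bounds(1)[OF assms] by simp
  then have "f (of_real u) \<in> polar_slit b m (\<lambda>_. cos \<theta>)"
    using f_middle[OF assms] cmod_f_middle[OF assms] M_bounds(2)[OF assms] \<theta>(3)
    by (simp add: polar_slit_def uhp_def M_def)
  then show ?thesis
    by simp
qed

lemma f_image: "f ` uhp = slit.\<Omega>"
proof (rule image_eq_of_proper[OF continuous_f _ _ f_maps_into])
  show "f holomorphic_on uhp"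
    unfolding f_def by (intro holomorphic_intros) (auto simp: uhp_def complex_nonpos_Reals_iff)
  \<comment> \<open>With a constant cosine every longer slit is admissible as well, as
    \<open>connected_\<Omega>\<close> requires.\<close>
  show "connected slit.\<Omega>"
    by (rule slit.connected_\<Omega>[of "m + 1"]) (use slit_domain[of "m + 1"] m_pos in auto)
  show "f (of_real u) \<notin> slit.\<Omega>" for u
  proof (cases "u \<in> {x..y}")
    case True
    then show ?thesis
      using f_on_slit[OF True] by (auto simp: slit.\<Omega>_def uhp_def)
  next
    case False
    then have "Im (f (of_real u)) = 0"
      using f_left[of u] f_right[of u] by auto
    then show ?thesis
      by (simp add: slit.\<Omega>_def uhp_def)
  qed
  show "bounded {z. 0 \<le> Im z \<and> cmod (f z) \<le> r}" for r
    unfolding bounded_iff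
  proof (intro exI ballI)
    fix z assume "z \<in> {z. 0 \<le> Im z \<and> cmod (f z) \<le> r}"
    then have "cmod (f z - of_real b) \<le> r + \<bar>b\<bar>"
      using norm_triangle_ineq4[of "f z" "of_real b"] by simp
    \<comment> \<open>The distances from \<open>z\<close> to \<open>x\<close> and to
      \<open>y\<close> are at least \<open>q\<close>, hence so is their weighted geometric mean,
      which is \<open>|f z - b|\<close>.\<close>
    define q where "q = cmod z - \<bar>x\<bar> - \<bar>y\<bar>"
    show "cmod z \<le> \<bar>r\<bar> + \<bar>b\<bar> + \<bar>x\<bar> + \<bar>y\<bar>"
    proof (cases "0 < q")
      case True
      have "q \<le> cmod (z - of_real x)" "q \<le> cmod (z - of_real y)"
        using norm_triangle_ineq2[of z "of_real x"] norm_triangle_ineq2[of z "of_real y"]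
        by (simp_all add: q_def)
      then have "q powr p * q powr (1 - p) \<le> cmod (f z - of_real b)"
        unfolding cmod_f using True p(1,2) by (intro mult_mono powr_mono2) auto
      then have "q \<le> r + \<bar>b\<bar>"
        using \<open>cmod (f z - of_real b) \<le> r + \<bar>b\<bar>\<close> True by (simp add: powr_add[symmetric])
      then show ?thesis
        by (simp add: q_def)
    qed (simp add: q_def)
  qed
qed

lemma polar_slit_segment: "segment_at_angle (polar_slit b m (\<lambda>_. cos \<theta>)) b \<theta>"
proof -
  define q where "q = of_real b + of_real m * cis \<theta>"
  have "q \<in> uhp"
    using m_pos \<theta>(3) by (simp add: q_def uhp_def)
  moreover have "Arg (q - of_real b) = \<theta>"
    using m_pos \<theta> by (intro Arg_unique[of m]) (auto simp: q_def cis_conv_exp)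
  moreover have "polar_slit b m (\<lambda>_. cos \<theta>) = closed_segment (of_real b) q - {of_real b}"
  proof (intro subset_antisym subsetI)
    fix z assume z: "z \<in> polar_slit b m (\<lambda>_. cos \<theta>)"
    define s where "s = cmod (z - of_real b)"
    have "0 < Im z"
      using z by (simp add: polar_slit_def uhp_def)
    then have "0 < s"
      by (auto simp: s_def)
    then have "s \<le> m" "Re (z - of_real b) / s = cos \<theta>"
      using z by (auto simp: polar_slit_def s_def)
    then have "z = polar_pt b s (cos \<theta>)"
      using eq_polar_pt[of z b] \<open>0 < Im z\<close> \<open>0 < s\<close> by (auto simp: s_def)
    also have "\<dots> = of_real b + of_real s * cis \<theta>"
      using \<theta>(3) by (simp add: polar_pt_def sin_squared_eq[symmetric] complex_eq_iff)
    also have "\<dots> = (1 - of_real (s / m)) * of_real b + of_real (s / m) * q"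
      using m_pos by (simp add: q_def field_simps)
    finally have "z = (1 - s / m) *\<^sub>R of_real b + (s / m) *\<^sub>R q"
      by (simp add: scaleR_conv_of_real)
    then show "z \<in> closed_segment (of_real b) q - {of_real b}"
      unfolding Diff_iff in_segment using \<open>0 < s\<close> \<open>s \<le> m\<close> m_pos
      by (intro conjI exI[of _ "s / m"]) (auto simp: s_def)
  next
    fix z assume "z \<in> closed_segment (of_real b) q - {of_real b}"
    then obtain u where u: "0 \<le> u" "u \<le> 1" "z = (1 - u) *\<^sub>R of_real b + u *\<^sub>R q" "z \<noteq> of_real b"
      by (auto simp: in_segment)
    then have "z = of_real b + of_real (u * m) * cis \<theta>"
      by (simp add: q_def scaleR_conv_of_real algebra_simps)
    moreover have "0 < u"
      using u by (cases "u = 0") (auto simp: scaleR_conv_of_real)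
    ultimately show "z \<in> polar_slit b m (\<lambda>_. cos \<theta>)"
      using u(2) m_pos \<theta>(3) by (simp add: polar_slit_def uhp_def norm_mult)
  qed
  ultimately show ?thesis
    unfolding segment_at_angle_def by blast
qed

lemma hitting:
  "\<exists>T. force_points_end_at_base \<tau> T \<xi> V1 V2 h \<and>
    segment_at_angle (loewner_hull \<tau> h T) (upto_time \<tau> \<xi> T) (pi * y / (y - x))"
proof -
  have xy: "x \<in> {x..y}" "y \<in> {x..y}" "0 \<in> {x..y}"
    using x_neg y_pos by auto
  have "inj_on M {x..0}" "inj_on M {0..y}"
    by (rule linorder_inj_onI'; use M_mono M_antimono in force)+
  then have inj: "inj_on (\<lambda>u. cmod (f (of_real u) - of_real b)) {x..0}"
    "inj_on (\<lambda>u. cmod (f (of_real u) - of_real b)) {0..y}"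
    using x_neg y_pos
    by (auto intro!: inj_on_cong[THEN iffD2, of _ _ M] simp: cmod_f_middle)
  have ends: "f (of_real x) = of_real b" "f (of_real y) = of_real b" "cmod (f 0 - of_real b) = m"
    using f_middle[OF xy(1)] f_middle[OF xy(2)] cmod_f_middle[OF xy(3)] p(1,2)
    by (simp_all add: M_def m_def)
  have left: "\<exists>u. \<bar>u - x\<bar> < \<delta> \<and> Im (f (of_real u)) = 0 \<and> Re (f (of_real u)) < b" if "0 < \<delta>" for \<delta>
    using that f_left[of "x - \<delta> / 2"] x_neg y_pos by (intro exI[of _ "x - \<delta> / 2"]) simp
  have right: "\<exists>u. \<bar>u - y\<bar> < \<delta> \<and> Im (f (of_real u)) = 0 \<and> b < Re (f (of_real u))" if "0 < \<delta>" for \<delta>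
    using that f_right[of "y + \<delta> / 2"] x_neg y_pos by (intro exI[of _ "y + \<delta> / 2"]) simp
  have "upto_time \<tau> \<xi> T = b"
    using limit_at_hitting(1)[OF \<tau>_eq gaps_tendsto] by (simp add: b_def)
  moreover have \<xi>: "(\<xi> \<longlongrightarrow> b) (at_left T)"
    using gaps_tendsto(3) by (simp only: b_def)
  have image: "f ` uhp = uhp - polar_slit b m (\<lambda>_. cos \<theta>)"
    using f_image by (simp only: slit.\<Omega>_def)
  note force_points_end_at_baseI[OF slit_domain[OF m_pos] \<tau>_eq T_pos gaps_tendsto(1,2) \<xi>
      continuous_f loewner_map_eq image f_on_slit inj ends left right]
  moreover have "\<theta> = pi * y / (y - x)"
    unfolding \<theta>_def p(3) by simp
  ultimately show ?thesis
    using polar_slit_segment by metis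
qed

end

section \<open>Circular arcs orthogonal to the real line\<close>

text \<open>With the two lemmas that follow: squaring is a bijection from the half-plane onto the
  plane without the nonnegative real axis.\<close>

lemma square_in_uhp_neq:
  assumes "0 < Im v" "0 \<le> r"
  shows "v\<^sup>2 \<noteq> complex_of_real r"
proof
  assume eq: "v\<^sup>2 = complex_of_real r"
  have "Re v * Im v = 0"
    using arg_cong[OF eq, of Im] by (auto simp: power2_eq_square)
  then have "Re v = 0"
    using assms by simp
  then have "- (Im v)\<^sup>2 = r"
    using arg_cong[OF eq, of Re] unfolding power2_eq_square by (simp add: power2_eq_square)
  then show False
    using assms by (smt (verit) zero_less_power2)
qed

lemma square_root_in_uhp:
  assumes "\<And>r. 0 \<le> r \<Longrightarrow> q \<noteq> complex_of_real r"
  shows "\<exists>v. 0 < Im v \<and> v\<^sup>2 = q"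
proof -
  define w where "w = csqrt q"
  have "Im w \<noteq> 0"
  proof
    assume "Im (w) = 0"
    then have "w = of_real (Re (w))"
      by (simp add: complex_eq_iff)
    then have "q = of_real ((Re (w))\<^sup>2)"
      by (metis of_real_power power2_csqrt w_def)
    then show False
      using assms zero_le_power2 by blast
  qed
  then have "0 < Im (w) \<or> 0 < Im (- w)"
    by auto
  then show ?thesis
    by (metis power2_csqrt power2_minus w_def)
qed

lemma square_inj_uhp:
  assumes "0 < Im v" "0 < Im w" "v\<^sup>2 = w\<^sup>2"
  shows "v = w"
  using assms by (auto simp: power2_eq_iff)

definition mob :: "real \<Rightarrow> real \<Rightarrow> complex \<Rightarrow> complex" where
  "mob k \<nu> z = z / (of_real k * z + of_real \<nu>)"

text \<open>The inverse of \<open>mob k \<nu>\<close> at \<open>\<i> * s\<close>. As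
  \<open>s\<close> grows from 0 it runs along a circle through 0 orthogonal to the real line, or
  along a vertical line if \<open>k = 0\<close>.\<close>

definition arc_pt :: "real \<Rightarrow> real \<Rightarrow> real \<Rightarrow> complex" where
  "arc_pt k \<nu> s = of_real \<nu> * (\<i> * of_real s) / (1 - of_real k * (\<i> * of_real s))"

definition circ_arc :: "real \<Rightarrow> real \<Rightarrow> real \<Rightarrow> real \<Rightarrow> complex set" where
  "circ_arc b k \<nu> m = {of_real b + arc_pt k \<nu> s | s. 0 < s \<and> s \<le> m}"

lemma mob_denom:
  assumes "0 < \<nu>" "0 < Im z"
  shows "of_real k * z + of_real \<nu> \<noteq> 0"
proof
  assume eq: "of_real k * z + of_real \<nu> = 0"
  have "k * Im z = 0"
    using arg_cong[OF eq, of Im] by simp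
  then have "k = 0"
    using assms by simp
  then show False
    using eq assms by simp
qed

lemma Im_mob:
  assumes "0 < \<nu>" "0 < Im z"
  shows "0 < Im (mob k \<nu> z)"
proof -
  have "Im (mob k \<nu> z) = \<nu> * Im z / (cmod (of_real k * z + of_real \<nu>))\<^sup>2"
    unfolding mob_def Im_divide cmod_power2[symmetric] by (simp add: algebra_simps)
  then show ?thesis
    using assms mob_denom[OF assms, of k] by simp
qed

lemma mob_inverse:
  assumes "0 < \<nu>" "0 < Im z"
  shows "z = of_real \<nu> * mob k \<nu> z / (1 - of_real k * mob k \<nu> z)"
proof -
  have "1 - of_real k * mob k \<nu> z = of_real \<nu> / (of_real k * z + of_real \<nu>)"
    using mob_denom[OF assms, of k] by (simp add: mob_def field_simps)
  then show ?thesis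
    using mob_denom[OF assms, of k] assms by (simp add: mob_def)
qed

lemma mob_surj:
  fixes k :: real
  assumes "0 < \<nu>" "0 < Im v"
  defines "z \<equiv> of_real \<nu> * v / (1 - of_real k * v)"
  shows "0 < Im z" "mob k \<nu> z = v"
proof -
  have ne: "1 - of_real k * v \<noteq> 0"
  proof
    assume eq: "1 - of_real k * v = 0"
    have "k * Im v = 0"
      using arg_cong[OF eq, of Im] by simp
    then have "k = 0"
      using assms by simp
    then show False
      using eq by simp
  qed
  have "Im z = \<nu> * Im v / (cmod (1 - of_real k * v))\<^sup>2"
    unfolding z_def Im_divide cmod_power2[symmetric] by (simp add: algebra_simps)
  then show "0 < Im z"
    using assms(1,2) ne by simp
  have "of_real k * z + of_real \<nu> = of_real \<nu> / (1 - of_real k * v)"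
    using ne by (simp add: z_def field_simps)
  then show "mob k \<nu> z = v"
    using ne assms(1) by (simp add: mob_def z_def)
qed

lemma mob_inj:
  assumes "0 < \<nu>" "0 < Im z" "0 < Im w" "mob k \<nu> z = mob k \<nu> w"
  shows "z = w"
  using mob_inverse[OF assms(1,2), of k] mob_inverse[OF assms(1,3), of k] assms(4) by simp

lemma mob_eq_imaginary:
  assumes "0 < \<nu>" "0 < Im z" "mob k \<nu> z = \<i> * of_real s"
  shows "z = arc_pt k \<nu> s" "0 < s"
  using mob_inverse[OF assms(1,2), of k] Im_mob[OF assms(1,2), of k] assms(3) by (simp_all add: arc_pt_def)

lemma mob_arc_pt:
  assumes "0 < \<nu>" "0 < s"
  shows "mob k \<nu> (arc_pt k \<nu> s) = \<i> * of_real s" "0 < Im (arc_pt k \<nu> s)"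
  using mob_surj[of \<nu> "\<i> * of_real s" k] assms by (simp_all add: arc_pt_def)

lemma arc_pt_altdef:
  "arc_pt k \<nu> s = of_real (\<nu> * s / (1 + k\<^sup>2 * s\<^sup>2)) * Complex (- (k * s)) 1"
proof -
  have pos: "0 < 1 + k\<^sup>2 * s\<^sup>2"
    by (intro add_pos_nonneg) auto
  define d where "d = 1 - of_real k * (\<i> * complex_of_real s)"
  define e where "e = 1 + of_real k * (\<i> * complex_of_real s)"
  have "d * e = complex_of_real (1 + k\<^sup>2 * s\<^sup>2)"
    by (simp add: d_def e_def algebra_simps power2_eq_square)
  moreover have "e \<noteq> 0"
    by (simp add: e_def complex_eq_iff)
  moreover have "arc_pt k \<nu> s = of_real \<nu> * (\<i> * of_real s) / d"
    by (simp add: arc_pt_def d_def)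
  ultimately have "arc_pt k \<nu> s = of_real \<nu> * (\<i> * of_real s) * e / complex_of_real (1 + k\<^sup>2 * s\<^sup>2)"
    by (metis mult_divide_mult_cancel_right)
  also have "\<dots> = of_real (\<nu> * s / (1 + k\<^sup>2 * s\<^sup>2)) * (\<i> * e)"
    by simp
  also have "\<i> * e = Complex (- (k * s)) 1"
    by (simp add: e_def complex_eq_iff)
  finally show ?thesis .
qed

lemma cmod_arc_pt_squared: "(cmod (arc_pt k \<nu> s))\<^sup>2 = \<nu>\<^sup>2 * (s\<^sup>2 / (1 + k\<^sup>2 * s\<^sup>2))"
proof -
  have pos: "0 < 1 + k\<^sup>2 * s\<^sup>2"
    by (intro add_pos_nonneg) auto
  have "(cmod (Complex (- (k * s)) 1))\<^sup>2 = 1 + k\<^sup>2 * s\<^sup>2"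
    by (simp add: cmod_power2 power_mult_distrib)
  then have "(cmod (arc_pt k \<nu> s))\<^sup>2 = (\<nu> * s / (1 + k\<^sup>2 * s\<^sup>2))\<^sup>2 * (1 + k\<^sup>2 * s\<^sup>2)"
    unfolding arc_pt_altdef norm_mult norm_of_real power_mult_distrib power2_abs by (simp only:)
  then show ?thesis
    using pos by (simp add: power_mult_distrib power_divide power2_eq_square[of "1 + k\<^sup>2 * s\<^sup>2"])
qed

text \<open>This monotonicity makes the arc a polar graph around its root. It rests on
  \<open>s^2 / (1 + k^2 * s^2)\<close> being increasing.\<close>

lemma cmod_arc_pt_strict_mono:
  assumes "0 < \<nu>" "0 \<le> s" "s < s'"
  shows "cmod (arc_pt k \<nu> s) < cmod (arc_pt k \<nu> s')"
proof -
  have pos: "0 < 1 + k\<^sup>2 * r\<^sup>2" for r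
    by (intro add_pos_nonneg) auto
  have "s\<^sup>2 < s'\<^sup>2"
    using assms by (simp add: power_strict_mono)
  then have "s\<^sup>2 / (1 + k\<^sup>2 * s\<^sup>2) < s'\<^sup>2 / (1 + k\<^sup>2 * s'\<^sup>2)"
    using pos[of s] pos[of s'] by (simp add: divide_simps) (simp add: algebra_simps)
  then have "(cmod (arc_pt k \<nu> s))\<^sup>2 < (cmod (arc_pt k \<nu> s'))\<^sup>2"
    unfolding cmod_arc_pt_squared using assms(1) by (intro mult_strict_left_mono) auto
  then show ?thesis
    by (rule power_less_imp_less_base) simp
qed

text \<open>
  In the coordinate \<open>mob\<close>, the map \<open>F\<close> is \<open>v \<mapsto> sqrt (\<mu> * v\<^sup>2 - m\<^sup>2)\<close>, whose image is
  the half-plane without the vertical segment of length \<open>m\<close>.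
\<close>

lemma image_eq_arc_complement:
  fixes F :: "complex \<Rightarrow> complex"
  assumes l: "l < l0" "k\<^sup>2 * l0 < 1" "k\<^sup>2 * l < 1"
    and F: "\<And>z. z \<in> uhp \<Longrightarrow> 0 < Im (F z - of_real b)"
      "\<And>z. z \<in> uhp \<Longrightarrow> (mob k ((1 - k\<^sup>2 * l) / 2) (F z - of_real b))\<^sup>2 =
        of_real l + of_real (1 - k\<^sup>2 * l) *
          ((mob k ((1 - k\<^sup>2 * l0) / 2) z)\<^sup>2 - of_real l0) / of_real (1 - k\<^sup>2 * l0)"
  shows "F ` uhp = uhp - circ_arc b k ((1 - k\<^sup>2 * l) / 2) (sqrt ((l0 - l) / (1 - k\<^sup>2 * l0)))"
proof -
  define \<nu> \<nu>0 \<mu> m where "\<nu> = (1 - k\<^sup>2 * l) / 2" and "\<nu>0 = (1 - k\<^sup>2 * l0) / 2"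
    and "\<mu> = (1 - k\<^sup>2 * l) / (1 - k\<^sup>2 * l0)" and "m = sqrt ((l0 - l) / (1 - k\<^sup>2 * l0))"
  have pos: "0 < \<nu>" "0 < \<nu>0" "0 < \<mu>"
    using l by (auto simp: \<nu>_def \<nu>0_def \<mu>_def)
  have m: "0 < m" "m\<^sup>2 = (l0 - l) / (1 - k\<^sup>2 * l0)"
    using l by (auto simp: m_def)
  \<comment> \<open>Minus the constant term of the affine relation between the squared coordinates,
    so that \<open>sq\<close> can take the form \<mu> times the square minus
    \<open>m^2\<close>.\<close>
  have m2: "m\<^sup>2 = \<mu> * l0 - l"
    using l unfolding m(2) \<mu>_def by (simp add: field_simps)
  have sq: "(mob k \<nu> (F z - of_real b))\<^sup>2 = of_real \<mu> * (mob k \<nu>0 z)\<^sup>2 - of_real (m\<^sup>2)" if "z \<in> uhp" for z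
  proof -
    define a a0 where "a = 1 - k\<^sup>2 * l" and "a0 = 1 - k\<^sup>2 * l0"
    have "(mob k \<nu> (F z - of_real b))\<^sup>2 = of_real l + of_real a * ((mob k \<nu>0 z)\<^sup>2 - of_real l0) / of_real a0"
      using F(2)[OF that] by (simp only: \<nu>_def \<nu>0_def a_def a0_def)
    moreover have "\<mu> = a / a0"
      by (simp add: \<mu>_def a_def a0_def)
    ultimately show ?thesis
      unfolding m2 by (simp add: right_diff_distrib diff_divide_distrib)
  qed
  have "F ` uhp = uhp - circ_arc b k \<nu> m"
  proof (intro subset_antisym subsetI)
    fix w assume "w \<in> F ` uhp"
    then obtain z where z: "z \<in> uhp" "w = F z"
      by blast
    have "w \<notin> circ_arc b k \<nu> m"
    proof
      assume "w \<in> circ_arc b k \<nu> m"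
      then obtain s where s: "0 < s" "s \<le> m" "w = of_real b + arc_pt k \<nu> s"
        unfolding circ_arc_def by blast
      then have "mob k \<nu> (F z - of_real b) = \<i> * of_real s"
        using mob_arc_pt(1)[OF pos(1) s(1)] z(2) by simp
      then have "of_real \<mu> * (mob k \<nu>0 z)\<^sup>2 = of_real (m\<^sup>2 - s\<^sup>2)"
        using sq[OF z(1)] by (simp add: power_mult_distrib algebra_simps)
      then have "(mob k \<nu>0 z)\<^sup>2 = of_real ((m\<^sup>2 - s\<^sup>2) / \<mu>)"
        using pos(3) by (simp add: field_simps)
      moreover have "0 \<le> (m\<^sup>2 - s\<^sup>2) / \<mu>"
        using s pos(3) by (simp add: power_mono)
      ultimately show False
        using square_in_uhp_neq[OF Im_mob[OF pos(2), of z k]] z(1) unfolding uhp_def by blast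
    qed
    then show "w \<in> uhp - circ_arc b k \<nu> m"
      using F(1)[OF z(1)] z(2) by (simp add: uhp_def)
  next
    fix w assume w: "w \<in> uhp - circ_arc b k \<nu> m"
    define P where "P = mob k \<nu> (w - of_real b)"
    have Im: "0 < Im (w - of_real b)"
      using w by (simp add: uhp_def)
    then have "0 < Im P"
      unfolding P_def by (rule Im_mob[OF pos(1)])
    \<comment> \<open>A nonnegative real \<open>r\<close> is the only obstruction to a square root
      in the half-plane. It would make \<open>P^2\<close> real, so \<open>P\<close> would be
      imaginary of height at most \<open>m\<close>, and \<open>w\<close> would lie on the
      arc.\<close>
    have "(P\<^sup>2 + of_real (m\<^sup>2)) / of_real \<mu> \<noteq> of_real r" if "0 \<le> r" for r
    proof
      assume "(P\<^sup>2 + of_real (m\<^sup>2)) / of_real \<mu> = of_real r"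
      then have eq: "P\<^sup>2 = of_real (\<mu> * r - m\<^sup>2)"
        using pos(3) by (simp add: field_simps)
      have "Re P * Im P = 0"
        using arg_cong[OF eq, of Im] by (auto simp: power2_eq_square)
      then have "Re P = 0"
        using \<open>0 < Im P\<close> by simp
      then have P: "P = \<i> * of_real (Im P)"
        by (simp add: complex_eq_iff)
      have "(Im P)\<^sup>2 = m\<^sup>2 - \<mu> * r"
        using arg_cong[OF eq, of Re] \<open>Re P = 0\<close> by (simp add: power2_eq_square)
      also have "\<dots> \<le> m\<^sup>2"
        using pos(3) that by simp
      finally have "(Im P)\<^sup>2 \<le> m\<^sup>2" .
      then have "Im P \<le> m"
        by (rule power2_le_imp_le) (use m(1) in simp)
      moreover have "w - of_real b = arc_pt k \<nu> (Im P)"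
        using mob_eq_imaginary(1)[OF pos(1) Im] P unfolding P_def by blast
      then have "w = of_real b + arc_pt k \<nu> (Im P)"
        by (simp add: algebra_simps)
      ultimately show False
        using w \<open>0 < Im P\<close> unfolding circ_arc_def by blast
    qed
    then obtain v where v: "0 < Im v" "v\<^sup>2 = (P\<^sup>2 + of_real (m\<^sup>2)) / of_real \<mu>"
      using square_root_in_uhp by blast
    define z where "z = of_real \<nu>0 * v / (1 - of_real k * v)"
    have z: "z \<in> uhp" "mob k \<nu>0 z = v"
      using mob_surj[OF pos(2) v(1), of k] by (auto simp: z_def uhp_def)
    have "(mob k \<nu> (F z - of_real b))\<^sup>2 = P\<^sup>2"
      using sq[OF z(1)] pos(3) unfolding z(2) v(2) by simp
    then have "mob k \<nu> (F z - of_real b) = mob k \<nu> (w - of_real b)"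
      using square_inj_uhp[OF Im_mob[OF pos(1) F(1)[OF z(1)]] \<open>0 < Im P\<close>] by (simp add: P_def)
    then have "F z - of_real b = w - of_real b"
      by (rule mob_inj[OF pos(1) F(1)[OF z(1)] Im])
    then show "w \<in> F ` uhp"
      using z(1) by force
  qed
  then show ?thesis
    by (simp add: \<nu>_def m_def)
qed

text \<open>The arc lies on the curve \<open>Re Z = - (k / \<nu>) * |Z|^2\<close>, for nonzero
  \<open>k\<close> the circle through 0 with centre \<open>- \<nu> / (2 * k)\<close>. Dividing by
  \<open>|Z|\<close> gives the cosine. Conversely this equation makes the real part of
  \<open>mob k \<nu> Z\<close> vanish.\<close>

lemma circ_arc_eq_polar_slit:
  assumes "0 < \<nu>" "0 < m"
  shows "circ_arc b k \<nu> m = polar_slit b (cmod (arc_pt k \<nu> m)) (\<lambda>r. - (k / \<nu>) * r)"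
proof (intro subset_antisym subsetI)
  fix z assume "z \<in> circ_arc b k \<nu> m"
  then obtain s where s: "0 < s" "s \<le> m" "z = of_real b + arc_pt k \<nu> s"
    by (auto simp: circ_arc_def)
  have "cmod (arc_pt k \<nu> s) \<le> cmod (arc_pt k \<nu> m)"
    using cmod_arc_pt_strict_mono[OF assms(1), of s m k] s by (cases "s = m") auto
  moreover have "Re (arc_pt k \<nu> s) = - (k / \<nu>) * (cmod (arc_pt k \<nu> s))\<^sup>2"
    unfolding cmod_arc_pt_squared using assms(1) by (simp add: arc_pt_altdef power2_eq_square)
  moreover have "0 < Im (arc_pt k \<nu> s)"
    by (rule mob_arc_pt(2)[OF assms(1) s(1)])
  ultimately show "z \<in> polar_slit b (cmod (arc_pt k \<nu> m)) (\<lambda>r. - (k / \<nu>) * r)"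
    using s(3) by (simp add: polar_slit_def uhp_def power2_eq_square mult.commute mult.left_commute)
next
  fix z assume z: "z \<in> polar_slit b (cmod (arc_pt k \<nu> m)) (\<lambda>r. - (k / \<nu>) * r)"
  define Z where "Z = z - of_real b"
  have Z: "0 < Im Z" "cmod Z \<le> cmod (arc_pt k \<nu> m)" "Re Z = - (k / \<nu>) * (cmod Z)\<^sup>2"
    using z by (auto simp: polar_slit_def uhp_def Z_def power2_eq_square)
  have "Re (mob k \<nu> Z) = (k * (cmod Z)\<^sup>2 + \<nu> * Re Z) / (cmod (of_real k * Z + of_real \<nu>))\<^sup>2"
    unfolding mob_def Re_divide cmod_power2 by (simp add: power2_eq_square algebra_simps)
  also have "\<dots> = 0"
    using assms(1) unfolding Z(3) by simp
  finally have "mob k \<nu> Z = \<i> * of_real (Im (mob k \<nu> Z))"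
    by (simp add: complex_eq_iff)
  then have s: "Z = arc_pt k \<nu> (Im (mob k \<nu> Z))" "0 < Im (mob k \<nu> Z)"
    using mob_eq_imaginary[OF assms(1) Z(1)] by blast+
  have "Im (mob k \<nu> Z) \<le> m"
  proof (rule ccontr)
    assume "\<not> Im (mob k \<nu> Z) \<le> m"
    then have "cmod (arc_pt k \<nu> m) < cmod (arc_pt k \<nu> (Im (mob k \<nu> Z)))"
      using assms by (intro cmod_arc_pt_strict_mono) auto
    then show False
      using Z(2) s(1) by simp
  qed
  then show "z \<in> circ_arc b k \<nu> m"
    unfolding circ_arc_def using s by (auto simp: Z_def algebra_simps intro!: exI[of _ "Im (mob k \<nu> Z)"])
qed

text \<open>At the tip the squared cosine is \<open>k^2 * m^2 / (1 + k^2 * m^2)\<close>, so an arc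
  with finite \<open>m\<close> stops before the circle returns to the real line.\<close>

lemma circ_arc_slit_domain:
  assumes "0 < \<nu>" "0 < m"
  shows "polar_slit_domain (cmod (arc_pt k \<nu> m)) (\<lambda>r. - (k / \<nu>) * r)"
proof
  show "0 < cmod (arc_pt k \<nu> m)"
    using mob_arc_pt(2)[OF assms, of k] by auto
  show "continuous_on UNIV (\<lambda>r. - (k / \<nu>) * r)"
    by (intro continuous_intros)
  fix r :: real assume r: "0 \<le> r" "r \<le> cmod (arc_pt k \<nu> m)"
  have pos: "0 < 1 + k\<^sup>2 * m\<^sup>2"
    by (intro add_pos_nonneg) auto
  have "(- (k / \<nu>) * r)\<^sup>2 \<le> (k / \<nu>)\<^sup>2 * (cmod (arc_pt k \<nu> m))\<^sup>2"
    using r by (simp only: power_mult_distrib power2_minus) (intro mult_left_mono power_mono; simp)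
  also have "\<dots> = k\<^sup>2 * m\<^sup>2 / (1 + k\<^sup>2 * m\<^sup>2)"
    unfolding cmod_arc_pt_squared using assms(1) by (simp add: power_divide)
  also have "\<dots> < 1"
    using pos by simp
  finally show "\<bar>- (k / \<nu>) * r\<bar> < 1"
    by (simp only: abs_square_less_1)
qed

text \<open>The quotient of \<open>1 + \<i> * k * s\<close> by its conjugate is the exponential of
  \<open>2 * \<i> * arctan (k * s)\<close>. This exhibits the centre, the radius and the
  angle.\<close>

lemma arc_pt_trig:
  assumes "k \<noteq> 0"
  shows "arc_pt k \<nu> s = of_real (\<nu> / (2 * k)) * (exp (\<i> * of_real (2 * arctan (k * s))) - 1)"
proof -
  have pos: "0 < 1 + (k * s)\<^sup>2"
    by (intro add_pos_nonneg) auto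
  have "exp (\<i> * of_real (2 * arctan (k * s))) = (cis (arctan (k * s)))\<^sup>2"
    by (simp add: cis_conv_exp exp_of_nat_mult[symmetric] exp_double[symmetric] mult.left_commute)
  also have "cis (arctan (k * s)) = Complex 1 (k * s) / of_real (sqrt (1 + (k * s)\<^sup>2))"
    by (simp add: complex_eq_iff cos_arctan sin_arctan)
  finally have "exp (\<i> * of_real (2 * arctan (k * s))) = (Complex 1 (k * s))\<^sup>2 / of_real (1 + (k * s)\<^sup>2)"
    using pos by (simp add: power_divide flip: of_real_power)
  then have "exp (\<i> * of_real (2 * arctan (k * s))) - 1 = ((Complex 1 (k * s))\<^sup>2 - of_real (1 + (k * s)\<^sup>2)) / of_real (1 + (k * s)\<^sup>2)"
    using pos by (simp add: diff_divide_distrib del: of_real_add)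
  also have "(Complex 1 (k * s))\<^sup>2 - of_real (1 + (k * s)\<^sup>2) = of_real (2 * k * s) * Complex (- (k * s)) 1"
    by (simp add: complex_eq_iff power2_eq_square algebra_simps)
  finally show ?thesis
    using assms pos by (simp add: arc_pt_altdef power_mult_distrib field_simps del: of_real_add)
qed

lemma circ_arc_orthogonal:
  assumes "k \<noteq> 0" "0 < \<nu>" "0 < m"
  shows "orthogonal_circular_arc (circ_arc b k \<nu> m) b"
proof -
  define a where "a = \<nu> / (2 * k)"
  \<comment> \<open>The radius must be positive although \<open>a\<close> has the sign of
    \<open>k\<close>. For negative \<open>k\<close> the centre is to the right of \<open>b\<close>,
    so the arc starts at angle pi and runs clockwise with negative \<open>\<psi>\<close>. Both
    starting angles give a vertical tangent.\<close>
  define \<phi> where "\<phi> = (if 0 < k then 0 else pi)"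
  define \<psi> where "\<psi> = 2 * arctan (k * m)"
  have turn: "of_real \<bar>a\<bar> * exp (\<i> * of_real (\<phi> + \<theta>)) = of_real a * exp (\<i> * of_real \<theta>)" for \<theta>
    using assms by (auto simp: a_def \<phi>_def distrib_left exp_add divide_neg_pos mult_neg_pos
        abs_if zero_less_divide_iff divide_less_0_iff)
  have pt: "of_real b + arc_pt k \<nu> s = of_real (b - a) + of_real \<bar>a\<bar> * exp (\<i> * of_real (\<phi> + 2 * arctan (k * s)))" for s
    unfolding turn arc_pt_trig[OF assms(1)] by (simp add: a_def algebra_simps)
  let ?\<gamma> = "part_circlepath (of_real (b - a)) \<bar>a\<bar> \<phi> (\<phi> + \<psi>)"
  have cont: "continuous_on (closed_segment 0 m) (\<lambda>s. \<phi> + 2 * arctan (k * s))"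
    by (intro continuous_intros)
  have "inj_on (\<lambda>s. \<phi> + 2 * arctan (k * s)) (closed_segment 0 m)"
    using assms(1) by (auto simp: inj_on_def arctan_eq_iff)
  then have seg: "(\<lambda>s. \<phi> + 2 * arctan (k * s)) ` {0..m} = closed_segment \<phi> (\<phi> + \<psi>)"
    using continuous_injective_image_segment_1[OF cont] assms(3)
    by (simp add: closed_segment_eq_real_ivl \<psi>_def)
  have "path_image ?\<gamma> =
      (\<lambda>s. of_real b + arc_pt k \<nu> s) ` {0..m}"
    unfolding path_image_part_circlepath' seg[symmetric] image_image pt cis_conv_exp ..
  also have "\<dots> = insert (of_real b) (circ_arc b k \<nu> m)"
  proof -
    have "{0..m} = insert 0 {0<..m}"
      using assms(3) by auto
    then show ?thesis
      by (auto simp: circ_arc_def arc_pt_def)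
  qed
  finally have "path_image ?\<gamma> = insert (of_real b) (circ_arc b k \<nu> m)" .
  moreover have "of_real b \<notin> circ_arc b k \<nu> m"
  proof
    assume "of_real b \<in> circ_arc b k \<nu> m"
    then obtain s where "0 < s" "arc_pt k \<nu> s = 0"
      by (auto simp: circ_arc_def)
    then show False
      using mob_arc_pt(2)[OF assms(2), of s k] by simp
  qed
  ultimately have image: "path_image ?\<gamma> - {of_real b} = circ_arc b k \<nu> m"
    by simp
  have "arctan (k * m) \<noteq> 0" "\<bar>arctan (k * m)\<bar> < pi"
    using assms arctan_bounded[of "k * m"] pi_gt_zero by (auto simp: abs_less_iff)
  then have "\<phi> \<noteq> \<phi> + \<psi>" "\<bar>\<phi> + \<psi> - \<phi>\<bar> < 2 * pi"
    by (auto simp: \<psi>_def)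
  moreover have "pathstart ?\<gamma> = of_real b"
    using pt[of 0] by (simp add: arc_pt_def)
  moreover have "orthogonal (vector_derivative ?\<gamma> (at 0)) 1"
    unfolding vector_derivative_part_circlepath
    by (simp add: orthogonal_def inner_complex_def linepath_def \<phi>_def exp_eq_polar)
  moreover have "0 < \<bar>a\<bar>"
    using assms by (simp add: a_def)
  ultimately show ?thesis
    unfolding orthogonal_circular_arc_def using image by metis
qed

lemma circ_arc_segment:
  assumes "0 < \<nu>" "0 < m"
  shows "segment_at_angle (circ_arc b 0 \<nu> m) b (pi / 2)"
proof -
  define q where "q = of_real b + \<i> * of_real (\<nu> * m)"
  have "q \<in> uhp"
    using assms by (simp add: q_def uhp_def)
  moreover have "Arg (q - of_real b) = pi / 2"
    using assms by (intro Arg_unique[of "\<nu> * m"]) (auto simp: q_def exp_eq_polar cis_conv_exp[symmetric])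
  moreover have "circ_arc b 0 \<nu> m = closed_segment (of_real b) q - {of_real b}"
  proof (intro subset_antisym subsetI)
    fix z assume "z \<in> circ_arc b 0 \<nu> m"
    then obtain s where s: "0 < s" "s \<le> m" "z = of_real b + of_real \<nu> * (\<i> * of_real s)"
      by (auto simp: circ_arc_def arc_pt_def)
    then have "z = (1 - s / m) *\<^sub>R of_real b + (s / m) *\<^sub>R q"
      using assms by (simp add: q_def complex_eq_iff field_simps)
    then show "z \<in> closed_segment (of_real b) q - {of_real b}"
      unfolding Diff_iff in_segment using s assms
      by (intro conjI exI[of _ "s / m"]) auto
  next
    fix z assume "z \<in> closed_segment (of_real b) q - {of_real b}"
    then obtain u where u: "0 \<le> u" "u \<le> 1" "z = (1 - u) *\<^sub>R of_real b + u *\<^sub>R q" "z \<noteq> of_real b"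
      by (auto simp: in_segment)
    then have "z = of_real b + of_real \<nu> * (\<i> * of_real (u * m))"
      by (simp add: q_def complex_eq_iff algebra_simps)
    moreover have "u \<noteq> 0"
      using u by (auto simp: complex_eq_iff)
    ultimately show "z \<in> circ_arc b 0 \<nu> m"
      using u(1,2) assms by (auto simp: circ_arc_def arc_pt_def intro!: exI[of _ "u * m"])
  qed
  ultimately show ?thesis
    unfolding segment_at_angle_def by blast
qed

section \<open>Weights -3\<close>

text \<open>\<open>f\<close> and the square of \<open>N\<close> satisfy the same linear equation;
  working with inverses avoids choosing logarithms.\<close>

lemma quotient_invariant:
  fixes f N g :: "real \<Rightarrow> complex"
  assumes "\<And>t. t \<in> lifetime \<tau> \<Longrightarrow> (f has_vector_derivative 2 * g t * f t) (at t within {0..})"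
    "\<And>t. t \<in> lifetime \<tau> \<Longrightarrow> (N has_vector_derivative g t * N t) (at t within {0..})"
    "\<And>t. t \<in> lifetime \<tau> \<Longrightarrow> N t \<noteq> 0" "t \<in> lifetime \<tau>"
  shows "f t / (N t)\<^sup>2 = f 0 / (N 0)\<^sup>2"
proof -
  have "((\<lambda>t. f t * (inverse (N t) * inverse (N t))) has_vector_derivative 0) (at t within {0..})"
    if t: "t \<in> lifetime \<tau>" for t
  proof -
    have "((\<lambda>t. inverse (N t)) has_vector_derivative (g t * N t) * - (inverse (N t) * inverse (N t))) (at t within {0..})"
      using field_vector_diff_chain_within[OF assms(2)[OF t], of inverse "- (inverse (N t) * inverse (N t))"]
        has_field_derivative_at_within[OF DERIV_inverse'[OF DERIV_ident assms(3)[OF t]]]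
      by (simp add: o_def)
    moreover have "(g t * N t) * - (inverse (N t) * inverse (N t)) = - g t * inverse (N t)"
      using assms(3)[OF t] by simp
    ultimately have inv: "((\<lambda>t. inverse (N t)) has_vector_derivative - g t * inverse (N t)) (at t within {0..})"
      by (simp only:)
    show ?thesis
      by (rule has_vector_derivative_eq_rhs[OF has_vector_derivative_mult[OF assms(1)[OF t]
              has_vector_derivative_mult[OF inv inv]]])
        (simp add: algebra_simps)
  qed
  from constant_on_lifetime[OF this assms(4)] show ?thesis
    by (simp add: divide_inverse power2_eq_square)
qed

text \<open>The two relations express the coefficients of \<open>(z + a) * (z - b)\<close> through
  \<open>k\<close> and \<open>l\<close>. The field is arbitrary because the identity is used along
  the flow over the complex numbers and on the boundary over the reals.\<close>

lemma mob_square_identity: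
  fixes k l a b z :: "'a :: field_char_0"
  assumes "4 * (a * b) = l * (1 - k\<^sup>2 * l)" "b - a = k * l"
  shows "(1 - k\<^sup>2 * l) * ((z + a) * (z - b)) = z\<^sup>2 - l * (k * z + (1 - k\<^sup>2 * l) / 2)\<^sup>2"
proof -
  have "z\<^sup>2 - l * (k * z + (1 - k\<^sup>2 * l) / 2)\<^sup>2 =
      (1 - k\<^sup>2 * l) * (z\<^sup>2 - (k * l) * z - l * (1 - k\<^sup>2 * l) / 4)"
    by (simp add: power2_eq_square field_simps)
  also have "\<dots> = (1 - k\<^sup>2 * l) * (z\<^sup>2 - (b - a) * z - a * b)"
    unfolding assms(1)[symmetric] assms(2) by simp
  also have "\<dots> = (1 - k\<^sup>2 * l) * ((z + a) * (z - b))"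
    by (simp add: power2_eq_square algebra_simps)
  finally show ?thesis ..
qed

locale rho3_flow = force_flow \<tau> \<xi> h "-3" x y V1 V2
  for \<tau> :: ereal and \<xi> :: "real \<Rightarrow> real" and h :: "real \<Rightarrow> complex \<Rightarrow> complex"
    and x y :: real and V1 V2 :: "real \<Rightarrow> real"
begin

section \<open>The gaps and the hitting time for weights -3\<close>

definition l0 :: real where "l0 = (y - x)\<^sup>2"

definition k :: real where "k = (x + y) / l0"

definition l :: "real \<Rightarrow> real" where "l t = (L t + R t)\<^sup>2"

text \<open>\<open>l - k^2 * l^2 / 2\<close> decreases at constant rate 16 and vanishes together
  with \<open>l\<close>; this is its initial value divided by 16.\<close>

definition T :: real where "T = (l0 - k\<^sup>2 * l0\<^sup>2 / 2) / 16"

lemma l0_pos: "0 < l0"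
  using x_neg y_pos by (simp add: l0_def)

lemma k_l0: "k * l0 = x + y"
  using l0_pos by (simp add: k_def)

lemma four_xy: "- 4 * x * y = l0 * (1 - k\<^sup>2 * l0)"
proof -
  have "l0 * (1 - k\<^sup>2 * l0) = l0 - (k * l0)\<^sup>2"
    by (simp add: power2_eq_square algebra_simps)
  then show ?thesis
    unfolding k_l0 by (simp add: l0_def power2_eq_square algebra_simps)
qed

lemma k2_l0: "k\<^sup>2 * l0 < 1"
proof -
  have "0 < - 4 * x * y"
    using x_neg y_pos by (simp add: mult_neg_pos)
  then have "0 < l0 * (1 - k\<^sup>2 * l0)"
    by (simp only: four_xy)
  then show ?thesis
    using l0_pos by (simp add: zero_less_mult_iff)
qed

lemma T_altdef: "16 * T = l0 * (1 - k\<^sup>2 * l0 / 2)"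
  by (simp add: T_def power2_eq_square field_simps)

lemma T_pos: "0 < T"
proof -
  note T_altdef
  moreover have "0 < l0 * (1 - k\<^sup>2 * l0 / 2)"
    using k2_l0 by (intro mult_pos_pos l0_pos) simp
  ultimately show ?thesis
    by simp
qed

lemma l_0: "l 0 = l0"
  by (simp add: l_def l0_def L_0 R_0)

lemma l_pos: "t \<in> lifetime \<tau> \<Longrightarrow> 0 < l t"
  using add_pos_pos[OF L_pos R_pos, of t t] by (simp add: l_def)

lemma l_deriv:
  assumes "t \<in> lifetime \<tau>"
  shows "(l has_real_derivative (- 4 * l t / (L t * R t))) (at t within {0..})"
  unfolding l_def[abs_def]
  by (rule derivative_eq_intros refl L_deriv R_deriv assms)+
    (use L_ne[OF assms] R_ne[OF assms] in \<open>simp add: field_simps power2_eq_square\<close>)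

text \<open>\<open>R - L\<close> and \<open>l\<close> satisfy the same linear equation with rate
  \<open>- 4 / (L * R)\<close>. The sum \<open>L + R\<close> decays at half that rate, whence the
  square in \<open>l\<close>.\<close>

lemma gap_difference:
  assumes "t \<in> lifetime \<tau>"
  shows "R t - L t = k * l t"
proof -
  have "((\<lambda>t. (R t - L t) / l t) has_real_derivative 0) (at t within {0..})" if t: "t \<in> lifetime \<tau>" for t
  proof -
    have "((\<lambda>t. R t - L t) has_real_derivative - 4 * (R t - L t) / (L t * R t)) (at t within {0..})"
      by (rule derivative_eq_intros refl L_deriv R_deriv t)+
        (use L_ne[OF t] R_ne[OF t] in \<open>simp add: field_simps\<close>)
    moreover
    have "- 4 * E / q * r - E * (- 4 * r / q) = 0" for E q r :: real
      by simp
    then have "(- 4 * (R t - L t) / (L t * R t) * l t - (R t - L t) * (- 4 * l t / (L t * R t))) / (l t * l t) = 0"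
      by (simp only: div_0)
    ultimately show ?thesis
      using l_pos[OF t] by (intro DERIV_cong[OF DERIV_divide[OF _ l_deriv[OF t]]]) auto
  qed
  from real_constant_on_lifetime[OF this assms] have "(R t - L t) / l t = k"
    by (simp add: l_0 L_0 R_0 k_def add.commute)
  then show ?thesis
    using l_pos[OF assms] by (simp add: field_simps)
qed

lemma gap_product:
  assumes "t \<in> lifetime \<tau>"
  shows "4 * (L t * R t) = l t * (1 - k\<^sup>2 * l t)"
proof -
  have "4 * (L t * R t) = l t - (R t - L t)\<^sup>2"
    by (simp add: l_def power2_eq_square algebra_simps)
  then show ?thesis
    unfolding gap_difference[OF assms] by (simp add: power2_eq_square algebra_simps)
qed

lemma k2_l:
  assumes "t \<in> lifetime \<tau>"
  shows "k\<^sup>2 * l t < 1"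
proof -
  have "0 < 4 * (L t * R t)"
    using L_pos[OF assms] R_pos[OF assms] by simp
  then have "0 < l t * (1 - k\<^sup>2 * l t)"
    by (simp only: gap_product[OF assms])
  then show ?thesis
    using l_pos[OF assms] by (simp add: zero_less_mult_iff)
qed

text \<open>By \<open>gap_product\<close> the equation for \<open>l\<close> separates into
  \<open>(1 - k^2 * l) * l' = - 16\<close>.\<close>

lemma l_time:
  assumes "t \<in> lifetime \<tau>"
  shows "l t - k\<^sup>2 * (l t)\<^sup>2 / 2 = 16 * (T - t)"
proof -
  have "((\<lambda>t. l t - k\<^sup>2 * (l t)\<^sup>2 / 2 + 16 * t) has_real_derivative 0) (at t within {0..})"
    if t: "t \<in> lifetime \<tau>" for t
  proof -
    have "((\<lambda>t. l t - k\<^sup>2 * (l t)\<^sup>2 / 2 + 16 * t) has_real_derivative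
        (1 - k\<^sup>2 * l t) * (- 4 * l t / (L t * R t)) + 16) (at t within {0..})"
      by (rule DERIV_cong[OF DERIV_add[OF DERIV_diff[OF l_deriv[OF t] DERIV_cdivide[OF DERIV_cmult[OF
                  DERIV_power[OF l_deriv[OF t]]]]] DERIV_cmult_Id]])
        (simp add: algebra_simps diff_divide_distrib)
    moreover have "(1 - k\<^sup>2 * l t) * (- 4 * l t / (L t * R t)) + 16 = 0"
    proof -
      have "(1 - k\<^sup>2 * l t) * (- 4 * l t / (L t * R t)) = - 4 * (l t * (1 - k\<^sup>2 * l t)) / (L t * R t)"
        by simp
      also have "\<dots> = - 16"
        unfolding gap_product[OF t, symmetric] using L_ne[OF t] R_ne[OF t] by simp
      finally show ?thesis
        by simp
    qed
    ultimately show ?thesis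
      by (simp only:)
  qed
  from real_constant_on_lifetime[OF this assms] show ?thesis
    by (simp add: l_0 T_def field_simps)
qed

lemma \<xi>_eq:
  assumes "t \<in> lifetime \<tau>"
  shows "\<xi> t = 3 / 4 * (x + y - k * l t)"
proof -
  have "((\<lambda>t. \<xi> t + 3 / 4 * (R t - L t)) has_real_derivative 0) (at t within {0..})" if "t \<in> lifetime \<tau>" for t
    by (rule derivative_eq_intros refl L_deriv R_deriv derivs that)+ (simp add: field_simps)
  from real_constant_on_lifetime[OF this assms] show ?thesis
    unfolding gap_difference[OF assms] by (simp add: L_0 R_0 \<xi>_0 algebra_simps)
qed

lemma l_bounds:
  assumes "t \<in> lifetime \<tau>"
  shows "16 * (T - t) \<le> l t" "l t \<le> 32 * (T - t)" "l t \<le> l0" "0 < t \<Longrightarrow> l t < l0"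
proof -
  have *: "l t * (1 - k\<^sup>2 * l t / 2) = 16 * (T - t)"
    using l_time[OF assms] by (simp add: power2_eq_square algebra_simps)
  have "l t * (1 - k\<^sup>2 * l t / 2) \<le> l t * 1" "l t * (1 / 2) \<le> l t * (1 - k\<^sup>2 * l t / 2)"
    using l_pos[OF assms] k2_l[OF assms] by (intro mult_left_mono; simp)+
  then show "16 * (T - t) \<le> l t" "l t \<le> 32 * (T - t)"
    unfolding * by simp_all
  \<comment> \<open>This is the difference of the law in \<open>l_time\<close> between times 0 and
    \<open>t\<close>. The second factor is positive since both \<open>k^2 * l0\<close> and
    \<open>k^2 * l t\<close> are below 1, so \<open>l t\<close> drops below \<open>l0\<close> at
    once.\<close>
  have "(l0 - l t) * (1 - k\<^sup>2 * (l0 + l t) / 2) = 16 * T - l t * (1 - k\<^sup>2 * l t / 2)"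
    unfolding T_altdef by (simp add: power2_eq_square field_simps)
  then have diff: "(l0 - l t) * (1 - k\<^sup>2 * (l0 + l t) / 2) = 16 * t"
    unfolding * by simp
  have pos: "0 < 1 - k\<^sup>2 * (l0 + l t) / 2"
    using k2_l0 k2_l[OF assms] by (simp add: distrib_left)
  have "0 \<le> t"
    using assms by (simp add: lifetime_def)
  then have "0 \<le> (l0 - l t) * (1 - k\<^sup>2 * (l0 + l t) / 2)"
    unfolding diff by simp
  then show "l t \<le> l0"
    using pos by (simp add: zero_le_mult_iff)
  show "l t < l0" if "0 < t"
  proof -
    have "0 < (l0 - l t) * (1 - k\<^sup>2 * (l0 + l t) / 2)"
      unfolding diff using that by simp
    then show ?thesis
      using pos by (simp add: zero_less_mult_iff)
  qed
qed

lemma gap_bounds: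
  assumes "t \<in> lifetime \<tau>"
  shows "L t + R t = sqrt (l t)" "L t + R t \<le> y - x"
proof -
  show *: "L t + R t = sqrt (l t)"
    using L_pos[OF assms] R_pos[OF assms] by (simp add: l_def)
  have "sqrt (l t) \<le> sqrt l0"
    using l_bounds(3)[OF assms] by simp
  then show "L t + R t \<le> y - x"
    unfolding * using x_neg y_pos by (simp add: l0_def)
qed

lemma \<tau>_eq: "\<tau> = ereal T"
proof (rule \<tau>_eqI)
  show "t < T" if "t \<in> lifetime \<tau>" for t
    using l_bounds(2)[OF that] l_pos[OF that] by simp
next
  fix r assume r: "0 < r" "r < T"
  \<comment> \<open>The numerator bounds \<open>L * R\<close> from below before time
    \<open>r\<close>, and neither gap ever exceeds \<open>y - x\<close>.\<close>
  define \<delta> where "\<delta> = 4 * ((T - r) * (1 - k\<^sup>2 * l0)) / (y - x)"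
  have "0 < y - x"
    using x_neg y_pos by simp
  have "\<delta> > 0"
    using r x_neg y_pos k2_l0 by (simp add: \<delta>_def)
  moreover have "\<delta> \<le> L t \<and> \<delta> \<le> R t" if t: "t \<in> lifetime \<tau>" "t < r" for t
  proof -
    have "(16 * (T - r)) * (1 - k\<^sup>2 * l0) \<le> l t * (1 - k\<^sup>2 * l t)"
      using l_bounds[OF t(1)] t(2) r k2_l0
      by (intro mult_mono diff_left_mono mult_left_mono) auto
    then have "16 * ((T - r) * (1 - k\<^sup>2 * l0)) \<le> l t * (1 - k\<^sup>2 * l t)"
      by (simp only: mult.assoc)
    also have "\<dots> = 4 * (L t * R t)"
      by (rule gap_product[OF t(1), symmetric])
    finally have prod: "4 * ((T - r) * (1 - k\<^sup>2 * l0)) \<le> L t * R t"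
      by linarith
    have "L t * R t \<le> L t * (y - x)" "L t * R t \<le> (y - x) * R t"
      using gap_bounds(2)[OF t(1)] L_pos[OF t(1)] R_pos[OF t(1)]
      by (intro mult_left_mono mult_right_mono; simp)+
    then show ?thesis
      using prod \<open>0 < y - x\<close> by (simp add: \<delta>_def pos_divide_le_eq mult.commute[of "y - x"])
  qed
  ultimately show "\<exists>\<delta>>0. \<forall>t\<in>lifetime \<tau>. t < r \<longrightarrow> \<delta> \<le> L t \<and> \<delta> \<le> R t"
    by blast
qed

lemma l_tendsto: "(l \<longlongrightarrow> 0) (at_left T)"
proof (rule tendsto_sandwich)
  note ev = eventually_at_left_lifetime[OF \<tau>_eq T_pos]
  show "\<forall>\<^sub>F t in at_left T. 0 \<le> l t" "\<forall>\<^sub>F t in at_left T. l t \<le> 32 * (T - t)"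
    by (rule eventually_mono[OF ev], simp add: l_def, rule eventually_mono[OF ev], rule l_bounds(2))
  have "((\<lambda>t. 32 * (T - t)) \<longlongrightarrow> 32 * (T - T)) (at_left T)"
    by (intro tendsto_intros)
  then show "((\<lambda>t. 32 * (T - t)) \<longlongrightarrow> 0) (at_left T)"
    by simp
qed simp

definition b :: real where "b = 3 / 4 * (x + y)"

lemma gaps_tendsto: "(L \<longlongrightarrow> 0) (at_left T)" "(R \<longlongrightarrow> 0) (at_left T)" "(\<xi> \<longlongrightarrow> b) (at_left T)"
proof -
  note ev = eventually_at_left_lifetime[OF \<tau>_eq T_pos]
  have lim: "((\<lambda>t. sqrt (l t)) \<longlongrightarrow> 0) (at_left T)"
    using tendsto_real_sqrt[OF l_tendsto] by simp
  have L: "\<forall>\<^sub>F t in at_left T. 0 \<le> L t" "\<forall>\<^sub>F t in at_left T. L t \<le> sqrt (l t)"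
    and R: "\<forall>\<^sub>F t in at_left T. 0 \<le> R t" "\<forall>\<^sub>F t in at_left T. R t \<le> sqrt (l t)"
    using ev by (eventually_elim; use L_pos R_pos gap_bounds(1) in \<open>smt (verit)\<close>)+
  show "(L \<longlongrightarrow> 0) (at_left T)" "(R \<longlongrightarrow> 0) (at_left T)"
    by (rule tendsto_sandwich[OF L tendsto_const lim] tendsto_sandwich[OF R tendsto_const lim])+
  have "((\<lambda>t. 3 / 4 * (x + y - k * l t)) \<longlongrightarrow> 3 / 4 * (x + y - k * 0)) (at_left T)"
    by (intro tendsto_intros l_tendsto)
  moreover have "\<forall>\<^sub>F t in at_left T. \<xi> t = 3 / 4 * (x + y - k * l t)"
    using ev by eventually_elim (rule \<xi>_eq)
  ultimately have "((\<lambda>t. 3 / 4 * (x + y - k * l t)) \<longlongrightarrow> b) (at_left T)" "\<forall>\<^sub>F t in at_left T. 3 / 4 * (x + y - k * l t) = \<xi> t"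
    by (simp_all only: b_def mult_zero_right diff_zero eq_commute)
  then show "(\<xi> \<longlongrightarrow> b) (at_left T)"
    by (rule Lim_transform_eventually)
qed

section \<open>The conserved quotient and the hull at every positive time, for weights -3\<close>

definition nu :: "real \<Rightarrow> real" where "nu r = (1 - k\<^sup>2 * r) / 2"

text \<open>The value at time 0 of the conserved quotient in \<open>flow_invariant\<close>.\<close>

definition G :: "complex \<Rightarrow> complex" where
  "G z = (z - of_real x) * (z - of_real y) / (of_real k * z + of_real (nu l0))\<^sup>2"

lemma nu_pos: "k\<^sup>2 * r < 1 \<Longrightarrow> 0 < nu r"
  by (simp add: nu_def)

lemma flow_invariant:
  assumes z: "z \<in> uhp" and t: "t \<in> lifetime \<tau>"
  shows "(h t z - of_real (V1 t)) * (h t z - of_real (V2 t)) /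
    (of_real k * (h t z - of_real (\<xi> t)) + of_real (nu (l t)))\<^sup>2 = G z"
proof -
  define f where "f t = (h t z - of_real (V1 t)) * (h t z - of_real (V2 t))" for t
  define N where "N t = of_real k * (h t z - of_real (\<xi> t)) + complex_of_real (nu (l t))" for t
  \<comment> \<open>Half the logarithmic derivative of \<open>f\<close>, read off from
    \<open>h_diff_derivs\<close>; what remains is that \<open>N\<close> has logarithmic derivative
    \<open>g\<close>.\<close>
  define g where "g t = complex_of_real (1 / R t - 1 / L t) / (h t z - of_real (\<xi> t))" for t
  have "f t / (N t)\<^sup>2 = f 0 / (N 0)\<^sup>2"
  proof (rule quotient_invariant[OF _ _ _ t])
    fix t assume t: "t \<in> lifetime \<tau>"
    define Z where "Z = h t z - of_real (\<xi> t)"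
    note d = h_diff_derivs[OF z t, folded Z_def]
    show "N t \<noteq> 0"
      unfolding N_def using h_in_uhp[OF z t] nu_pos[OF k2_l[OF t]]
      by (intro mob_denom) (simp_all add: uhp_def)
    show "(f has_vector_derivative 2 * g t * f t) (at t within {0..})"
      unfolding f_def
      by (rule has_vector_derivative_eq_rhs[OF has_vector_derivative_mult[OF d(2,3)]])
        (use d(1) L_ne[OF t] R_ne[OF t] in \<open>simp add: g_def Z_def[symmetric] field_simps\<close>)
    define \<delta> where "\<delta> = 1 / R t - 1 / L t"
    have "\<delta> = - (R t - L t) / (L t * R t)"
      using L_ne[OF t] R_ne[OF t] by (simp add: \<delta>_def field_simps)
    then have \<delta>: "\<delta> = - k * l t / (L t * R t)"
      unfolding gap_difference[OF t] by simp
    have "l t * nu (l t) = 2 * (L t * R t)"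
      using gap_product[OF t] by (simp add: nu_def)
    \<comment> \<open>This matches the pole \<open>- 2 * k / Z\<close> in the derivative of
      \<open>N\<close>. In the regular part the driver contributes \<open>3 * k * \<delta>\<close>
      and \<open>nu\<close> contributes \<open>- 2 * k * \<delta>\<close>, leaving the required
      \<open>k * \<delta>\<close>.\<close>
    then have \<delta>_nu: "\<delta> * nu (l t) = - 2 * k"
      using L_ne[OF t] R_ne[OF t] unfolding \<delta> by (simp add: field_simps)
    have "((\<lambda>t. nu (l t)) has_real_derivative - 2 * k * \<delta>) (at t within {0..})"
      unfolding nu_def
      by (rule DERIV_cong[OF DERIV_cdivide[OF DERIV_diff[OF DERIV_const DERIV_cmult[OF l_deriv[OF t]]]]])
        (simp add: \<delta> power2_eq_square)
    moreover have "(\<xi> has_real_derivative - 3 * \<delta>) (at t within {0..})"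
      using derivs(1)[OF t] by (simp add: \<delta>_def)
    ultimately have "(N has_vector_derivative
        of_real k * (- 2 / Z - of_real (- 3 * \<delta>)) + of_real (- 2 * k * \<delta>)) (at t within {0..})"
      unfolding N_def Z_def
      by (intro has_vector_derivative_add has_vector_derivative_mult_right has_vector_derivative_diff
          has_vector_derivative_of_real h_deriv z t)
    moreover have "of_real k * (- 2 / Z - of_real (- 3 * \<delta>)) + of_real (- 2 * k * \<delta>) = g t * N t"
    proof -
      have "g t * N t = of_real \<delta> * of_real k + of_real (\<delta> * nu (l t)) / Z"
        using d(1) by (simp add: g_def N_def Z_def[symmetric] \<delta>_def[symmetric] distrib_left)
      then show ?thesis
        unfolding \<delta>_nu by (simp add: algebra_simps)
    qed
    ultimately show "(N has_vector_derivative g t * N t) (at t within {0..})"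
      by (simp only:)
  qed
  then show ?thesis
    by (simp add: f_def N_def G_def h_0[OF z] V1_0 V2_0 \<xi>_0 l_0)
qed

text \<open>Dividing \<open>mob_square_identity\<close> by the squared denominator turns the
  conserved quotient into an affine relation whose coefficients depend on time only through
  \<open>l\<close>. Comparison with time 0 then eliminates \<open>G\<close>.\<close>

lemma mob_square_flow:
  assumes z: "z \<in> uhp" and t: "t \<in> lifetime \<tau>"
  shows "(mob k (nu (l t)) (h t z - of_real (\<xi> t)))\<^sup>2 = of_real (l t) + of_real (1 - k\<^sup>2 * l t) * G z"
proof -
  define Z where "Z = h t z - of_real (\<xi> t)"
  define N where "N = of_real k * Z + complex_of_real (nu (l t))"
  have N: "N \<noteq> 0"
    unfolding N_def Z_def using h_in_uhp[OF z t] nu_pos[OF k2_l[OF t]]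
    by (intro mob_denom) (simp_all add: uhp_def)
  have "of_real (1 - k\<^sup>2 * l t) * ((Z + of_real (L t)) * (Z - of_real (R t))) = Z\<^sup>2 - of_real (l t) * N\<^sup>2"
  proof -
    have "4 * (complex_of_real (L t) * of_real (R t)) = of_real (l t) * (1 - (of_real k)\<^sup>2 * of_real (l t))"
      using arg_cong[OF gap_product[OF t], of complex_of_real] by simp
    moreover have "complex_of_real (R t) - of_real (L t) = of_real k * of_real (l t)"
      using arg_cong[OF gap_difference[OF t], of complex_of_real] by simp
    ultimately show ?thesis
      using mob_square_identity[of "of_real (L t)" "of_real (R t)" "of_real (l t)" "of_real k" Z]
      by (simp add: N_def nu_def)
  qed
  moreover have "Z + of_real (L t) = h t z - of_real (V1 t)" "Z - of_real (R t) = h t z - of_real (V2 t)"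
    by (simp_all add: Z_def L_def R_def)
  moreover have "(h t z - of_real (V1 t)) * (h t z - of_real (V2 t)) = G z * N\<^sup>2"
    using flow_invariant[OF z t] N by (simp add: N_def Z_def field_simps)
  ultimately have "of_real (1 - k\<^sup>2 * l t) * (G z * N\<^sup>2) = Z\<^sup>2 - of_real (l t) * N\<^sup>2"
    by (simp only:)
  then have "Z\<^sup>2 = (of_real (l t) + of_real (1 - k\<^sup>2 * l t) * G z) * N\<^sup>2"
    by (simp add: algebra_simps)
  then show ?thesis
    using N by (simp add: mob_def N_def[symmetric] Z_def[symmetric] power_divide)
qed

lemma mob_square_0:
  assumes "z \<in> uhp"
  shows "(mob k (nu l0) z)\<^sup>2 = of_real l0 + of_real (1 - k\<^sup>2 * l0) * G z"
proof -
  have "0 \<in> lifetime \<tau>"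
    using \<tau>_pos by (simp add: lifetime_def zero_ereal_def)
  then show ?thesis
    using mob_square_flow[OF assms, of 0] by (simp add: h_0[OF assms] \<xi>_0 l_0)
qed

text \<open>The gaps are not constrained at time \<open>T\<close> itself, so \<open>l\<close> is
  replaced there by its limit 0.\<close>

definition lhat :: "real \<Rightarrow> real" where "lhat t = (if t < T then l t else 0)"

lemma lhat:
  assumes "0 < t" "t \<le> T"
  shows "0 \<le> lhat t" "lhat t < l0" "k\<^sup>2 * lhat t < 1"
proof -
  have "t \<in> lifetime \<tau>" if "t < T"
    using assms that by (simp add: \<tau>_eq lifetime_ereal)
  then show "0 \<le> lhat t" "lhat t < l0" "k\<^sup>2 * lhat t < 1"
    using l_bounds(4)[of t] l_pos[of t] k2_l[of t] l0_pos assms(1) by (auto simp: lhat_def)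
qed

lemma mob_square_map:
  assumes t: "0 < t" "t \<le> T" and z: "z \<in> uhp"
  shows "0 < Im (loewner_map \<tau> h t z - of_real (upto_time \<tau> \<xi> t))" (is ?Im)
    "(mob k (nu (lhat t)) (loewner_map \<tau> h t z - of_real (upto_time \<tau> \<xi> t)))\<^sup>2 =
      of_real (lhat t) + of_real (1 - k\<^sup>2 * lhat t) * G z" (is ?sq)
proof -
  have "?Im \<and> ?sq"
  proof (cases "t < T")
    case True
    then have "t \<in> lifetime \<tau>" "ereal t < \<tau>"
      using t by (auto simp: \<tau>_eq lifetime_ereal)
    then show ?thesis
      using mob_square_flow[OF z] h_in_uhp[OF z] True
      by (simp add: loewner_map_def upto_time_def lhat_def uhp_def)
  next
    case False
    then have "t = T"
      using t by simp
    define w where "w = loewner_map \<tau> h T z - of_real b"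
    note lim = h_tendsto[OF z \<tau>_eq T_pos]
    have b: "upto_time \<tau> \<xi> T = b"
      by (rule limit_at_hitting(1)[OF \<tau>_eq gaps_tendsto])
    have "0 < Im w"
      using lim(2) z by (simp add: w_def uhp_def)
    have ne: "of_real k * w + complex_of_real (nu 0) \<noteq> 0"
      using \<open>0 < Im w\<close> by (intro mob_denom) (auto simp: nu_def)
    have nu: "((\<lambda>t. nu (l t)) \<longlongrightarrow> nu 0) (at_left T)"
      unfolding nu_def by (intro tendsto_intros l_tendsto) simp
    have "((\<lambda>t. (mob k (nu (l t)) (h t z - of_real (\<xi> t)))\<^sup>2) \<longlongrightarrow> (mob k (nu 0) w)\<^sup>2) (at_left T)"
      using ne unfolding mob_def w_def
      by (intro tendsto_intros lim gaps_tendsto(3) nu)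
    moreover have "\<forall>\<^sub>F t in at_left T. (mob k (nu (l t)) (h t z - of_real (\<xi> t)))\<^sup>2 =
        of_real (l t) + of_real (1 - k\<^sup>2 * l t) * G z"
      using eventually_at_left_lifetime[OF \<tau>_eq T_pos] by eventually_elim (rule mob_square_flow[OF z])
    ultimately have "((\<lambda>t. of_real (l t) + of_real (1 - k\<^sup>2 * l t) * G z) \<longlongrightarrow> (mob k (nu 0) w)\<^sup>2) (at_left T)"
      by (rule Lim_transform_eventually)
    moreover have "((\<lambda>t. of_real (l t) + of_real (1 - k\<^sup>2 * l t) * G z) \<longlongrightarrow>
        of_real 0 + of_real (1 - k\<^sup>2 * 0) * G z) (at_left T)"
      by (intro tendsto_intros l_tendsto)
    ultimately have "(mob k (nu 0) w)\<^sup>2 = of_real 0 + of_real (1 - k\<^sup>2 * 0) * G z"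
      using tendsto_unique trivial_limit_at_left_real by blast
    then show ?thesis
      using \<open>0 < Im w\<close> \<open>t = T\<close> by (simp add: lhat_def w_def b)
  qed
  then show ?Im ?sq
    by blast+
qed

text \<open>The height of the vertical slit that the hull becomes in the Moebius coordinate.\<close>

definition tip :: "real \<Rightarrow> real" where "tip t = sqrt ((l0 - lhat t) / (1 - k\<^sup>2 * l0))"

lemma tip_pos: "0 < t \<Longrightarrow> t \<le> T \<Longrightarrow> 0 < tip t"
  using lhat(2)[of t] k2_l0 by (simp add: tip_def)

lemma loewner_map_image:
  assumes t: "0 < t" "t \<le> T"
  shows "loewner_map \<tau> h t ` uhp = uhp - circ_arc (upto_time \<tau> \<xi> t) k (nu (lhat t)) (tip t)"
  unfolding nu_def tip_def
proof (rule image_eq_arc_complement[OF lhat(2)[OF t] k2_l0 lhat(3)[OF t] mob_square_map(1)[OF t]])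
  fix z assume z: "z \<in> uhp"
  have "complex_of_real (1 - k\<^sup>2 * l0) \<noteq> 0"
    using k2_l0 by (simp only: of_real_eq_0_iff)
  then have "G z = ((mob k (nu l0) z)\<^sup>2 - of_real l0) / of_real (1 - k\<^sup>2 * l0)"
    unfolding mob_square_0[OF z] by simp
  then show "(mob k ((1 - k\<^sup>2 * lhat t) / 2) (loewner_map \<tau> h t z - of_real (upto_time \<tau> \<xi> t)))\<^sup>2 =
      of_real (lhat t) + of_real (1 - k\<^sup>2 * lhat t) *
        ((mob k ((1 - k\<^sup>2 * l0) / 2) z)\<^sup>2 - of_real l0) / of_real (1 - k\<^sup>2 * l0)"
    using mob_square_map(2)[OF t z] by (simp only: nu_def times_divide_eq_right)
qed

lemma hull_eq:
  assumes t: "0 < t" "t \<le> T"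
  shows "loewner_hull \<tau> h t = circ_arc (upto_time \<tau> \<xi> t) k (nu (lhat t)) (tip t)"
proof -
  have "circ_arc (upto_time \<tau> \<xi> t) k (nu (lhat t)) (tip t) \<subseteq> uhp"
    using mob_arc_pt(2)[OF nu_pos[OF lhat(3)[OF t]]] by (auto simp: circ_arc_def uhp_def)
  then show ?thesis
    unfolding loewner_hull_def loewner_map_image[OF t] by blast
qed

lemma hull_shape:
  assumes t: "0 < t" "t \<le> T"
  shows "if y = - x then segment_at_angle (loewner_hull \<tau> h t) (upto_time \<tau> \<xi> t) (pi / 2)
    else orthogonal_circular_arc (loewner_hull \<tau> h t) (upto_time \<tau> \<xi> t)"
proof (cases "y = - x")
  case True
  then have "x + y = 0"
    by simp
  then have "k = 0"
    using k_l0 l0_pos by simp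
  then show ?thesis
    using circ_arc_segment[OF nu_pos[OF lhat(3)[OF t]] tip_pos[OF t]] True
    by (simp add: hull_eq[OF t])
next
  case False
  then have "x + y \<noteq> 0"
    by simp
  then have "k \<noteq> 0"
    using k_l0 by auto
  then show ?thesis
    using circ_arc_orthogonal[OF _ nu_pos[OF lhat(3)[OF t]] tip_pos[OF t]] False
    by (simp add: hull_eq[OF t])
qed

text \<open>The branch of the square root of \<open>(z - x) * (z - y)\<close> that maps the half-plane into itself.\<close>

definition branch :: "complex \<Rightarrow> complex" where
  "branch z = (z - of_real x) powr of_real (1 / 2) * (z - of_real y) powr of_real (1 / 2)"

text \<open>Inverting the Moebius coordinate at \<open>branch z / (k * z + nu l0)\<close> gives a
  double fraction. Its inner denominator vanishes at a real point when \<open>k\<close> is nonzero,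
  so it is cleared to make \<open>f\<close> continuous on the closed half-plane.\<close>

definition denom :: "complex \<Rightarrow> complex" where
  "denom z = of_real k * z + of_real (nu l0) - of_real k * branch z"

definition f :: "complex \<Rightarrow> complex" where
  "f z = of_real b + of_real (1 / 2) * branch z / denom z"

section \<open>The explicit map at the hitting time and its boundary values, for weights -3\<close>

lemma branch_squared: "(branch z)\<^sup>2 = (z - of_real x) * (z - of_real y)"
proof -
  have "(w powr of_real (1 / 2))\<^sup>2 = w" for w :: complex
    by (simp add: power2_eq_square powr_add[symmetric])
  then show ?thesis
    by (simp only: branch_def power_mult_distrib)
qed

lemma continuous_branch: "continuous_on {z. 0 \<le> Im z} branch"
  unfolding branch_def by (intro continuous_intros continuous_on_powr_halfplane) auto

lemma branch_left:
  assumes "u \<le> x"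
  shows "branch (of_real u) = of_real (- sqrt ((x - u) * (y - u)))"
proof (cases "u = x")
  case False
  then have u: "u < x" "u < y"
    using assms x_neg y_pos by auto
  have "exp (\<i> * of_real pi * of_real (1 / 2)) = \<i>"
    by (simp add: exp_eq_polar)
  then show ?thesis
    unfolding branch_def powr_of_neg[OF u(1)] powr_of_neg[OF u(2)]
    using u by (simp add: powr_half_sqrt real_sqrt_mult complex_eq_iff)
qed (simp add: branch_def)

lemma branch_middle:
  assumes "x \<le> u" "u \<le> y"
  shows "branch (of_real u) = \<i> * of_real (sqrt ((u - x) * (y - u)))"
proof (cases "u = y")
  case False
  then have u: "u < y"
    using assms by auto
  have "exp (\<i> * of_real pi * of_real (1 / 2)) = \<i>"
    by (simp add: exp_eq_polar)
  then show ?thesis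
    unfolding branch_def powr_of_nonneg[OF assms(1)] powr_of_neg[OF u]
    using assms by (simp add: powr_half_sqrt real_sqrt_mult)
qed (simp add: branch_def)

lemma branch_right:
  assumes "y \<le> u"
  shows "branch (of_real u) = of_real (sqrt ((u - x) * (u - y)))"
proof -
  have u: "x \<le> u"
    using assms x_neg y_pos by auto
  show ?thesis
    unfolding branch_def powr_of_nonneg[OF u] powr_of_nonneg[OF assms]
    using assms u by (simp add: powr_half_sqrt real_sqrt_mult)
qed

text \<open>In this form positivity on \<open>{x..y}\<close> is visible: both products are
  nonnegative there and they do not vanish together.\<close>

lemma l0_n: "l0 * (k * u + nu l0) = x * (u - y) + y * (u - x)"
proof -
  have "l0 * (k * u + nu l0) = (k * l0) * u + l0 * (1 - k\<^sup>2 * l0) / 2"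
    by (simp add: nu_def algebra_simps)
  then show ?thesis
    unfolding k_l0 four_xy[symmetric] by (simp add: algebra_simps)
qed

lemma n_pos:
  assumes "x \<le> u" "u \<le> y"
  shows "0 < k * u + nu l0"
proof -
  have "0 \<le> x * (u - y)" "0 \<le> y * (u - x)"
    using assms x_neg y_pos by (auto simp: mult_nonpos_nonpos)
  moreover have "x * (u - y) \<noteq> 0 \<or> y * (u - x) \<noteq> 0"
    using x_neg y_pos by auto
  ultimately have "0 < l0 * (k * u + nu l0)"
    unfolding l0_n by linarith
  then show ?thesis
    using l0_pos by (simp add: zero_less_mult_iff)
qed

text \<open>With \<open>c = x * y / (x + y)\<close> the equation reads
  \<open>branch z = z - 2 * c\<close>. Squaring it cancels the quadratic terms and leaves
  \<open>z = c\<close> as the only candidate.\<close>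

lemma denom_zero:
  assumes "denom z = 0"
  shows "of_real (x + y) * z = of_real (x * y)" "branch z = - z"
proof -
  have "0 < nu l0"
    using k2_l0 by (rule nu_pos)
  then have "k \<noteq> 0"
    using assms by (auto simp: denom_def)
  then have e: "x + y \<noteq> 0"
    using k_l0 l0_pos by auto
  define c where "c = x * y / (x + y)"
  have c: "(x + y) * c = x * y"
    using e by (simp add: c_def)
  have "complex_of_real l0 * denom z = 0"
    using assms by simp
  moreover have "complex_of_real l0 * denom z = of_real (k * l0) * z + of_real (l0 * nu l0) - of_real (k * l0) * branch z"
    by (simp add: denom_def algebra_simps)
  moreover have "l0 * nu l0 = - 2 * ((x + y) * c)"
    unfolding c using l0_n[of 0] by simp
  ultimately have "complex_of_real (x + y) * z + of_real (- 2 * ((x + y) * c)) - of_real (x + y) * branch z = 0"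
    by (simp only: k_l0)
  then have "of_real (x + y) * (z - 2 * of_real c - branch z) = 0"
    by (simp add: algebra_simps)
  then have branch: "branch z = z - 2 * of_real c"
    using e by (metis eq_iff_diff_eq_0 mult_eq_0_iff of_real_eq_0_iff)
  have "z\<^sup>2 - of_real (x + y) * z + of_real ((x + y) * c) = (z - 2 * of_real c)\<^sup>2"
    using branch_squared[of z] unfolding branch c by (simp add: power2_eq_square algebra_simps)
  then have "of_real (x + y - 4 * c) * (z - of_real c) = 0"
    by (simp add: power2_eq_square algebra_simps)
  moreover have "x + y - 4 * c \<noteq> 0"
  proof
    assume "x + y - 4 * c = 0"
    then have "(x + y)\<^sup>2 = 4 * ((x + y) * c)"
      by (simp add: power2_eq_square)
    then have "(x + y)\<^sup>2 = 4 * (x * y)"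
      by (simp only: c)
    then show False
      using x_neg y_pos mult_neg_pos[of x y] zero_le_power2[of "x + y"] by linarith
  qed
  ultimately have "z = of_real c"
    by (metis eq_iff_diff_eq_0 mult_eq_0_iff of_real_eq_0_iff)
  then show "of_real (x + y) * z = of_real (x * y)" "branch z = - z"
    using branch by (simp_all flip: c)
qed

text \<open>The candidate in \<open>denom_zero\<close> is real, and there the branch would have to
  equal \<open>- z\<close>. Outside \<open>{x..y}\<close> the branch has the wrong sign for that,
  and inside, the real part of \<open>denom\<close> is positive.\<close>

lemma denom_nonzero:
  assumes "0 \<le> Im z"
  shows "denom z \<noteq> 0"
proof
  assume zero: "denom z = 0"
  have "x + y \<noteq> 0"
  proof
    assume "x + y = 0"
    then have "complex_of_real (x * y) = 0"
      using denom_zero(1)[OF zero] by simp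
    then show False
      using x_neg y_pos by simp
  qed
  then have "z = of_real (x * y / (x + y))"
    using denom_zero(1)[OF zero] by (simp add: field_simps flip: of_real_add of_real_mult)
  then obtain u where u: "z = of_real u"
    by blast
  consider "u < x" | "x \<le> u" "u \<le> y" | "y < u"
    by linarith
  then show False
  proof cases
    case 1
    then have "- sqrt ((x - u) * (y - u)) = - u"
      using denom_zero(2)[OF zero] branch_left[of u] unfolding u by (metis less_imp_le of_real_eq_iff of_real_minus)
    moreover have "0 \<le> sqrt ((x - u) * (y - u))"
      using 1 x_neg y_pos by simp
    ultimately show False
      using 1 x_neg by simp
  next
    case 2
    then have "Re (denom z) = k * u + nu l0"
      unfolding u denom_def branch_middle[OF 2] by simp
    then show False
      using n_pos[OF 2] zero by simp
  next
    case 3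
    then have "sqrt ((u - x) * (u - y)) = - u"
      using denom_zero(2)[OF zero] branch_right[of u] unfolding u by (metis less_imp_le of_real_eq_iff of_real_minus)
    moreover have "0 \<le> sqrt ((u - x) * (u - y))"
      using 3 x_neg y_pos by simp
    ultimately show False
      using 3 y_pos by simp
  qed
qed

lemma continuous_f: "continuous_on {z. 0 \<le> Im z} f"
  unfolding f_def using denom_nonzero
  by (intro continuous_intros continuous_branch) (auto simp: denom_def intro!: continuous_intros continuous_branch)

lemma G_eq: "G z = (branch z / (of_real k * z + of_real (nu l0)))\<^sup>2"
  by (simp add: G_def power_divide branch_squared)

text \<open>
  On the half-plane the quotient is nowhere real, and it is close to a positive multiple of
  \<open>\<i>\<close> near 0. This selects the branch of the square branch of \<open>G\<close>.
\<close>

lemma Im_branch_quotient: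
  assumes z: "z \<in> uhp"
  shows "0 < Im (branch z / (of_real k * z + of_real (nu l0)))"
proof -
  define q where "q z = branch z / (of_real k * z + of_real (nu l0))" for z
  have nu: "0 < nu l0"
    using k2_l0 by (rule nu_pos)
  have ne: "Im (q w) \<noteq> 0" if w: "w \<in> uhp" for w
  proof
    assume "Im (q w) = 0"
    then have "q w = of_real (Re (q w))"
      by (simp add: complex_eq_iff)
    then have "G w = of_real ((Re (q w))\<^sup>2)"
      unfolding G_eq q_def by (metis of_real_power)
    \<comment> \<open>A real quotient would make the square of a point of the half-plane a
      nonnegative real.\<close>
    then have "(mob k (nu l0) w)\<^sup>2 = of_real (l0 + (1 - k\<^sup>2 * l0) * (Re (q w))\<^sup>2)"
      using mob_square_0[OF w] by simp
    moreover have "0 \<le> l0 + (1 - k\<^sup>2 * l0) * (Re (q w))\<^sup>2"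
      using l0_pos k2_l0 by simp
    ultimately show False
      using square_in_uhp_neq[OF Im_mob[OF nu]] w unfolding uhp_def by blast
  qed
  have cont: "continuous_on S q" if "S \<subseteq> {z. 0 \<le> Im z}" "\<And>z. z \<in> S \<Longrightarrow> of_real k * z + of_real (nu l0) \<noteq> 0" for S
    unfolding q_def using that(2)
    by (intro continuous_intros continuous_on_subset[OF continuous_branch] that(1)) blast
  have "continuous_on uhp q"
    using mob_denom[OF nu] by (intro cont) (auto simp: uhp_def)
  then have conn: "connected ((\<lambda>z. Im (q z)) ` uhp)"
    by (intro connected_continuous_image convex_connected convex_uhp continuous_intros)
  obtain w where w: "w \<in> uhp" "0 < Im (q w)"
  proof -
    \<comment> \<open>The quotient may have a pole on the real axis, but not at 0, so this set
      allows continuity up to the boundary point 0.\<close>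
    define S where "S = {z. 0 \<le> Im z} \<inter> {z. of_real k * z + of_real (nu l0) \<noteq> 0}"
    have S0: "0 \<in> S" "uhp \<subseteq> S"
      using mob_denom[OF nu, of _ k] nu by (auto simp: S_def uhp_def)
    have "continuous_on S (\<lambda>z. Im (q z))"
      by (intro continuous_intros cont) (auto simp: S_def)
    then have "((\<lambda>z. Im (q z)) \<longlongrightarrow> Im (q 0)) (at 0 within S)"
      using S0(1) by (simp add: continuous_on_def)
    then have lim: "((\<lambda>z. Im (q z)) \<longlongrightarrow> Im (q 0)) (at 0 within uhp)"
      by (rule tendsto_within_subset[OF _ S0(2)])
    have "branch 0 = \<i> * of_real (sqrt (- x * y))"
      using branch_middle[of 0] x_neg y_pos by simp
    then have "Im (q 0) = sqrt (- x * y) / nu l0"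
      by (simp add: q_def)
    then have "0 < Im (q 0)"
      using nu x_neg y_pos by (simp add: mult_neg_pos)
    then have "\<forall>\<^sub>F z in at 0 within uhp. 0 < Im (q z)"
      using lim order_tendstoD(1) by blast
    moreover have "\<forall>\<^sub>F z in at 0 within uhp. z \<in> uhp"
      by (simp add: eventually_at_filter)
    ultimately have "\<forall>\<^sub>F z in at 0 within uhp. z \<in> uhp \<and> 0 < Im (q z)"
      by eventually_elim simp
    then show ?thesis
      using that eventually_happens' at_within_uhp_neq_bot[of 0] by force
  qed
  show ?thesis
  proof (rule ccontr)
    assume "\<not> 0 < Im (branch z / (of_real k * z + of_real (nu l0)))"
    then have "Im (q z) \<le> 0"
      by (simp add: q_def)
    then have "0 \<in> (\<lambda>z. Im (q z)) ` uhp"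
      using connected_contains_Icc[OF conn, of "Im (q z)" "Im (q w)"] w z by auto
    then show False
      using ne by auto
  qed
qed

lemma loewner_map_eq:
  assumes z: "z \<in> uhp"
  shows "loewner_map \<tau> h T z = f z"
proof -
  define w where "w = loewner_map \<tau> h T z - of_real b"
  have b: "upto_time \<tau> \<xi> T = b"
    by (rule limit_at_hitting(1)[OF \<tau>_eq gaps_tendsto])
  have w: "0 < Im w" "(mob k (1 / 2) w)\<^sup>2 = (branch z / (of_real k * z + of_real (nu l0)))\<^sup>2"
    using mob_square_map[OF T_pos order_refl z] unfolding b G_eq
    by (simp_all add: w_def lhat_def nu_def)
  define n where "n = of_real k * z + complex_of_real (nu l0)"
  have n: "n \<noteq> 0"
    unfolding n_def using z nu_pos[OF k2_l0] by (intro mob_denom) (auto simp: uhp_def)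
  have "mob k (1 / 2) w = branch z / n"
    using square_inj_uhp[OF Im_mob[OF _ w(1)] Im_branch_quotient[OF z] w(2)] by (simp add: n_def)
  then have "w = of_real (1 / 2) * (branch z / n) / (1 - of_real k * (branch z / n))"
    using mob_inverse[of "1 / 2" w k] w(1) by simp
  also have "1 - of_real k * (branch z / n) = denom z / n"
    using n by (simp add: denom_def n_def diff_divide_distrib)
  finally have "w = of_real (1 / 2) * branch z / denom z"
    using n by simp
  then show ?thesis
    by (simp add: f_def w_def algebra_simps)
qed

text \<open>In the Moebius coordinate the boundary value at \<open>u\<close> is
  \<open>\<i> * \<sigma> u\<close>, a point of the vertical slit.\<close>

definition \<sigma> :: "real \<Rightarrow> real" where
  "\<sigma> u = sqrt ((u - x) * (y - u)) / (k * u + nu l0)"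

lemma f_middle:
  assumes "x \<le> u" "u \<le> y"
  shows "f (of_real u) = of_real b + arc_pt k (1 / 2) (\<sigma> u)"
proof -
  define n where "n = k * u + nu l0"
  have n: "complex_of_real n \<noteq> 0"
    using n_pos[OF assms] unfolding n_def of_real_eq_0_iff by simp
  have "branch (of_real u) = of_real n * (\<i> * of_real (\<sigma> u))"
    unfolding branch_middle[OF assms] \<sigma>_def n_def[symmetric] using n by simp
  moreover from this have "denom (of_real u) = of_real n * (1 - of_real k * (\<i> * of_real (\<sigma> u)))"
    by (simp add: denom_def n_def algebra_simps)
  ultimately show ?thesis
    using n by (simp add: f_def arc_pt_def)
qed

lemma \<sigma>_nonneg: "x \<le> u \<Longrightarrow> u \<le> y \<Longrightarrow> 0 \<le> \<sigma> u"
  using n_pos[of u] by (simp add: \<sigma>_def)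

text \<open>Reduces the monotonicity of \<sigma> to that of the real Moebius map
  \<open>u / (k * u + nu l0)\<close>, which increases on \<open>{x..y}\<close> and vanishes at 0, so
  \<sigma> peaks at 0.\<close>

lemma \<sigma>_squared:
  assumes "x \<le> u" "u \<le> y"
  shows "(1 - k\<^sup>2 * l0) * (\<sigma> u)\<^sup>2 = l0 - (u / (k * u + nu l0))\<^sup>2"
proof -
  define n where "n = k * u + nu l0"
  have n: "n \<noteq> 0"
    using n_pos[OF assms] by (simp add: n_def)
  have "(1 - k\<^sup>2 * l0) * ((u + - x) * (u - y)) = u\<^sup>2 - l0 * (k * u + (1 - k\<^sup>2 * l0) / 2)\<^sup>2"
    by (rule mob_square_identity) (use four_xy k_l0 in \<open>simp_all add: algebra_simps\<close>)
  then have "(1 - k\<^sup>2 * l0) * ((u - x) * (y - u)) = l0 * n\<^sup>2 - u\<^sup>2"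
    by (simp add: n_def nu_def algebra_simps)
  moreover have "(\<sigma> u)\<^sup>2 = (u - x) * (y - u) / n\<^sup>2"
    using assms by (simp add: \<sigma>_def n_def power_divide)
  ultimately have "(1 - k\<^sup>2 * l0) * (\<sigma> u)\<^sup>2 = (l0 * n\<^sup>2 - u\<^sup>2) / n\<^sup>2"
    by simp
  then show ?thesis
    using n by (simp add: n_def[symmetric] power_divide diff_divide_distrib)
qed

lemma \<sigma>_less:
  assumes "x \<le> u" "u \<le> y" "x \<le> v" "v \<le> y"
    and "\<bar>v / (k * v + nu l0)\<bar> < \<bar>u / (k * u + nu l0)\<bar>"
  shows "\<sigma> u < \<sigma> v"
proof -
  have "(v / (k * v + nu l0))\<^sup>2 < (u / (k * u + nu l0))\<^sup>2"
    using power_strict_mono[OF assms(5) abs_ge_zero, of 2] by (simp only: power2_abs)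
  then have "(1 - k\<^sup>2 * l0) * (\<sigma> u)\<^sup>2 < (1 - k\<^sup>2 * l0) * (\<sigma> v)\<^sup>2"
    unfolding \<sigma>_squared[OF assms(1,2)] \<sigma>_squared[OF assms(3,4)] by simp
  then have "(\<sigma> u)\<^sup>2 < (\<sigma> v)\<^sup>2"
    using k2_l0 by simp
  then show ?thesis
    using \<sigma>_nonneg[OF assms(3,4)] by (rule power_less_imp_less_base)
qed

lemma mob_real_mono:
  assumes "x \<le> u" "u < v" "v \<le> y"
  shows "u / (k * u + nu l0) < v / (k * v + nu l0)"
proof -
  have "0 < nu l0 * (v - u)"
    using nu_pos[OF k2_l0] assms by simp
  then show ?thesis
    using n_pos[of u] n_pos[of v] assms by (simp add: frac_less_eq pos_divide_less_eq field_simps)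
qed

lemma \<sigma>_mono:
  assumes "x \<le> u" "u < v" "v \<le> 0"
  shows "\<sigma> u < \<sigma> v"
proof (rule \<sigma>_less)
  have "v / (k * v + nu l0) \<le> 0"
    using n_pos[of v] assms y_pos by (intro divide_nonpos_pos) auto
  then show "\<bar>v / (k * v + nu l0)\<bar> < \<bar>u / (k * u + nu l0)\<bar>"
    using mob_real_mono[of u v] assms y_pos by linarith
qed (use assms y_pos in auto)

lemma \<sigma>_antimono:
  assumes "0 \<le> u" "u < v" "v \<le> y"
  shows "\<sigma> v < \<sigma> u"
proof (rule \<sigma>_less)
  have "0 \<le> u / (k * u + nu l0)"
    using n_pos[of u] assms x_neg by (intro divide_nonneg_pos) auto
  then show "\<bar>u / (k * u + nu l0)\<bar> < \<bar>v / (k * v + nu l0)\<bar>"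
    using mob_real_mono[of u v] assms x_neg by linarith
qed (use assms x_neg in auto)

lemma \<sigma>_0: "\<sigma> 0 = tip T"
proof -
  have "(\<sigma> 0)\<^sup>2 = l0 / (1 - k\<^sup>2 * l0)"
    using \<sigma>_squared[of 0] x_neg y_pos k2_l0 by (simp add: field_simps)
  then show ?thesis
    using \<sigma>_nonneg[of 0] x_neg y_pos by (simp add: tip_def lhat_def real_sqrt_unique)
qed

lemma \<sigma>_le: "x \<le> u \<Longrightarrow> u \<le> y \<Longrightarrow> \<sigma> u \<le> tip T"
  using \<sigma>_mono[of u 0] \<sigma>_antimono[of 0 u] \<sigma>_0 by (cases u "0::real" rule: linorder_cases) auto

lemma hitting:
  "\<exists>T. force_points_end_at_base \<tau> T \<xi> V1 V2 h \<and>
    (\<forall>t. 0 < t \<and> t \<le> T \<longrightarrow>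
      (if y = - x then segment_at_angle (loewner_hull \<tau> h t) (upto_time \<tau> \<xi> t) (pi / 2)
       else orthogonal_circular_arc (loewner_hull \<tau> h t) (upto_time \<tau> \<xi> t)))"
proof -
  have half: "0 < (1 / 2 :: real)"
    by simp
  have tip: "0 < tip T"
    using tip_pos T_pos by simp
  have b: "upto_time \<tau> \<xi> T = b"
    by (rule limit_at_hitting(1)[OF \<tau>_eq gaps_tendsto])
  note slit = circ_arc_eq_polar_slit[OF half tip, of b k] circ_arc_slit_domain[OF half tip, of k]
  have image: "f ` uhp = uhp - polar_slit b (cmod (arc_pt k (1 / 2) (tip T))) (\<lambda>r. - (k / (1 / 2)) * r)"
    using loewner_map_image[OF T_pos order_refl] loewner_map_eq unfolding slit(1)[symmetric] b
    by (simp add: lhat_def nu_def cong: image_cong)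
  have modulus: "cmod (f (of_real u) - of_real b) = cmod (arc_pt k (1 / 2) (\<sigma> u))" if "u \<in> {x..y}" for u
    using that by (simp add: f_middle)
  have on_slit: "f (of_real u) \<in> insert (of_real b)
      (polar_slit b (cmod (arc_pt k (1 / 2) (tip T))) (\<lambda>r. - (k / (1 / 2)) * r))" if "u \<in> {x..y}" for u
  proof (cases "\<sigma> u = 0")
    case True
    then show ?thesis
      using that by (simp add: f_middle arc_pt_def)
  next
    case False
    then have "0 < \<sigma> u" "\<sigma> u \<le> tip T"
      using \<sigma>_nonneg[of u] \<sigma>_le[of u] that by auto
    then show ?thesis
      unfolding slit(1)[symmetric] circ_arc_def using that f_middle[of u] by auto
  qed
  have inj: "inj_on (\<lambda>u. cmod (f (of_real u) - of_real b)) {x..0}" (is ?left)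
    "inj_on (\<lambda>u. cmod (f (of_real u) - of_real b)) {0..y}" (is ?right)
  proof -
    have "cmod (f (of_real u) - of_real b) < cmod (f (of_real v) - of_real b)"
      if "u \<in> {x..y}" "v \<in> {x..y}" "\<sigma> u < \<sigma> v" for u v
      unfolding modulus[OF that(1)] modulus[OF that(2)] using that \<sigma>_nonneg[of u]
      by (intro cmod_arc_pt_strict_mono) auto
    note less = this
    show ?left
      by (rule linorder_inj_onI') (use less[OF _ _ \<sigma>_mono] y_pos in force)
    show ?right
      by (rule linorder_inj_onI') (use less[OF _ _ \<sigma>_antimono] x_neg in force)
  qed
  have ends: "f (of_real x) = of_real b" "f (of_real y) = of_real b"
    "cmod (f 0 - of_real b) = cmod (arc_pt k (1 / 2) (tip T))"
  proof -
    have xy: "x \<le> y" "0 \<in> {x..y}"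
      using x_neg y_pos by auto
    show "f (of_real x) = of_real b" "f (of_real y) = of_real b"
      using f_middle[of x] f_middle[of y] xy by (simp_all add: \<sigma>_def arc_pt_def)
    show "cmod (f 0 - of_real b) = cmod (arc_pt k (1 / 2) (tip T))"
      using modulus[OF xy(2)] by (simp only: \<sigma>_0 of_real_0)
  qed
  have left: "\<exists>u. \<bar>u - x\<bar> < \<delta> \<and> Im (f (of_real u)) = 0 \<and> Re (f (of_real u)) < b" if "0 < \<delta>" for \<delta>
  proof -
    \<comment> \<open>For \<open>u \<le> x\<close> this is \<open>denom u\<close>, as the branch is
      negative there. Its positive value at \<open>x\<close> persists slightly to the left, which
      puts \<open>f u\<close> on the real line to the left of \<open>b\<close>.\<close>
    define d where "d u = k * u + nu l0 + k * sqrt ((x - u) * (y - u))" for u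
    have "(d \<longlongrightarrow> d x) (at_left x)"
      unfolding d_def by (intro tendsto_intros)
    moreover have "0 < d x"
      using n_pos[of x] x_neg y_pos by (simp add: d_def)
    ultimately have "\<forall>\<^sub>F u in at_left x. 0 < d u"
      by (rule order_tendstoD(1))
    moreover have "\<forall>\<^sub>F u in at_left x. u \<in> {x - \<delta><..<x}"
      using that by (intro eventually_at_leftI[of "x - \<delta>"]) auto
    ultimately have "\<forall>\<^sub>F u in at_left x. 0 < d u \<and> u \<in> {x - \<delta><..<x}"
      by eventually_elim simp
    then obtain u where u: "0 < d u" "x - \<delta> < u" "u < x"
      using eventually_happens'[OF trivial_limit_at_left_real] by fastforce
    have "f (of_real u) = of_real (b - sqrt ((x - u) * (y - u)) / d u / 2)"
      using u by (simp add: f_def denom_def branch_left d_def)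
    moreover have "0 < sqrt ((x - u) * (y - u)) / d u / 2"
      using u x_neg y_pos by simp
    ultimately show ?thesis
      using u(2,3) by (intro exI[of _ u]) (simp only: Re_complex_of_real Im_complex_of_real, simp)
  qed
  have right: "\<exists>u. \<bar>u - y\<bar> < \<delta> \<and> Im (f (of_real u)) = 0 \<and> b < Re (f (of_real u))" if "0 < \<delta>" for \<delta>
  proof -
    define d where "d u = k * u + nu l0 - k * sqrt ((u - x) * (u - y))" for u
    have "(d \<longlongrightarrow> d y) (at_right y)"
      unfolding d_def by (intro tendsto_intros)
    moreover have "0 < d y"
      using n_pos[of y] x_neg y_pos by (simp add: d_def)
    ultimately have "\<forall>\<^sub>F u in at_right y. 0 < d u"
      by (rule order_tendstoD(1))
    moreover have "\<forall>\<^sub>F u in at_right y. u \<in> {y<..<y + \<delta>}"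
      using that by (intro eventually_at_rightI[of _ "y + \<delta>"]) auto
    ultimately have "\<forall>\<^sub>F u in at_right y. 0 < d u \<and> u \<in> {y<..<y + \<delta>}"
      by eventually_elim simp
    then obtain u where u: "0 < d u" "y < u" "u < y + \<delta>"
      using eventually_happens'[OF trivial_limit_at_right_real] by fastforce
    have "f (of_real u) = of_real (b + sqrt ((u - x) * (u - y)) / d u / 2)"
      using u by (simp add: f_def denom_def branch_right d_def)
    moreover have "0 < sqrt ((u - x) * (u - y)) / d u / 2"
      using u x_neg y_pos by simp
    ultimately show ?thesis
      using u(2,3) by (intro exI[of _ u]) (simp only: Re_complex_of_real Im_complex_of_real, simp)
  qed
  have "force_points_end_at_base \<tau> T \<xi> V1 V2 h"
    by (rule force_points_end_at_baseI(2)[OF slit(2) \<tau>_eq T_pos gaps_tendsto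
          continuous_f loewner_map_eq image on_slit inj ends left right])
  then show ?thesis
    using hull_shape by blast
qed

end

theorem lemma6p1:
  fixes x y :: real
  assumes "x < 0" and "0 < y"
  shows "(\<forall>\<tau> \<xi> V1 V2 h.
            upwards_SLE0 (-2) (-2) 0 x y \<tau> \<xi> V1 V2 \<and> upwards_loewner_flow \<xi> \<tau> h \<longrightarrow>
            (\<exists>T. force_points_end_at_base \<tau> T \<xi> V1 V2 h \<and>
                 segment_at_angle (loewner_hull \<tau> h T) (upto_time \<tau> \<xi> T) (pi * y / (y - x)))) \<and>
         (\<forall>\<tau> \<xi> V1 V2 h.
            upwards_SLE0 (-3) (-3) 0 x y \<tau> \<xi> V1 V2 \<and> upwards_loewner_flow \<xi> \<tau> h \<longrightarrow>
            (\<exists>T. force_points_end_at_base \<tau> T \<xi> V1 V2 h \<and>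
                 (\<forall>t. 0 < t \<and> t \<le> T \<longrightarrow>
                    (if y = - x
                     then segment_at_angle (loewner_hull \<tau> h t) (upto_time \<tau> \<xi> t) (pi / 2)
                     else orthogonal_circular_arc (loewner_hull \<tau> h t) (upto_time \<tau> \<xi> t)))))"
proof (intro conjI allI impI)
  fix \<tau> \<xi> V1 V2 h
  assume "upwards_SLE0 (-2) (-2) 0 x y \<tau> \<xi> V1 V2 \<and> upwards_loewner_flow \<xi> \<tau> h"
  then interpret rho2_flow \<tau> \<xi> h x y V1 V2
    using assms by unfold_locales auto
  show "\<exists>T. force_points_end_at_base \<tau> T \<xi> V1 V2 h \<and>
      segment_at_angle (loewner_hull \<tau> h T) (upto_time \<tau> \<xi> T) (pi * y / (y - x))"
    by (rule hitting)
next
  fix \<tau> \<xi> V1 V2 h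
  assume "upwards_SLE0 (-3) (-3) 0 x y \<tau> \<xi> V1 V2 \<and> upwards_loewner_flow \<xi> \<tau> h"
  then interpret rho3_flow \<tau> \<xi> h x y V1 V2
    using assms by unfold_locales auto
  show "\<exists>T. force_points_end_at_base \<tau> T \<xi> V1 V2 h \<and>
      (\<forall>t. 0 < t \<and> t \<le> T \<longrightarrow>
        (if y = - x then segment_at_angle (loewner_hull \<tau> h t) (upto_time \<tau> \<xi> t) (pi / 2)
         else orthogonal_circular_arc (loewner_hull \<tau> h t) (upto_time \<tau> \<xi> t)))"
    by (rule hitting)
qed

end
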